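(* In the setting of the context, assume hypotheses (H1)--(H5) stated there and suppose that the sequence $P^n$ of time-invariant distributions of the processes $X^n$ is exponentially tight of order $n$. Let $\mathbf\Pi$ be an LD limit point of the sequence $P^n$. Then: 1. $\mathbf\Pi$ satisfies the max balance property $$\Phi_{\mathbf\Pi}(A',A'')=\Phi_{\mathbf\Pi}(A'',A')\quad\text{for any partition }\{A',A''\}\text{ of }A,$$ and the normalisation condition $\mathbf\Pi(A)=1$; these requirements uniquely specify the restriction of $\mathbf\Pi$ to $A$ (that is, if a deviability $\mathbf\Pi'$ on $\mathbb S$ satisfies $\Phi_{\mathbf\Pi'}(A',A'')=\Phi_{\mathbf\Pi'}(A'',A')$ for any partition $\{A',A''\}$ of $A$ and $\mathbf\Pi'(A)=1$, then $\mathbf\Pi'(a)=\mathbf\Pi(a)$ for all $a\in A$). 2. For all $x\in\mathbb S$, $\mathbf\Pi(x)=\Phi_{\mathbf\Pi}(A,x)$. 3. The sequence $P^n$ LD converges at rate $n$ to $\mathbf\Pi$.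
   Context: **Deviabilities.** Suprema over empty sets equal $0$. For a metric space $\mathbb E$, a deviability on $\mathbb E$ is a set function $\mathbf\Pi:\mathcal P(\mathbb E)\to[0,1]$ on the power set with $\mathbf\Pi(E)=\sup_{x\in E}\mathbf\Pi(x)$ for all $E\subset\mathbb E$, where $\mathbf\Pi(x)=\mathbf\Pi(\{x\})$ (the deviability density), such that $\sup_{x\in\mathbb E}\mathbf\Pi(x)=1$ and $\{x:\mathbf\Pi(x)\ge\gamma\}$ is compact for every $\gamma\in(0,1]$. A sequence $Q_n$ of Borel probability measures on $\mathbb E$ LD converges at rate $n$ to a deviability $\mathbf\Pi$ if $\lim_{n\to\infty}\bigl(\int_{\mathbb E}f(x)^nQ_n(dx)\bigr)^{1/n}=\sup_{x\in\mathbb E}f(x)\mathbf\Pi(x)$ for every bounded continuous $f:\mathbb E\to[0,\infty)$. The sequence $Q_n$ is exponentially tight of order $n$ if $\inf_{K}\limsup_{n\to\infty}Q_n(\mathbb E\setminus K)^{1/n}=0$, the infimum being over compact $K\subset\mathbb E$. An LD limit point of $Q_n$ is a deviability to which some subsequence $Q_{n'}$ LD converges at rate $n'$. **Setting.** $(\mathbb S,d)$ is a metric space; $\mathbb D(\mathbb R_+,\mathbb S)$ is the Skorohod space of right-continuous functions with left-hand limits. $X^n=(X^n_t,t\ge0)$, $n\in\mathbb N$, are stochastic processes with trajectories in $\mathbb D(\mathbb R_+,\mathbb S)$ defined on a complete probability space $(\Omega,\mathcal F,\mathbf P)$, and $P^n$ are Borel probability measures on $\mathbb S$ with $\mathbf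 P(X^n_t\in\Gamma)=P^n(\Gamma)$ for all Borel $\Gamma\subset\mathbb S$ and all $t\ge0$. **Hypotheses.** (H1) There exist versions of the regular conditional distributions $\mathbf P(X^n\in\cdot\,|X^n_0=x)$, $x\in\mathbb S$, such that whenever $x^n\to x$ with $x^n$ in the support of $P^n$, the distributions $\mathbf P(X^n\in\cdot\,|X^n_0=x^n)$ on $\mathbb D(\mathbb R_+,\mathbb S)$ LD converge at rate $n$ to a deviability $\mathbf\Pi_x$ on $\mathbb D(\mathbb R_+,\mathbb S)$ such that $\mathbf\Pi_x(X)=0$ unless $X$ is a continuous function. (Then $\mathbf\Pi_x(X)=0$ unless $X_0=x$.) (H2) $\mathbf\Pi_x(X)$ is upper semicontinuous in $(x,X)$, and $\bigcup_{x\in K}\{X:\mathbf\Pi_x(X)\ge\gamma\}$ is compact for all $\gamma\in(0,1]$ and all compact $K\subset\mathbb S$. (H3) For all $X\in\mathbb D(\mathbb R_+,\mathbb S)$ (and all $x\in\mathbb S$, $s\ge0$), $\mathbf\Pi_x(X)=\mathbf\Pi_x(\pi_s^{-1}(\pi_sX))\,\mathbf\Pi_{X_s}(\theta_sX)$, where $\pi_sX=(X_t,t\in[0,s])$ and $\theta_sX=(X_{s+t},t\ge0)$. Let $\Pi_{x,t}(y)=\sup\{\mathbf\Pi_x(X):X\in\mathbb D(\mathbb R_+,\mathbb S),X_t=y\}$ and $\Pi_{x,t}(\Gamma)=\sup_{y\in\Gamma}\Pi_{x,t}(y)$ for $\Gamma\subset\mathbb S$. (H4) There is a set $A\subset\mathbb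 S$ that is locally finite (every compact subset of $\mathbb S$ contains at most finitely many elements of $A$) such that: (1) if $\mathbf\Pi_x(X)=1$, then $\inf_{t\ge0}d(X_t,A)=0$; (2) if $X_t=a$ for all $t\ge0$, where $a\in A$, then $\mathbf\Pi_a(X)=1$; (3) if $a,a'\in A$, then $\Pi_{a,t}(a')>0$ for some $t>0$; (4) for any $\epsilon>0$ there exists $\delta>0$ such that if $d(x,A)<\delta$, then $\Pi_{x,s_0}(a)>1-\epsilon$ and $\Pi_{a,s_1}(x)>1-\epsilon$ for some $s_0>0$, $s_1>0$ and $a\in A$; (5) for any $x\in\mathbb S$ and $\epsilon>0$ there exist $\delta>0$, $t_0$ and $t_1$ such that $\Pi_{x,t_0}(x')>1-\epsilon$ and $\Pi_{x',t_1}(x)>1-\epsilon$ whenever $d(x,x')<\delta$. (H5) For any compact $K_1\subset\mathbb S$ and $\epsilon>0$ there exists a compact $K_2\subset\mathbb S$ such that $\limsup_{t\to\infty}\sup_{x\in K_1}\Pi_{x,t}(\mathbb S\setminus K_2)<\epsilon$. **Notation.** Under these hypotheses the limits $\Pi(x,y)=\lim_{t\to\infty}\Pi_{x,t}(y)$ exist for all $x,y\in\mathbb S$. For $\Gamma,\Gamma'\subset\mathbb S$, $\Pi(\Gamma,\Gamma')=\sup_{x\in\Gamma,\,y\in\Gamma'}\Pi(x,y)$; one-element sets are identified with their elements. For a deviability $\mathbf\Pi$ on $\mathbb S$, the max flux from $\Gamma$ to $\Gamma'$ is $\Phi_{\mathbf\Pi}(\Gamma,\Gamma')=\sup_{x\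in\Gamma}\mathbf\Pi(x)\Pi(x,\Gamma')$.
   Formalization: (H1) is assumed also along subsequences x^{n'} → x with x^{n'} in the support of P^{n'}; this follows from (H1) when every x is a limit of such x^n, and without it (H1) can be vacuous and the claim false (P^n alternating between two point masses). *)

theory Defs
  imports "HOL-Probability.Probability"
begin

text \<open>Suprema of sets of nonnegative reals, with the convention that the supremum of the empty
  set is zero (the library leaves \<open>Sup {} :: real\<close> unspecified).\<close>

definition sup0 :: "real set \<Rightarrow> real"
  where "sup0 S = (if S = {} then 0 else Sup S)"

definition deviability :: "('e::topological_space set \<Rightarrow> real) \<Rightarrow> bool"
  where "deviability D \<longleftrightarrow>
    (\<forall>E. 0 \<le> D E \<and> D E \<le> 1) \<and>
    (\<forall>E. D E = sup0 ((\<lambda>x. D {x}) ` E)) \<and>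
    sup0 (range (\<lambda>x. D {x})) = 1 \<and>
    (\<forall>\<gamma>. 0 < \<gamma> \<and> \<gamma> \<le> 1 \<longrightarrow> compact {x. \<gamma> \<le> D {x}})"

text \<open>\<open>ld_converges r Q D\<close>: the sequence \<open>Q 0, Q 1, \<dots>\<close> LD converges to \<open>D\<close> at rate \<open>r\<close>. The whole
  sequence of measures indexed by \<open>n\<close> is the case \<open>r = (\<lambda>n. n)\<close>; a subsequence with indices
  \<open>n' = r 0, r 1, \<dots>\<close> has the rate \<open>r\<close>.\<close>

definition ld_converges ::
    "(nat \<Rightarrow> nat) \<Rightarrow> (nat \<Rightarrow> 'e::topological_space measure) \<Rightarrow> ('e set \<Rightarrow> real) \<Rightarrow> bool"
  where "ld_converges r Q D \<longleftrightarrow>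
    (\<forall>f :: 'e \<Rightarrow> real. continuous_on UNIV f \<and> bounded (range f) \<and> (\<forall>x. 0 \<le> f x) \<longrightarrow>
      (\<lambda>k. root (r k) (\<integral>x. f x ^ r k \<partial>Q k)) \<longlonglongrightarrow> sup0 (range (\<lambda>x. f x * D {x})))"

definition ld_limit_point ::
    "(nat \<Rightarrow> 'e::topological_space measure) \<Rightarrow> ('e set \<Rightarrow> real) \<Rightarrow> bool"
  where "ld_limit_point Q D \<longleftrightarrow>
    deviability D \<and> (\<exists>r. strict_mono r \<and> ld_converges r (\<lambda>k. Q (r k)) D)"

definition exponentially_tight :: "(nat \<Rightarrow> 'e::topological_space measure) \<Rightarrow> bool"
  where "exponentially_tight Q \<longleftrightarrow>
    (INF K\<in>{K. compact K}. limsup (\<lambda>n. ereal (root n (measure (Q n) (- K))))) = 0"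

definition measure_support :: "'e::topological_space measure \<Rightarrow> 'e set"
  where "measure_support Q = {x. \<forall>U. open U \<and> x \<in> U \<longrightarrow> 0 < measure Q U}"

text \<open>\<open>\<kappa>\<close> is a version of the regular conditional distribution of \<open>Y\<close> given \<open>Z\<close>, that is,
  \<open>\<kappa> z\<close> is \<open>P(Y \<in> \<cdot> | Z = z)\<close>.\<close>

definition regular_conditional_distribution ::
    "'w measure \<Rightarrow> ('w \<Rightarrow> 'e::topological_space) \<Rightarrow> ('w \<Rightarrow> 'b::topological_space) \<Rightarrow>
      ('b \<Rightarrow> 'e measure) \<Rightarrow> bool"
  where "regular_conditional_distribution M Y Z \<kappa> \<longleftrightarrow>
    Y \<in> borel_measurable M \<and> Z \<in> borel_measurable M \<and>
    \<kappa> \<in> borel \<rightarrow>\<^sub>M prob_algebra borel \<and>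
    (\<forall>B\<in>sets borel. \<forall>\<Gamma>\<in>sets borel.
      measure M {\<omega> \<in> space M. Y \<omega> \<in> B \<and> Z \<omega> \<in> \<Gamma>} =
      (LINT z:\<Gamma>|distr M borel Z. measure (\<kappa> z) B))"

definition upper_semicontinuous :: "('e::topological_space \<Rightarrow> real) \<Rightarrow> bool"
  where "upper_semicontinuous f \<longleftrightarrow> (\<forall>c. open {x. f x < c})"

text \<open>Paths on the half-line are functions on the reals that are \<open>undefined\<close> at negative times, so
  that two paths are equal iff they agree on \<open>{0..}\<close>.\<close>

definition cadlag_paths :: "(real \<Rightarrow> 'a::topological_space) set"
  where "cadlag_paths = {X \<in> extensional {0..}.
    (\<forall>t\<ge>0. (X \<longlongrightarrow> X t) (at_right t)) \<and> (\<forall>t>0. \<exists>l. (X \<longlongrightarrow> l) (at_left t))}"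

lemma const_cadlag_paths: "restrict (\<lambda>_. a) {0..} \<in> cadlag_paths"
proof -
  have "(restrict (\<lambda>_. a) {0..} \<longlongrightarrow> restrict (\<lambda>_. a) {0..} t) (at_right t)" if "t \<ge> 0" for t :: real
    by (rule tendsto_eventually) (use that in \<open>auto simp: eventually_at_right_field intro: exI[of _ "t + 1"]\<close>)
  moreover have "(restrict (\<lambda>_. a) {0..} \<longlongrightarrow> a) (at_left t)" if "t > 0" for t :: real
    by (rule tendsto_eventually) (use that in \<open>auto simp: eventually_at_left_field intro: exI[of _ 0]\<close>)
  ultimately show ?thesis
    unfolding cadlag_paths_def by blast
qed

typedef (overloaded) ('a::topological_space) skorohod = "cadlag_paths :: (real \<Rightarrow> 'a) set"
  morphisms path_of Skorohod
  using const_cadlag_paths by blast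

definition time_changes :: "(real \<Rightarrow> real) set"
  where "time_changes = {l. strict_mono_on {0..} l \<and> l ` {0..} = {0..}}"

definition skorohod_nbhd :: "'a::metric_space skorohod \<Rightarrow> real \<Rightarrow> real \<Rightarrow> 'a skorohod set"
  where "skorohod_nbhd X T \<epsilon> = {Y. \<exists>l\<in>time_changes. \<forall>t\<in>{0..T}.
    \<bar>l t - t\<bar> < \<epsilon> \<and> dist (path_of Y t) (path_of X (l t)) < \<epsilon>}"

lemma skorohod_nbhd_mono:
  "T' \<le> T \<Longrightarrow> \<epsilon> \<le> \<epsilon>' \<Longrightarrow> skorohod_nbhd X T \<epsilon> \<subseteq> skorohod_nbhd X T' \<epsilon>'"
  unfolding skorohod_nbhd_def by (auto intro!: bexI order_less_le_trans[of _ \<epsilon> \<epsilon>'])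

text \<open>The Skorohod J1 topology. A sequence \<open>Y k\<close> converges to \<open>X\<close> in the usual (metrizable)
  topology iff, for every \<open>T\<close>, there are time changes \<open>l k\<close> with \<open>l k t - t\<close> and
  \<open>dist (path_of (Y k) t) (path_of X (l k t))\<close> tending to zero uniformly in \<open>t \<in> {0..T}\<close>
  (Ethier and Kurtz, Markov Processes, Proposition 3.5.3); that is, iff it is eventually in each
  \<open>skorohod_nbhd X T \<epsilon>\<close>. Hence a set is open iff with every \<open>X\<close> it contains such a set.\<close>

instantiation skorohod :: (metric_space) topological_space
begin

definition open_skorohod :: "'a skorohod set \<Rightarrow> bool"
  where "open_skorohod U \<longleftrightarrow> (\<forall>X\<in>U. \<exists>T>0. \<exists>\<epsilon>>0. skorohod_nbhd X T \<epsilon> \<subseteq> U)"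

instance
proof
  show "open (UNIV :: 'a skorohod set)"
    unfolding open_skorohod_def by (auto intro: exI[of _ 1])
next
  fix U V :: "'a skorohod set"
  assume UV: "open U" "open V"
  show "open (U \<inter> V)"
    unfolding open_skorohod_def
  proof
    fix X assume "X \<in> U \<inter> V"
    then obtain T1 e1 T2 e2 where *: "T1 > 0" "e1 > 0" "skorohod_nbhd X T1 e1 \<subseteq> U"
        "T2 > 0" "e2 > 0" "skorohod_nbhd X T2 e2 \<subseteq> V"
      using UV unfolding open_skorohod_def by (meson IntD1 IntD2)
    have "skorohod_nbhd X (max T1 T2) (min e1 e2) \<subseteq> U \<inter> V"
      using skorohod_nbhd_mono[of T1 "max T1 T2" "min e1 e2" e1 X]
        skorohod_nbhd_mono[of T2 "max T1 T2" "min e1 e2" e2 X] * by auto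
    then show "\<exists>T>0. \<exists>\<epsilon>>0. skorohod_nbhd X T \<epsilon> \<subseteq> U \<inter> V"
      using * by (intro exI[of _ "max T1 T2"] conjI exI[of _ "min e1 e2"]) auto
  qed
next
  fix \<U> :: "'a skorohod set set"
  assume "\<forall>U\<in>\<U>. open U"
  then show "open (\<Union>\<U>)"
    unfolding open_skorohod_def by (meson Sup_upper UnionE order_trans)
qed

end

definition time_shift :: "real \<Rightarrow> 'a::topological_space skorohod \<Rightarrow> 'a skorohod"
  where "time_shift s X = Skorohod (restrict (\<lambda>t. path_of X (s + t)) {0..})"

lemma path_of_time_shift:
  assumes "0 \<le> s" "0 \<le> t"
  shows "path_of (time_shift s X) t = path_of X (s + t)"
proof -
  let ?Y = "restrict (\<lambda>t. path_of X (s + t)) {0..}"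
  have X: "\<And>t. 0 \<le> t \<Longrightarrow> (path_of X \<longlongrightarrow> path_of X t) (at_right t)"
          "\<And>t. 0 < t \<Longrightarrow> \<exists>l. (path_of X \<longlongrightarrow> l) (at_left t)"
    using path_of[of X] unfolding cadlag_paths_def by auto
  have "(?Y \<longlongrightarrow> ?Y t) (at_right t)" if t: "0 \<le> t" for t
  proof -
    have "filterlim ((+) s) (at_right (s + t)) (at_right t)"
      by (auto simp: filterlim_at eventually_at_filter intro!: tendsto_eq_intros)
    from filterlim_compose[OF X(1) this]
    have "((\<lambda>u. path_of X (s + u)) \<longlongrightarrow> path_of X (s + t)) (at_right t)"
      using t \<open>0 \<le> s\<close> by simp
    moreover have "\<forall>\<^sub>F u in at_right t. path_of X (s + u) = ?Y u"
      using t by (auto simp: eventually_at_right_field intro: exI[of _ "t + 1"])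
    ultimately have "(?Y \<longlongrightarrow> path_of X (s + t)) (at_right t)"
      using tendsto_cong by fast
    then show ?thesis
      using t by simp
  qed
  moreover have "\<exists>l. (?Y \<longlongrightarrow> l) (at_left t)" if t: "0 < t" for t
  proof -
    obtain l where l: "(path_of X \<longlongrightarrow> l) (at_left (s + t))"
      using X(2)[of "s + t"] t \<open>0 \<le> s\<close> by auto
    have "filterlim ((+) s) (at_left (s + t)) (at_left t)"
      by (auto simp: filterlim_at eventually_at_filter intro!: tendsto_eq_intros)
    from filterlim_compose[OF l this]
    have "((\<lambda>u. path_of X (s + u)) \<longlongrightarrow> l) (at_left t)" .
    moreover have "\<forall>\<^sub>F u in at_left t. path_of X (s + u) = ?Y u"
      using t by (auto simp: eventually_at_left_field intro: exI[of _ 0])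
    ultimately show ?thesis
      using tendsto_cong by fast
  qed
  ultimately have "?Y \<in> cadlag_paths"
    unfolding cadlag_paths_def by blast
  then show ?thesis
    using assms by (simp add: time_shift_def Skorohod_inverse)
qed

text \<open>\<open>same_until s X\<close> is the inverse image of the restriction of \<open>X\<close> to \<open>{0..s}\<close> under the
  restriction map.\<close>

definition same_until :: "real \<Rightarrow> 'a::topological_space skorohod \<Rightarrow> 'a skorohod set"
  where "same_until s X = {Y. \<forall>t\<in>{0..s}. path_of Y t = path_of X t}"

text \<open>Below, \<open>D x\<close> is the deviability on the Skorohod space of the trajectories started at \<open>x\<close>;
  its density is \<open>D x {X}\<close>.\<close>

definition trans_dens ::
    "('a \<Rightarrow> 'a::topological_space skorohod set \<Rightarrow> real) \<Rightarrow> 'a \<Rightarrow> real \<Rightarrow> 'a \<Rightarrow> real"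
  where "trans_dens D x t y = sup0 ((\<lambda>X. D x {X}) ` {X. path_of X t = y})"

definition trans_set ::
    "('a \<Rightarrow> 'a::topological_space skorohod set \<Rightarrow> real) \<Rightarrow> 'a \<Rightarrow> real \<Rightarrow> 'a set \<Rightarrow> real"
  where "trans_set D x t \<Gamma> = sup0 (trans_dens D x t ` \<Gamma>)"

text \<open>Under the assumptions of the theorem the limit exists for the points \<open>x\<close> at which it is used;
  \<open>Lim\<close> is unspecified where the limit does not exist.\<close>

definition lim_dens ::
    "('a \<Rightarrow> 'a::topological_space skorohod set \<Rightarrow> real) \<Rightarrow> 'a \<Rightarrow> 'a \<Rightarrow> real"
  where "lim_dens D x y = Lim at_top (\<lambda>t. trans_dens D x t y)"

definition lim_set ::
    "('a \<Rightarrow> 'a::topological_space skorohod set \<Rightarrow> real) \<Rightarrow> 'a set \<Rightarrow> 'a set \<Rightarrow> real"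
  where "lim_set D \<Gamma> \<Gamma>' = sup0 {lim_dens D x y |x y. x \<in> \<Gamma> \<and> y \<in> \<Gamma>'}"

definition max_flux ::
    "('a \<Rightarrow> 'a::topological_space skorohod set \<Rightarrow> real) \<Rightarrow> ('a set \<Rightarrow> real) \<Rightarrow>
      'a set \<Rightarrow> 'a set \<Rightarrow> real"
  where "max_flux D E \<Gamma> \<Gamma>' = sup0 ((\<lambda>x. E {x} * lim_set D {x} \<Gamma>') ` \<Gamma>)"

definition max_balance ::
    "('a \<Rightarrow> 'a::topological_space skorohod set \<Rightarrow> real) \<Rightarrow> ('a set \<Rightarrow> real) \<Rightarrow> 'a set \<Rightarrow> bool"
  where "max_balance D E A \<longleftrightarrow>
    (\<forall>A' A''. A' \<noteq> {} \<and> A'' \<noteq> {} \<and> A' \<inter> A'' = {} \<and> A' \<union> A'' = A \<longrightarrow>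
      max_flux D E A' A'' = max_flux D E A'' A')"

end

theory Submission
  imports Defs "HOL-Complex_Analysis.Great_Picard"
begin

text \<open>
  Write \<open>e x = E {x}\<close> for the density of an LD limit point along a subsequence, and \<open>reach x y\<close> for the
  largest weight \<open>D x {Y}\<close> of a trajectory \<open>Y\<close> that passes through \<open>y\<close> at some time. Stationarity says
  that the law of \<open>X n\<close> at time \<open>t\<close> is \<open>P n\<close>, so on the exponential scale the probability that the
  process starts near \<open>x\<close> and is near \<open>y\<close> at time \<open>t\<close> has the rate \<open>e x\<close> times the best weight of a
  trajectory from \<open>x\<close> to \<open>y\<close> (\<open>joint_ball_lower\<close>, \<open>joint_limit_pair\<close>). All that follows is
  deterministic, except for one identity: the probability of leaving a set \<open>B\<close> between the times
  \<open>0\<close> and \<open>t\<close> equals the probability of entering it (\<open>joint_flux\<close>).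

  Two consequences of stationarity drive the proof. First, \<open>e x * reach x y \<le> e y\<close>
  (\<open>e_reach\<close>), so a trajectory of noticeable weight cannot leave the compact superlevel sets of
  \<open>e\<close>. Second, every \<open>y\<close> is the end of arbitrarily long trajectories whose weight,
  multiplied by \<open>e\<close> at the start, is almost \<open>e y\<close> (\<open>long_path_exists\<close>). Now a trajectory of
  weight one comes close to \<open>A\<close>; by compactness a trajectory of weight close to one comes
  close to \<open>A\<close> within a uniform time (\<open>near_A_uniform\<close>); and a very long trajectory whose
  weight is bounded below has a piece of weight close to one. Hence long trajectories pass near \<open>A\<close>
  and lose little when they are diverted through a point of \<open>A\<close> (\<open>long_path_via_A\<close>). This yields
  \<open>e y = sup {e a * reach a y | a \<in> A}\<close>, which is the second claim, and the normalisation.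

  For the balance between the parts \<open>A1\<close> and \<open>A2\<close> of \<open>A\<close>, suppose that the flux \<open>u\<close> from \<open>A1\<close> to \<open>A2\<close>
  exceeds the flux \<open>v\<close> back. Pick \<open>v'\<close> between them and let \<open>B\<close> be the set of points \<open>x\<close> with
  \<open>sup {e x * reach x a | a \<in> A1} \<ge> v'\<close>. The probability of leaving \<open>B\<close> has a rate above \<open>v'\<close>, hence
  so has the probability of entering \<open>B\<close>. A long trajectory that realises the entrance passes near
  some \<open>d \<in> A\<close>. The point \<open>d\<close> cannot be in \<open>A1\<close> because the trajectory starts outside \<open>B\<close>, and if it is
  in \<open>A2\<close> then the flux from \<open>A2\<close> through the entrance point into \<open>A1\<close> exceeds \<open>v\<close>
  when \<open>v'\<close> is close to \<open>u\<close> (\<open>crossing_contradiction\<close>).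

  Balance and normalisation determine the values on \<open>A\<close>: if two solutions differ, the flux
  between the set where the first is larger and its complement grows strictly in one direction and
  does not grow in the other (\<open>max_balance_le\<close>). With the second claim, they determine \<open>e\<close>. Since
  exponentially tight sequences are sequentially compact for LD convergence
  (\<open>exists_local_ld_subsequence\<close>), the whole sequence converges.
\<close>

section \<open>Suprema, exponential comparison and bump functions\<close>

lemma sup0_upper: "bdd_above S \<Longrightarrow> x \<in> S \<Longrightarrow> x \<le> sup0 S"
  unfolding sup0_def by (auto intro: cSup_upper)

lemma sup0_least: "(\<And>x. x \<in> S \<Longrightarrow> x \<le> c) \<Longrightarrow> 0 \<le> c \<Longrightarrow> sup0 S \<le> c"
  unfolding sup0_def by (auto intro: cSup_least)

lemma less_sup0: "0 \<le> c \<Longrightarrow> c < sup0 S \<Longrightarrow> \<exists>x\<in>S. c < x"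
  using sup0_least[of S c] by force

lemma sup0_nonneg: "(\<And>x. x \<in> S \<Longrightarrow> 0 \<le> x) \<Longrightarrow> bdd_above S \<Longrightarrow> 0 \<le> sup0 S"
  by (cases "S = {}") (auto simp: sup0_def intro: cSup_upper2)

lemma eventually_mult_power_le:
  fixes a b C :: real
  assumes r: "strict_mono (r :: nat \<Rightarrow> nat)" and ab: "0 \<le> a" "a < b"
  shows "\<forall>\<^sub>F k in sequentially. C * a ^ r k \<le> b ^ r k"
proof -
  have "(\<lambda>n. C * (a / b) ^ n) \<longlonglongrightarrow> C * 0"
    using ab by (intro tendsto_mult tendsto_const LIMSEQ_realpow_zero) auto
  then have "((\<lambda>n. C * (a / b) ^ n) \<circ> r) \<longlonglongrightarrow> 0"
    using LIMSEQ_subseq_LIMSEQ[OF _ r] by fastforce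
  then have "\<forall>\<^sub>F k in sequentially. C * (a / b) ^ r k < 1"
    by (intro order_tendstoD) (auto simp: o_def)
  then show ?thesis
    proof eventually_elim
    case (elim k)
    then show ?case using ab by (simp add: power_divide field_simps)
  qed
qed

text \<open>The largest-term principle: finitely many terms of order \<open>a ^ r k\<close> add up to less than
  \<open>b ^ r k\<close> for any \<open>b > a\<close>, so a local exponential bound passes to compact sets by a finite subcover.
  The set function \<open>\<mu>\<close> is arbitrary, and the predicate \<open>R\<close> keeps the cover inside a class of sets for
  which \<open>\<mu>\<close> makes sense.\<close>

lemma finite_cover_sum_le:
  fixes \<mu> :: "'b::topological_space set \<Rightarrow> nat \<Rightarrow> real"
  assumes r: "strict_mono r" and K: "compact K" and ab: "0 \<le> a" "a < b"
    and loc: "\<And>x. x \<in> K \<Longrightarrow> \<exists>U. x \<in> U \<and> open U \<and> R U \<and> (\<forall>\<^sub>F k in sequentially. \<mu> U k \<le> a ^ r k)"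
  obtains \<U> where "finite \<U>" "K \<subseteq> \<Union>\<U>" "\<And>U. U \<in> \<U> \<Longrightarrow> open U \<and> R U"
    "\<forall>\<^sub>F k in sequentially. (\<Sum>U\<in>\<U>. \<mu> U k) \<le> b ^ r k"
proof -
  obtain u where u: "\<And>x. x \<in> K \<Longrightarrow> x \<in> u x \<and> open (u x) \<and> R (u x) \<and>
      (\<forall>\<^sub>F k in sequentially. \<mu> (u x) k \<le> a ^ r k)"
    using loc by metis
  obtain F where F: "F \<subseteq> K" "finite F" "K \<subseteq> \<Union>(u ` F)"
  proof (rule compactE_image[OF K, of K u])
    show "open (u x)" if "x \<in> K" for x using u[OF that] by blast
    show "K \<subseteq> \<Union>(u ` K)" using u by blast
  qed
  have "\<forall>\<^sub>F k in sequentially. \<forall>x\<in>F. \<mu> (u x) k \<le> a ^ r k"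
    using F u by (intro eventually_ball_finite) auto
  moreover have "\<forall>\<^sub>F k in sequentially. real (card (u ` F)) * a ^ r k \<le> b ^ r k"
    by (rule eventually_mult_power_le[OF r ab])
  ultimately have "\<forall>\<^sub>F k in sequentially. (\<Sum>U\<in>u ` F. \<mu> U k) \<le> b ^ r k"
  proof eventually_elim
    case (elim k)
    have "(\<Sum>U\<in>u ` F. \<mu> U k) \<le> (\<Sum>U\<in>u ` F. a ^ r k)"
      using elim by (intro sum_mono) auto
    with elim show ?case by simp
  qed
  then show thesis
    using F u by (intro that[of "u ` F"]) auto
qed

text \<open>A Lipschitz function that is one on \<open>ball x (\<rho> / 2)\<close> and vanishes outside \<open>ball x \<rho>\<close>; it trades
  the indicators of balls for the continuous functions on which LD convergence is tested.\<close>

definition bump :: "'a::metric_space \<Rightarrow> real \<Rightarrow> 'a \<Rightarrow> real"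
  where "bump x \<rho> z = max 0 (min 1 (2 - 2 * dist x z / \<rho>))"

lemma bump_range: "0 \<le> bump x \<rho> z" "bump x \<rho> z \<le> 1"
  by (auto simp: bump_def)

lemma bump_center: "bump x \<rho> x = 1"
  by (simp add: bump_def)

lemma bump_eq_1: "0 < \<rho> \<Longrightarrow> z \<in> ball x (\<rho> / 2) \<Longrightarrow> bump x \<rho> z = 1"
  by (auto simp: bump_def field_simps)

lemma bump_pos: "0 < \<rho> \<Longrightarrow> 0 < bump x \<rho> z \<Longrightarrow> z \<in> ball x \<rho>"
  by (auto simp: bump_def field_simps max_def min_def split: if_splits)

lemma bump_lipschitz:
  assumes "0 < \<rho>"
  shows "(2 / \<rho>)-lipschitz_on UNIV (bump x \<rho>)"
proof (rule lipschitz_onI)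
  fix y z
  have clip: "\<bar>max 0 (min 1 u) - max 0 (min 1 v)\<bar> \<le> \<bar>u - v\<bar>" for u v :: real
    by linarith
  have "\<bar>dist x y - dist x z\<bar> \<le> dist y z"
    using dist_triangle[of x y z] dist_triangle[of x z y] by (simp add: dist_commute abs_le_iff)
  then have "2 / \<rho> * \<bar>dist x z - dist x y\<bar> \<le> 2 / \<rho> * dist y z"
    using assms by (intro mult_left_mono) auto
  moreover have "2 * dist x z / \<rho> - 2 * dist x y / \<rho> = 2 / \<rho> * (dist x z - dist x y)"
    by (simp add: right_diff_distrib)
  moreover have "\<bar>2 / \<rho> * (dist x z - dist x y)\<bar> = 2 / \<rho> * \<bar>dist x z - dist x y\<bar>"
    using assms by (simp only: abs_mult) simp
  ultimately have "\<bar>2 * dist x z / \<rho> - 2 * dist x y / \<rho>\<bar> \<le> 2 / \<rho> * dist y z"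
    by metis
  moreover have "dist (bump x \<rho> y) (bump x \<rho> z) \<le> \<bar>(2 - 2 * dist x y / \<rho>) - (2 - 2 * dist x z / \<rho>)\<bar>"
    unfolding bump_def dist_real_def by (rule clip)
  ultimately show "dist (bump x \<rho> y) (bump x \<rho> z) \<le> 2 / \<rho> * dist y z"
    by linarith
qed (use assms in auto)

lemma continuous_bump: "0 < \<rho> \<Longrightarrow> continuous_on S (bump x \<rho>)"
  using lipschitz_on_continuous_on[OF bump_lipschitz] continuous_on_subset by blast

section \<open>LD convergence on balls\<close>

lemma (in prob_space) integrable_bounded_nonneg:
  fixes f :: "'a \<Rightarrow> real"
  shows "f \<in> borel_measurable M \<Longrightarrow> (\<And>x. 0 \<le> f x) \<Longrightarrow> (\<And>x. f x \<le> C) \<Longrightarrow> integrable M f"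
  by (rule integrable_const_bound[where B = C]) auto

text \<open>The exponential rate of small balls. For exponentially tight sequences this is
  equivalent to LD convergence. The bounds compare powers instead of roots, so that they can be added
  and multiplied.\<close>

definition local_ld :: "(nat \<Rightarrow> nat) \<Rightarrow> (nat \<Rightarrow> 'a::metric_space measure) \<Rightarrow> ('a \<Rightarrow> real) \<Rightarrow> bool"
  where "local_ld r P e \<longleftrightarrow>
    (\<forall>x. 0 \<le> e x) \<and>
    (\<forall>x c \<rho>. 0 \<le> c \<and> c < e x \<and> 0 < \<rho> \<longrightarrow>
      (\<forall>\<^sub>F k in sequentially. c ^ r k \<le> measure (P (r k)) (ball x \<rho>))) \<and>
    (\<forall>x c. e x < c \<longrightarrow>
      (\<exists>\<rho>>0. \<forall>\<^sub>F k in sequentially. measure (P (r k)) (ball x \<rho>) \<le> c ^ r k))"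

lemma local_ldD:
  assumes "local_ld r P e"
  shows local_ld_nonneg: "0 \<le> e x"
    and local_ld_lower: "0 \<le> c \<Longrightarrow> c < e x \<Longrightarrow> 0 < \<rho> \<Longrightarrow>
      \<forall>\<^sub>F k in sequentially. c ^ r k \<le> measure (P (r k)) (ball x \<rho>)"
    and local_ld_upper: "e x < c \<Longrightarrow>
      \<exists>\<rho>>0. \<forall>\<^sub>F k in sequentially. measure (P (r k)) (ball x \<rho>) \<le> c ^ r k"
  using assms unfolding local_ld_def by auto

lemma deviability_density:
  assumes "deviability E"
  shows "0 \<le> E S" "E S \<le> 1" "E S = sup0 ((\<lambda>x. E {x}) ` S)" "sup0 (range (\<lambda>x. E {x})) = 1"
    "0 < \<gamma> \<Longrightarrow> compact {x. \<gamma> \<le> E {x}}"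
proof -
  show "0 \<le> E S" "E S \<le> 1" "E S = sup0 ((\<lambda>x. E {x}) ` S)" "sup0 (range (\<lambda>x. E {x})) = 1"
    using assms unfolding deviability_def by blast+
  assume "0 < \<gamma>"
  show "compact {x. \<gamma> \<le> E {x}}"
  proof (cases "\<gamma> \<le> 1")
    case True
    then show ?thesis using assms \<open>0 < \<gamma>\<close> unfolding deviability_def by blast
  next
    case False
    have "E {x} \<le> 1" for x using assms unfolding deviability_def by blast
    then have "{x. \<gamma> \<le> E {x}} = {}" using False by (auto simp: not_le intro: le_less_trans)
    then show ?thesis by simp
  qed
qed

lemma bdd_above_mult_deviability:
  assumes E: "deviability E" and f: "\<And>x. 0 \<le> f x" "\<And>x. f x \<le> C"
  shows "bdd_above (range (\<lambda>x. f x * E {x}))"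
proof (rule bdd_aboveI2)
  fix x show "f x * E {x} \<le> C"
    using f[of x] deviability_density(1,2)[OF E, of "{x}"]
    by (meson mult_left_le order_trans)
qed

lemma ld_converges_integral_bounds:
  assumes ld: "ld_converges r Q E" and r: "strict_mono r"
    and f: "continuous_on UNIV f" "\<And>x. 0 \<le> f x" "\<And>x. f x \<le> 1"
  shows ld_converges_integral_lower:
      "0 \<le> c \<Longrightarrow> c < sup0 (range (\<lambda>x. f x * E {x})) \<Longrightarrow>
        \<forall>\<^sub>F k in sequentially. c ^ r k \<le> (\<integral>x. f x ^ r k \<partial>Q k)"
    and ld_converges_integral_upper:
      "sup0 (range (\<lambda>x. f x * E {x})) < c \<Longrightarrow>
        \<forall>\<^sub>F k in sequentially. (\<integral>x. f x ^ r k \<partial>Q k) \<le> c ^ r k"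
proof -
  have "bounded (range f)" using f by (intro boundedI[of _ 1]) auto
  then have lim: "(\<lambda>k. root (r k) (\<integral>x. f x ^ r k \<partial>Q k)) \<longlonglongrightarrow> sup0 (range (\<lambda>x. f x * E {x}))"
    using ld f unfolding ld_converges_def by blast
  have pos: "\<forall>\<^sub>F k in sequentially. 0 < r k"
    using filterlim_subseq[OF r] eventually_gt_at_top[of 0] unfolding filterlim_iff by blast
  have nn: "0 \<le> (\<integral>x. f x ^ r k \<partial>Q k)" for k
    using f by (intro integral_nonneg_AE) auto
  show "\<forall>\<^sub>F k in sequentially. c ^ r k \<le> (\<integral>x. f x ^ r k \<partial>Q k)"
    if "0 \<le> c" "c < sup0 (range (\<lambda>x. f x * E {x}))"
    using order_tendstoD(1)[OF lim that(2)] pos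
  proof eventually_elim
    case (elim k)
    then have "c ^ r k \<le> root (r k) (\<integral>x. f x ^ r k \<partial>Q k) ^ r k"
      using that by (intro power_mono) auto
    then show ?case using elim nn[of k] by simp
  qed
  show "\<forall>\<^sub>F k in sequentially. (\<integral>x. f x ^ r k \<partial>Q k) \<le> c ^ r k"
    if "sup0 (range (\<lambda>x. f x * E {x})) < c"
    using order_tendstoD(2)[OF lim that] pos
  proof eventually_elim
    case (elim k)
    then have "root (r k) (\<integral>x. f x ^ r k \<partial>Q k) ^ r k \<le> c ^ r k"
      using nn[of k] by (intro power_mono) auto
    then show ?case using elim nn[of k] by simp
  qed
qed

text \<open>Chebyshev bounds on the exponential scale: for \<open>0 \<le> f \<le> 1\<close> the integral of \<open>f ^ n\<close> lies between the
  probabilities of \<open>{x. 1 \<le> f x}\<close> and \<open>{x. 0 < f x}\<close>.\<close>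

lemma ld_converges_event_bounds:
  assumes ld: "ld_converges r Q E" and r: "strict_mono r"
    and Q: "\<And>k. prob_space (Q k)" "\<And>k. sets (Q k) = sets borel"
    and E: "deviability E"
    and f: "continuous_on UNIV f" "\<And>x. 0 \<le> f x" "\<And>x. f x \<le> 1"
  shows ld_converges_event_lower:
      "0 \<le> c \<Longrightarrow> c < f x * E {x} \<Longrightarrow>
        \<forall>\<^sub>F k in sequentially. c ^ r k \<le> measure (Q k) {x. 0 < f x}"
    and ld_converges_event_upper:
      "(\<And>x. f x * E {x} \<le> c') \<Longrightarrow> c' < c \<Longrightarrow> 
        \<forall>\<^sub>F k in sequentially. measure (Q k) {x. 1 \<le> f x} \<le> c ^ r k"
proof -
  note [measurable] = borel_measurable_continuous_onI[OF f(1)]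
  have meas: "f \<in> borel_measurable (Q k)" for k
    using Q(2) by (simp cong: measurable_cong_sets)
  have sp: "space (Q k) = UNIV" for k using Q(2)[of k] by (metis sets_eq_imp_space_eq space_borel)
  have int: "integrable (Q k) (\<lambda>x. f x ^ n)" for k n
  proof -
    interpret prob_space "Q k" by (rule Q)
    show ?thesis using meas[of k] f by (intro integrable_bounded_nonneg[of _ 1]) (auto simp: power_le_one)
  qed
  have pos: "\<forall>\<^sub>F k in sequentially. 0 < r k"
    using filterlim_subseq[OF r] eventually_gt_at_top[of 0] unfolding filterlim_iff by blast
  show "\<forall>\<^sub>F k in sequentially. c ^ r k \<le> measure (Q k) {x. 0 < f x}"
    if c: "0 \<le> c" "c < f x * E {x}"
  proof -
    have "c < sup0 (range (\<lambda>x. f x * E {x}))"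
      using c(2) sup0_upper[OF bdd_above_mult_deviability[OF E f(2,3), of "\<lambda>x. x"], of "f x * E {x}"] by auto
    from ld_converges_integral_lower[OF ld r f c(1) this] pos
    show ?thesis
    proof eventually_elim
      case (elim k)
      interpret prob_space "Q k" by (rule Q)
      have s: "{x. 0 < f x} \<in> sets (Q k)" unfolding Q(2) by measurable
      have "(\<integral>x. f x ^ r k \<partial>Q k) \<le> (\<integral>x. indicator {x. 0 < f x} x \<partial>Q k)"
      proof (rule integral_mono[OF int])
        show "f x ^ r k \<le> indicator {x. 0 < f x} x" for x
          using f(2)[of x] f(3)[of x] elim(2)
          by (cases "f x = 0") (auto simp: indicator_def power_le_one zero_power)
      qed (use s in \<open>simp add: emeasure_eq_measure\<close>)
      also have "\<dots> = measure (Q k) {x. 0 < f x}" using s sp by simp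
      finally show ?case using elim by simp
    qed
  qed
  show "\<forall>\<^sub>F k in sequentially. measure (Q k) {x. 1 \<le> f x} \<le> c ^ r k"
    if c: "\<And>x. f x * E {x} \<le> c'" "c' < c"
  proof -
    have "0 \<le> c'" using c(1) f(2) deviability_density(1)[OF E] by (metis mult_nonneg_nonneg order_trans)
    then have "sup0 (range (\<lambda>x. f x * E {x})) \<le> c'"
      using c by (intro sup0_least) auto
    then have "sup0 (range (\<lambda>x. f x * E {x})) < c" using c by simp
    from ld_converges_integral_upper[OF ld r f this] 
    show ?thesis
    proof eventually_elim
      case (elim k)
      interpret prob_space "Q k" by (rule Q)
      have s: "{x. 1 \<le> f x} \<in> sets (Q k)" unfolding Q(2) by measurable
      have "measure (Q k) {x. 1 \<le> f x} = (\<integral>x. indicator {x. 1 \<le> f x} x \<partial>Q k)" using s sp by simp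
      also have "\<dots> \<le> (\<integral>x. f x ^ r k \<partial>Q k)"
      proof (rule integral_mono[OF _ int])
        show "indicator {x. 1 \<le> f x} x \<le> f x ^ r k" for x
          using f(2)[of x] by (auto simp: indicator_def)
      qed (use s in \<open>simp add: emeasure_eq_measure\<close>)
      finally show ?case using elim by simp
    qed
  qed
qed

lemma ld_converges_imp_local_ld:
  fixes P :: "nat \<Rightarrow> 'a::metric_space measure"
  assumes ld: "ld_converges r (\<lambda>k. P (r k)) E" and r: "strict_mono r"
    and P: "\<And>n. prob_space (P n)" "\<And>n. sets (P n) = sets borel"
    and E: "deviability E"
  shows "local_ld r P (\<lambda>x. E {x})"
  unfolding local_ld_def
proof (intro conjI allI impI)
  fix x show "0 \<le> E {x}" by (rule deviability_density(1)[OF E])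
next
  fix x c \<rho> :: real and y :: 'a
  assume "0 \<le> c \<and> c < E {y} \<and> 0 < \<rho>"
  then have *: "0 \<le> c" "c < bump y \<rho> y * E {y}" "0 < \<rho>" by (auto simp: bump_center)
  have sub: "{z. 0 < bump y \<rho> z} \<subseteq> ball y \<rho>" using bump_pos[OF *(3)] by blast
  from ld_converges_event_lower[OF ld r P E continuous_bump[OF *(3)] bump_range *(1,2)]
  show "\<forall>\<^sub>F k in sequentially. c ^ r k \<le> measure (P (r k)) (ball y \<rho>)"
  proof eventually_elim
    case (elim k)
    interpret prob_space "P (r k)" by (rule P)
    have "measure (P (r k)) {z. 0 < bump y \<rho> z} \<le> measure (P (r k)) (ball y \<rho>)"
      by (intro finite_measure_mono sub) (simp add: P)
    with elim show ?case by simp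
  qed
next
  fix y c assume c: "E {y} < c"
  obtain c' where c': "E {y} < c'" "c' < c" using dense[OF c] by auto
  have "0 < c'" using c'(1) deviability_density(1)[OF E, of "{y}"] by simp
  then have "open (- {z. c' \<le> E {z}})"
    using compact_imp_closed[OF deviability_density(5)[OF E]] by (simp add: open_Compl)
  then obtain \<rho> where \<rho>: "0 < \<rho>" "ball y \<rho> \<subseteq> - {z. c' \<le> E {z}}"
    using c'(1) by (metis (no_types, lifting) ComplI mem_Collect_eq not_le open_contains_ball)
  have *: "bump y \<rho> z * E {z} \<le> c'" for z
  proof (cases "0 < bump y \<rho> z")
    case True
    then have "E {z} < c'" using bump_pos[OF \<rho>(1)] \<rho>(2) by force
    moreover have "bump y \<rho> z * E {z} \<le> 1 * E {z}"
      by (intro mult_right_mono bump_range deviability_density(1)[OF E])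
    ultimately show ?thesis by simp
  next
    case False
    then have "bump y \<rho> z = 0" using bump_range(1)[of y \<rho> z] by simp
    then show ?thesis using \<open>0 < c'\<close> by simp
  qed
  have sub: "ball y (\<rho> / 2) \<subseteq> {z. 1 \<le> bump y \<rho> z}" using bump_eq_1[OF \<rho>(1)] by fastforce
  have "\<forall>\<^sub>F k in sequentially. measure (P (r k)) (ball y (\<rho> / 2)) \<le> c ^ r k"
    using ld_converges_event_upper[OF ld r P E continuous_bump[OF \<rho>(1)] bump_range * c'(2)]
  proof eventually_elim
    case (elim k)
    interpret prob_space "P (r k)" by (rule P)
    have [measurable]: "bump y \<rho> \<in> borel_measurable borel"
      by (intro borel_measurable_continuous_onI continuous_bump \<rho>)
    have "{z. 1 \<le> bump y \<rho> z} \<in> sets (P (r k))" unfolding P(2) by measurable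
    then have "measure (P (r k)) (ball y (\<rho> / 2)) \<le> measure (P (r k)) {z. 1 \<le> bump y \<rho> z}"
      by (intro finite_measure_mono sub)
    with elim show ?case by simp
  qed
  then show "\<exists>\<rho>>0. \<forall>\<^sub>F k in sequentially. measure (P (r k)) (ball y \<rho>) \<le> c ^ r k"
    using \<rho>(1) by (intro exI[of _ "\<rho> / 2"]) auto
qed

section \<open>Exponentially tight sequences\<close>

lemma eventually_power_contradiction:
  fixes a b :: real
  assumes r: "strict_mono r" and ab: "0 \<le> a" "a < b"
    and lo: "\<forall>\<^sub>F k in sequentially. b ^ r k \<le> f k" and up: "\<forall>\<^sub>F k in sequentially. f k \<le> a ^ r k"
  shows False
proof -
  have "\<forall>\<^sub>F k in sequentially. 2 * a ^ r k \<le> b ^ r k"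
    by (rule eventually_mult_power_le[OF r ab])
  moreover have "\<forall>\<^sub>F k in sequentially. 0 < b ^ r k"
    using ab by (intro always_eventually) auto
  ultimately have "\<forall>\<^sub>F k in sequentially. False"
    using lo up by eventually_elim linarith
  then show False by simp
qed

lemma eventually_subseq_pos: "strict_mono (r :: nat \<Rightarrow> nat) \<Longrightarrow> \<forall>\<^sub>F k in sequentially. 0 < r k"
  using eventually_subseq[OF _ eventually_gt_at_top[of 0]] by blast

lemma open_measure_support_compl: "open (- measure_support Q)"
proof -
  have "- measure_support Q = \<Union>{U. open U \<and> measure Q U = 0}"
    unfolding measure_support_def by (auto simp: zero_less_measure_iff)
  then show ?thesis by (metis (no_types, lifting) mem_Collect_eq open_Union)
qed

locale tight_sequence =
  fixes P :: "nat \<Rightarrow> 'a::metric_space measure"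
  assumes prob_P: "\<And>n. prob_space (P n)"
    and sets_P: "\<And>n. sets (P n) = sets borel"
    and tight: "exponentially_tight P"
begin

lemma space_P: "space (P n) = UNIV"
  using sets_eq_imp_space_eq[OF sets_P[of n]] by simp

lemma tight_compact:
  assumes r: "strict_mono r" and c: "0 < c"
  shows "\<exists>K. compact K \<and> (\<forall>\<^sub>F k in sequentially. measure (P (r k)) (- K) \<le> c ^ r k)"
proof -
  have "(INF K\<in>{K. compact K}. limsup (\<lambda>n. ereal (root n (measure (P n) (- K))))) < ereal c"
    using tight c unfolding exponentially_tight_def by simp
  then obtain K where K: "compact K" "limsup (\<lambda>n. ereal (root n (measure (P n) (- K)))) < ereal c"
    by (auto simp: INF_less_iff)
  have "\<forall>\<^sub>F n in sequentially. ereal (root n (measure (P n) (- K))) < ereal c"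
    using Limsup_lessD[OF K(2)] .
  from eventually_subseq[OF r this] eventually_subseq_pos[OF r]
  have "\<forall>\<^sub>F k in sequentially. measure (P (r k)) (- K) \<le> c ^ r k"
  proof eventually_elim
    case (elim k)
    then have "root (r k) (measure (P (r k)) (- K)) ^ r k \<le> c ^ r k"
      by (intro power_mono) auto
    then show ?case using elim by simp
  qed
  with K show ?thesis by blast
qed

text \<open>The complement \<open>O'\<close> of the support is a union of open null sets. In a space that is not
  separable it may have positive measure, but its part in a compact set \<open>K\<close> is exhausted by the compact
  sets of points of \<open>K\<close> whose distance to the support is at least \<open>1 / Suc m\<close>, and each of these is
  covered by finitely many null sets.\<close>

lemma compact_off_support_null:
  assumes K: "compact K"
  shows "measure (P n) (K - measure_support (P n)) = 0"
proof -
  interpret prob_space "P n" by (rule prob_P)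
  define O' where "O' = - measure_support (P n)"
  define C where "C m = {x. ball x (1 / Suc m) \<subseteq> O'}" for m
  have closed: "closed (C m)" for m
  proof -
    have "- C m = (\<Union>y\<in>- O'. ball y (1 / Suc m))"
      by (auto simp: C_def dist_commute subset_iff)
    then show ?thesis by (metis closed_open open_UN open_ball)
  qed
  have UN: "K - measure_support (P n) = (\<Union>m. K \<inter> C m)"
  proof
    show "K - measure_support (P n) \<subseteq> (\<Union>m. K \<inter> C m)"
    proof
      fix x assume x: "x \<in> K - measure_support (P n)"
      then obtain \<epsilon> where "0 < \<epsilon>" "ball x \<epsilon> \<subseteq> O'"
        using open_measure_support_compl[of "P n"] unfolding O'_def open_contains_ball by blast
      moreover obtain m where "1 / Suc m < \<epsilon>" using nat_approx_posE[OF \<open>0 < \<epsilon>\<close>] .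
      ultimately have "x \<in> C m" unfolding C_def using subset_ball[of "1 / Suc m" \<epsilon> x] by auto
      then show "x \<in> (\<Union>m. K \<inter> C m)" using x by blast
    qed
    have "C m \<subseteq> O'" for m
      unfolding C_def by auto
    then show "(\<Union>m. K \<inter> C m) \<subseteq> K - measure_support (P n)"
      unfolding O'_def by blast
  qed
  have "K \<inter> C m \<in> null_sets (P n)" for m
  proof -
    have cpt: "compact (K \<inter> C m)" using K closed by (rule compact_Int_closed)
    let ?\<N> = "{U. open U \<and> measure (P n) U = 0}"
    have "K \<inter> C m \<subseteq> \<Union>?\<N>"
    proof
      fix x assume "x \<in> K \<inter> C m"
      then have "x \<in> O'" unfolding C_def by auto
      then show "x \<in> \<Union>?\<N>"
        unfolding O'_def measure_support_def by (auto simp: zero_less_measure_iff)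
    qed
    then obtain T where T: "T \<subseteq> ?\<N>" "finite T" "K \<inter> C m \<subseteq> \<Union>T"
      using compactE[OF cpt] by (metis (no_types, lifting) mem_Collect_eq)
    have "\<Union>T \<in> null_sets (P n)"
      using T by (intro null_sets.finite_Union) (auto simp: null_sets_def sets_P emeasure_eq_measure)
    then show ?thesis
      by (rule null_sets_subset) (use T cpt in \<open>auto simp: sets_P borel_compact\<close>)
  qed
  then have "(\<Union>m. K \<inter> C m) \<in> null_sets (P n)" by (intro null_sets_UN) auto
  then show ?thesis unfolding UN by (simp add: null_sets_def measure_def)
qed

text \<open>The kernels are controlled at points of the support only. This is enough since the rest of the
  space carries no mass on the exponential scale.\<close>

lemma off_support_small:
  assumes r: "strict_mono r" and c: "0 < c"
  shows "\<forall>\<^sub>F k in sequentially. measure (P (r k)) (- measure_support (P (r k))) \<le> c ^ r k"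
proof -
  obtain K where K: "compact K" "\<forall>\<^sub>F k in sequentially. measure (P (r k)) (- K) \<le> c ^ r k"
    using tight_compact[OF r c] by blast
  show ?thesis using K(2)
  proof eventually_elim
    case (elim k)
    interpret prob_space "P (r k)" by (rule prob_P)
    have s: "- measure_support (P (r k)) \<in> sets borel" 
      by (intro borel_open open_measure_support_compl)
    have "K - measure_support (P (r k)) \<in> sets borel"
      unfolding Diff_eq by (rule sets.Int[OF borel_compact[OF K(1)] s])
    then have "measure (P (r k)) (- measure_support (P (r k)))
        \<le> measure (P (r k)) ((K - measure_support (P (r k))) \<union> - K)"
      using K(1) borel_compact[OF K(1)] by (intro finite_measure_mono) (auto simp: sets_P)
    also have "\<dots> \<le> measure (P (r k)) (K - measure_support (P (r k))) + measure (P (r k)) (- K)"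
      using \<open>K - measure_support (P (r k)) \<in> sets borel\<close> borel_compact[OF K(1)]
      by (intro measure_Un_le) (auto simp: sets_P)
    finally show ?case using compact_off_support_null[OF K(1)] elim by simp
  qed
qed

lemma local_ld_le_of_open:
  assumes ld: "local_ld r P e" and r: "strict_mono r" and U: "open U" "x \<in> U"
    and c: "0 \<le> c" and up: "\<forall>\<^sub>F k in sequentially. measure (P (r k)) U \<le> c ^ r k"
  shows "e x \<le> c"
proof (rule ccontr)
  assume "\<not> e x \<le> c"
  then obtain b where b: "c < b" "b < e x" using dense[of c "e x"] by auto
  obtain \<sigma> where \<sigma>: "0 < \<sigma>" "ball x \<sigma> \<subseteq> U" using U openE by blast
  have "0 \<le> b" using c b by simp
  have "\<forall>\<^sub>F k in sequentially. b ^ r k \<le> measure (P (r k)) U"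
    using local_ld_lower[OF ld \<open>0 \<le> b\<close> b(2) \<sigma>(1)]
  proof eventually_elim
    case (elim k)
    interpret prob_space "P (r k)" by (rule prob_P)
    have "measure (P (r k)) (ball x \<sigma>) \<le> measure (P (r k)) U"
      using U \<sigma> by (intro finite_measure_mono) (auto simp: sets_P)
    with elim show ?case by simp
  qed
  then show False using eventually_power_contradiction[OF r c b(1) _ up] by blast
qed

lemma local_ld_le_1:
  assumes "local_ld r P e" "strict_mono r"
  shows "e x \<le> 1"
proof (rule local_ld_le_of_open[OF assms open_UNIV])
  show "\<forall>\<^sub>F k in sequentially. measure (P (r k)) UNIV \<le> 1 ^ r k"
    using prob_space.prob_le_1[OF prob_P] by (intro always_eventually) auto
qed auto

lemma local_ld_usc:
  assumes ld: "local_ld r P e" and r: "strict_mono r"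
  shows "open {x. e x < c}"
  unfolding open_contains_ball
proof (intro ballI)
  fix x assume "x \<in> {x. e x < c}"
  then obtain c' where c': "e x < c'" "c' < c" using dense[of "e x" c] by auto
  obtain \<rho> where \<rho>: "0 < \<rho>" "\<forall>\<^sub>F k in sequentially. measure (P (r k)) (ball x \<rho>) \<le> c' ^ r k"
    using local_ld_upper[OF ld c'(1)] by blast
  have c'0: "0 \<le> c'" using local_ld_nonneg[OF ld, of x] c' by simp
  have "e y \<le> c'" if "y \<in> ball x \<rho>" for y
    by (rule local_ld_le_of_open[OF ld r open_ball that c'0 \<rho>(2)])
  then show "\<exists>\<rho>>0. ball x \<rho> \<subseteq> {x. e x < c}"
    using c' \<rho>(1) by (intro exI[of _ \<rho>]) fastforce
qed

lemma local_ld_compact: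
  assumes ld: "local_ld r P e" and r: "strict_mono r" and \<gamma>: "0 < \<gamma>"
  shows "compact {x. \<gamma> \<le> e x}"
proof -
  obtain K where K: "compact K" "\<forall>\<^sub>F k in sequentially. measure (P (r k)) (- K) \<le> (\<gamma> / 2) ^ r k"
    using tight_compact[OF r, of "\<gamma> / 2"] \<gamma> by auto
  have "e x \<le> \<gamma> / 2" if "x \<notin> K" for x
    using local_ld_le_of_open[OF ld r _ _ _ K(2), of x] that \<gamma> compact_imp_closed[OF K(1)] by auto
  then have "{x. \<gamma> \<le> e x} = K \<inter> - {x. e x < \<gamma>}" using \<gamma> by fastforce
  moreover have "closed (- {x. e x < \<gamma>})" using local_ld_usc[OF ld r] by (simp add: closed_open)
  ultimately show ?thesis using compact_Int_closed[OF K(1)] by simp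
qed

text \<open>If the density were bounded by \<open>c < 1\<close>, finitely many balls of exponentially small probability
  would cover almost all of the mass.\<close>

lemma local_ld_sup:
  assumes ld: "local_ld r P e" and r: "strict_mono r" and c: "c < 1"
  shows "\<exists>x. c < e x"
proof (rule ccontr)
  assume "\<nexists>x. c < e x"
  then have le: "e x \<le> c" for x by (simp add: not_less)
  have c0: "0 \<le> c" using local_ld_nonneg[OF ld] le order_trans by blast
  obtain a where a: "c < a" "a < 1" using dense[OF c] by blast
  obtain b where b: "a < b" "b < 1" using dense[OF a(2)] by blast
  obtain K where K: "compact K" "\<forall>\<^sub>F k in sequentially. measure (P (r k)) (- K) \<le> b ^ r k"
    using tight_compact[OF r, of b] a b c0 by auto
  have "\<exists>U. x \<in> U \<and> open U \<and> True \<and> (\<forall>\<^sub>F k in sequentially. measure (P (r k)) U \<le> a ^ r k)" for x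
    using local_ld_upper[OF ld, of x a] le[of x] a by (meson centre_in_ball le_less_trans open_ball)
  then obtain \<U> where \<U>: "finite \<U>" "K \<subseteq> \<Union>\<U>" "\<And>U. U \<in> \<U> \<Longrightarrow> open U \<and> True"
      "\<forall>\<^sub>F k in sequentially. (\<Sum>U\<in>\<U>. measure (P (r k)) U) \<le> b ^ r k"
    using finite_cover_sum_le[OF r K(1) _ b(1), of "\<lambda>_. True" "\<lambda>U k. measure (P (r k)) U"] a c0 by auto
  have "\<forall>\<^sub>F k in sequentially. 1 \<le> 2 * b ^ r k"
    using \<U>(4) K(2)
  proof eventually_elim
    case (elim k)
    interpret prob_space "P (r k)" by (rule prob_P)
    have Kb: "- K \<in> sets borel" using borel_compact[OF K(1)] by auto
    have Ub: "\<Union>\<U> \<in> sets borel" using \<U>(3) by (intro borel_open open_Union) auto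
    have "1 = measure (P (r k)) UNIV" using prob_space space_P by metis
    also have "\<dots> \<le> measure (P (r k)) (\<Union>\<U> \<union> - K)"
      using \<U>(2) Ub Kb by (intro finite_measure_mono) (auto simp: sets_P)
    also have "\<dots> \<le> measure (P (r k)) (\<Union>\<U>) + measure (P (r k)) (- K)"
      using Ub Kb by (intro measure_Un_le) (auto simp: sets_P)
    also have "measure (P (r k)) (\<Union>\<U>) \<le> (\<Sum>U\<in>\<U>. measure (P (r k)) U)"
      using measure_UNION_le[OF \<U>(1), of "\<lambda>U. U" "P (r k)"] \<U>(3) by (auto simp: sets_P)
    finally show ?case using elim by simp
  qed
  moreover have "\<forall>\<^sub>F k in sequentially. 4 * b ^ r k \<le> 1 ^ r k"
    using a b c0 by (intro eventually_mult_power_le[OF r]) auto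
  ultimately have "\<forall>\<^sub>F k in sequentially. False" by eventually_elim simp
  then show False by simp
qed

lemma local_ld_deviability:
  assumes ld: "local_ld r P e" and r: "strict_mono r"
  shows "deviability (\<lambda>S. sup0 (e ` S))"
proof -
  have single: "sup0 (e ` {x}) = e x" for x by (simp add: sup0_def)
  have bdd: "bdd_above (e ` S)" for S
    using local_ld_le_1[OF ld r] by (intro bdd_aboveI2) 
  have "sup0 (range e) = 1"
  proof (rule antisym)
    show "sup0 (range e) \<le> 1" using local_ld_le_1[OF ld r] by (intro sup0_least) auto
    show "1 \<le> sup0 (range e)"
    proof (rule dense_le)
      fix c :: real assume "c < 1"
      then obtain x where "c < e x" using local_ld_sup[OF ld r] by blast
      then show "c \<le> sup0 (range e)" using sup0_upper[OF bdd[of UNIV], of "e x"] by auto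
    qed
  qed
  then show ?thesis
    unfolding deviability_def single
    using local_ld_nonneg[OF ld] local_ld_le_1[OF ld r] bdd local_ld_compact[OF ld r]
    by (auto intro!: sup0_nonneg sup0_least)
qed

text \<open>Laplace's principle. Near a point \<open>x\<close> the integral of \<open>f ^ n\<close> has the rate \<open>f x * E {x}\<close>, by
  the continuity of \<open>f\<close> and the rate of balls; a finite cover of a compact set that carries all but
  a negligible part of the integral leaves the largest of these rates.\<close>

lemma local_ld_imp_ld_converges:
  assumes ld: "local_ld r P (\<lambda>x. E {x})" and r: "strict_mono r" and E: "deviability E"
  shows "ld_converges r (\<lambda>k. P (r k)) E"
  unfolding ld_converges_def
proof (intro allI impI, elim conjE)
  fix f :: "'a \<Rightarrow> real"
  assume f: "continuous_on UNIV f" "bounded (range f)" "\<forall>x. 0 \<le> f x"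
  obtain C where C: "0 < C" "\<And>x. f x \<le> C"
  proof -
    obtain C where "0 < C" "\<forall>x\<in>range f. norm x \<le> C" using f(2) unfolding bounded_pos by blast
    then show thesis using that[of C] by (auto simp: abs_le_iff)
  qed
  let ?L = "sup0 (range (\<lambda>x. f x * E {x}))"
  have [measurable]: "f \<in> borel_measurable borel" by (rule borel_measurable_continuous_onI[OF f(1)])
  have fP: "f \<in> borel_measurable (P n)" for n by (simp add: sets_P cong: measurable_cong_sets)
  have int: "integrable (P n) (\<lambda>x. indicator U x * f x ^ m)" if "U \<in> sets borel" for U n m
  proof -
    interpret prob_space "P n" by (rule prob_P)
    have "indicator U x * f x ^ m \<le> C ^ m" for x
      using f(3) C(2)[of x] C(1) by (auto simp: indicator_def power_mono)
    moreover have "(\<lambda>x. indicator U x * f x ^ m) \<in> borel_measurable (P n)"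
      using that fP by (intro borel_measurable_times borel_measurable_power borel_measurable_indicator) (auto simp: sets_P)
    ultimately show ?thesis using f(3)
      by (intro integrable_bounded_nonneg[of _ "C ^ m"]) auto
  qed
  have int1: "integrable (P n) (\<lambda>x. f x ^ m)" for n m using int[of UNIV n m] by simp
  have nn: "0 \<le> (\<integral>x. f x ^ n \<partial>P m)" for n m using f(3) by (intro integral_nonneg_AE) auto
  have Edev: "0 \<le> E {x}" "E {x} \<le> 1" for x by (rule deviability_density(1)[OF E] deviability_density(2)[OF E])+
  have bdd: "bdd_above (range (\<lambda>x. f x * E {x}))"
    using f(3) C(2) by (intro bdd_above_mult_deviability[OF E, of f C]) auto
  show "(\<lambda>k. root (r k) (\<integral>x. f x ^ r k \<partial>P (r k))) \<longlonglongrightarrow> ?L"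
  proof (rule order_tendstoI)
    fix a assume a: "a < ?L"
    show "\<forall>\<^sub>F k in sequentially. a < root (r k) (\<integral>x. f x ^ r k \<partial>P (r k))"
    proof (cases "0 \<le> a")
      case False
      have "a < root (r k) (\<integral>x. f x ^ r k \<partial>P (r k))" for k
        using real_root_ge_zero[OF nn, of "r k" "r k" "r k"] False by linarith
      then show ?thesis by simp
    next
      case True
      then obtain x where x: "a < f x * E {x}" using less_sup0[OF True a] by auto
      then have pos: "0 < f x" "0 < E {x}"
        using True f(3)[rule_format, of x] Edev(1)[of x] by (auto simp: less_le)
      \<comment> \<open>Split \<open>c\<close> as \<open>\<phi> * c'\<close> with \<open>\<phi> < f x\<close> and \<open>c' < E {x}\<close>.\<close>
      obtain c where c: "a < c" "c < f x * E {x}" using dense[OF x] by blast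
      then have "c / f x < E {x}" using pos by (simp add: field_simps)
      then obtain c' where c': "c / f x < c'" "c' < E {x}" using dense by blast
      have "0 < c" using True c by simp
      then have "0 < c'" using c'(1) pos by (meson divide_pos_pos less_trans)
      define \<phi> where "\<phi> = c / c'"
      have \<phi>: "0 < \<phi>" "\<phi> < f x" "\<phi> * c' = c"
        using \<open>0 < c\<close> \<open>0 < c'\<close> c' pos by (auto simp: \<phi>_def field_simps)
      have "open (f -` {\<phi><..})" using f(1) by (simp add: open_vimage)
      then obtain \<rho> where \<rho>: "0 < \<rho>" "ball x \<rho> \<subseteq> f -` {\<phi><..}"
        using \<phi> openE[of "f -` {\<phi><..}" x] by auto
      have "0 \<le> c'" using \<open>0 < c'\<close> by simp
      from local_ld_lower[OF ld \<open>0 \<le> c'\<close> c'(2) \<rho>(1)] eventually_subseq_pos[OF r]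
      show ?thesis
      proof eventually_elim
        case (elim k)
        interpret prob_space "P (r k)" by (rule prob_P)
        have "c ^ r k = \<phi> ^ r k * c' ^ r k" using \<phi>(3) by (simp add: power_mult_distrib[symmetric])
        also have "\<dots> \<le> \<phi> ^ r k * measure (P (r k)) (ball x \<rho>)"
          using elim \<phi> by (intro mult_left_mono) auto
        also have "\<dots> = (\<integral>z. \<phi> ^ r k * indicator (ball x \<rho>) z \<partial>P (r k))"
          using space_P by (simp add: sets_P)
        also have "\<dots> \<le> (\<integral>z. f z ^ r k \<partial>P (r k))"
        proof (rule integral_mono[OF _ int1])
          show "\<phi> ^ r k * indicator (ball x \<rho>) z \<le> f z ^ r k" for z
          proof (cases "z \<in> ball x \<rho>")
            case True
            then have "\<phi> \<le> f z" using \<rho>(2) by (auto intro: less_imp_le)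
            then show ?thesis using \<phi>(1) by (auto simp: indicator_def intro!: power_mono)
          qed (use f(3) in auto)
        qed (simp add: sets_P emeasure_eq_measure)
        finally have "root (r k) (c ^ r k) \<le> root (r k) (\<integral>z. f z ^ r k \<partial>P (r k))"
          using elim by simp
        moreover have "root (r k) (c ^ r k) = c" using elim \<open>0 < c\<close> by (simp add: real_root_power_cancel)
        ultimately show ?case using c by simp
      qed
    qed
  next
    fix a assume a: "?L < a"
    have L0: "0 \<le> ?L" using f(3) Edev by (intro sup0_nonneg bdd) auto
    obtain c where c: "?L < c" "c < a" using dense[OF a] by blast
    obtain c2 where c2: "c < c2" "c2 < a" using dense[OF c(2)] by blast
    obtain c3 where c3: "c2 < c3" "c3 < a" using dense[OF c2(2)] by blast
    have "0 < c" using L0 c by simp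
    obtain K where K: "compact K" "\<forall>\<^sub>F k in sequentially. measure (P (r k)) (- K) \<le> (c / C) ^ r k"
      using tight_compact[OF r, of "c / C"] \<open>0 < c\<close> C by auto
    let ?\<mu> = "\<lambda>U k. \<integral>x. indicator U x * f x ^ r k \<partial>P (r k)"
    have "\<exists>U. x \<in> U \<and> open U \<and> True \<and> (\<forall>\<^sub>F k in sequentially. ?\<mu> U k \<le> c ^ r k)" for x
    proof -
      have "f x * E {x} < c" using c sup0_upper[OF bdd, of "f x * E {x}"] by auto
      obtain c' where c': "E {x} < c'" "f x * c' < c"
      proof (cases "f x = 0")
        case True then show thesis using that[of "E {x} + 1"] \<open>0 < c\<close> by simp
      next
        case False
        then have "0 < f x" using f(3) by (simp add: less_le)
        then have "E {x} < c / f x" using \<open>f x * E {x} < c\<close> by (simp add: field_simps)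
        then obtain c' where "E {x} < c'" "c' < c / f x" using dense by blast
        then show thesis using that[of c'] \<open>0 < f x\<close> by (simp add: field_simps)
      qed
      have "0 < c'" using Edev(1)[of x] c' by simp
      define \<phi> where "\<phi> = c / c'"
      have \<phi>: "f x < \<phi>" "\<phi> * c' = c"
        using \<open>0 < c\<close> \<open>0 < c'\<close> c' by (auto simp: \<phi>_def field_simps)
      obtain \<rho>1 where \<rho>1: "0 < \<rho>1" "\<forall>\<^sub>F k in sequentially. measure (P (r k)) (ball x \<rho>1) \<le> c' ^ r k"
        using local_ld_upper[OF ld c'(1)] by blast
      have op: "open (f -` {..<\<phi>})" using f(1) by (simp add: open_vimage)
      let ?U = "ball x \<rho>1 \<inter> f -` {..<\<phi>}"
      have U: "?U \<in> sets borel" using op by (intro borel_open) auto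
      have "\<forall>\<^sub>F k in sequentially. ?\<mu> ?U k \<le> c ^ r k"
        using \<rho>1(2)
      proof eventually_elim
        case (elim k)
        interpret prob_space "P (r k)" by (rule prob_P)
        have "?\<mu> ?U k \<le> (\<integral>z. \<phi> ^ r k * indicator (ball x \<rho>1) z \<partial>P (r k))"
        proof (rule integral_mono[OF int[OF U]])
          show "indicator ?U z * f z ^ r k \<le> \<phi> ^ r k * indicator (ball x \<rho>1) z" for z
            using f(3) \<phi>(1) by (auto simp: indicator_def intro!: power_mono) (meson f(3) le_less_trans less_imp_le order.trans zero_le_power)
        qed (simp add: sets_P emeasure_eq_measure)
        also have "\<dots> = \<phi> ^ r k * measure (P (r k)) (ball x \<rho>1)"
          using space_P by (simp add: sets_P)
        also have "\<dots> \<le> \<phi> ^ r k * c' ^ r k"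
          using elim f(3) \<phi>(1) by (intro mult_left_mono zero_le_power) (auto intro: order_trans less_imp_le)
        also have "\<dots> = c ^ r k" using \<phi>(2) by (simp add: power_mult_distrib[symmetric])
        finally show ?case .
      qed
      then show ?thesis using \<rho>1 \<phi> op by (intro exI[of _ ?U]) auto
    qed
    then obtain \<U> where \<U>: "finite \<U>" "K \<subseteq> \<Union>\<U>" "\<And>U. U \<in> \<U> \<Longrightarrow> open U \<and> True"
        "\<forall>\<^sub>F k in sequentially. (\<Sum>U\<in>\<U>. ?\<mu> U k) \<le> c2 ^ r k"
      using finite_cover_sum_le[OF r K(1) _ c2(1), of "\<lambda>_. True" ?\<mu>] \<open>0 < c\<close> by auto
    have "\<forall>\<^sub>F k in sequentially. 2 * c2 ^ r k \<le> c3 ^ r k"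
      using \<open>0 < c\<close> c2 c3 by (intro eventually_mult_power_le[OF r]) auto
    with \<U>(4) K(2) eventually_subseq_pos[OF r]
    show "\<forall>\<^sub>F k in sequentially. root (r k) (\<integral>x. f x ^ r k \<partial>P (r k)) < a"
    proof eventually_elim
      case (elim k)
      interpret prob_space "P (r k)" by (rule prob_P)
      have Kb: "- K \<in> sets borel" using borel_compact[OF K(1)] by auto
      have "(\<integral>z. f z ^ r k \<partial>P (r k)) \<le>
          (\<integral>z. (\<Sum>U\<in>\<U>. indicator U z * f z ^ r k) + C ^ r k * indicator (- K) z \<partial>P (r k))"
      proof (rule integral_mono[OF int1])
        show "integrable (P (r k)) (\<lambda>z. (\<Sum>U\<in>\<U>. indicator U z * f z ^ r k) + C ^ r k * indicator (- K) z)"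
          using \<U>(3) int Kb by (auto intro!: Bochner_Integration.integrable_add Bochner_Integration.integrable_sum simp: sets_P emeasure_eq_measure)
        show "f z ^ r k \<le> (\<Sum>U\<in>\<U>. indicator U z * f z ^ r k) + C ^ r k * indicator (- K) z" for z
        proof (cases "z \<in> K")
          case True
          then obtain U where "U \<in> \<U>" "z \<in> U" using \<U>(2) by blast
          then have "f z ^ r k \<le> (\<Sum>U\<in>\<U>. indicator U z * f z ^ r k)"
            using member_le_sum[of U \<U> "\<lambda>U. indicator U z * f z ^ r k"] \<U>(1) f(3) by auto
          then show ?thesis using True by simp
        next
          case False
          have "0 \<le> (\<Sum>U\<in>\<U>. indicator U z * f z ^ r k)" using f(3) by (intro sum_nonneg) auto
          moreover have "f z ^ r k \<le> C ^ r k" using f(3) C(2) by (intro power_mono) auto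
          ultimately show ?thesis using False by simp
        qed
      qed
      also have "\<dots> = (\<Sum>U\<in>\<U>. ?\<mu> U k) + C ^ r k * measure (P (r k)) (- K)"
        using \<U>(3) int Kb space_P
        by (subst Bochner_Integration.integral_add) (auto simp: Bochner_Integration.integral_sum sets_P emeasure_eq_measure)
      also have "\<dots> \<le> c2 ^ r k + C ^ r k * (c / C) ^ r k"
        using elim C by (intro add_mono mult_left_mono) auto
      also have "C ^ r k * (c / C) ^ r k = c ^ r k" using C by (simp add: power_mult_distrib[symmetric])
      also have "c2 ^ r k + c ^ r k \<le> 2 * c2 ^ r k" using \<open>0 < c\<close> c2 by (simp add: power_mono)
      also have "\<dots> \<le> c3 ^ r k" using elim by simp
      finally have "root (r k) (\<integral>z. f z ^ r k \<partial>P (r k)) \<le> root (r k) (c3 ^ r k)"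
        using elim by simp
      moreover have "root (r k) (c3 ^ r k) = c3" using elim \<open>0 < c\<close> c2 c3 by (simp add: real_root_power_cancel)
      ultimately show ?case using c3 by simp
    qed
  qed
qed

text \<open>Exponential tightness leaves a sigma-compact set outside which the density vanishes. That set
  has a countable base \<open>\<B>\<close> of balls, and a diagonal subsequence makes the rates of all balls of
  \<open>\<B>\<close> converge. The density at \<open>x\<close> is the infimum of the limits over the balls of \<open>\<B>\<close> around \<open>x\<close>.\<close>

lemma exists_local_ld_subsequence:
  assumes r: "strict_mono (r :: nat \<Rightarrow> nat)"
  shows "\<exists>s e. strict_mono s \<and> local_ld (r \<circ> s) P e"
proof -
  have id: "strict_mono (\<lambda>n::nat. n)" by (simp add: strict_mono_def)
  have "\<exists>K. compact K \<and> (\<forall>\<^sub>F n in sequentially. measure (P n) (- K) \<le> (1 / Suc j) ^ n)" for j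
    using tight_compact[OF id, of "1 / Suc j"] by simp
  then obtain K where K: "\<And>j. compact (K j)"
      "\<And>j. \<forall>\<^sub>F n in sequentially. measure (P n) (- K j) \<le> (1 / Suc j) ^ n"
    by metis
  have "\<exists>F. finite F \<and> K j \<subseteq> (\<Union>q\<in>F. ball q (1 / Suc m))" for j m
    using compact_eq_totally_bounded[of "K j"] K(1)[of j] by (metis of_nat_0_less_iff zero_less_Suc zero_less_divide_1_iff)
  then obtain F where F: "\<And>j m. finite (F j m)" "\<And>j m. K j \<subseteq> (\<Union>q\<in>F j m. ball q (1 / Suc m))"
    by metis
  define \<B> where "\<B> = (\<Union>j m. (\<lambda>q. ball q (1 / Suc m)) ` F j m)"
  have countable: "countable \<B>" unfolding \<B>_def by (intro countable_UN countable_image countable_finite[OF F(1)] countableI_type)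
  have \<B>_open: "open B" if "B \<in> \<B>" for B using that unfolding \<B>_def by auto
  have basis: "\<exists>B\<in>\<B>. x \<in> B \<and> B \<subseteq> ball x \<rho>" if x: "x \<in> K j" and "0 < \<rho>" for x j \<rho>
  proof -
    obtain m where m: "1 / Suc m < \<rho> / 2" using nat_approx_posE[of "\<rho> / 2"] \<open>0 < \<rho>\<close> by auto
    obtain q where q: "q \<in> F j m" "x \<in> ball q (1 / Suc m)" using F(2) x by blast
    have "ball q (1 / Suc m) \<subseteq> ball x \<rho>"
    proof
      fix z assume "z \<in> ball q (1 / Suc m)"
      then show "z \<in> ball x \<rho>" using q(2) m dist_triangle[of x z q] by (simp add: dist_commute)
    qed
    then show ?thesis using q unfolding \<B>_def by blast
  qed
  let ?a = "\<lambda>k::nat. \<lambda>B. root (r k) (measure (P (r k)) B)"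
  have "norm (?a k B) \<le> 1" for k :: nat and B
    using prob_space.prob_le_1[OF prob_P[of "r k"]] by (cases "r k = 0") (auto simp: real_root_ge_zero)
  then obtain s where s: "strict_mono s" "\<And>B. B \<in> \<B> \<Longrightarrow> \<exists>l. (\<lambda>k. ?a (s k) B) \<longlonglongrightarrow> l"
    using function_convergent_subsequence[OF countable, of ?a 1] by blast
  then obtain \<alpha> where \<alpha>: "\<And>B. B \<in> \<B> \<Longrightarrow> (\<lambda>k. ?a (s k) B) \<longlonglongrightarrow> \<alpha> B" by metis
  have \<alpha>0: "0 \<le> \<alpha> B" if "B \<in> \<B>" for B
    using LIMSEQ_le_const[OF \<alpha>[OF that], of 0] by (auto simp: real_root_ge_zero)
  \<comment> \<open>The element \<open>1\<close>, an upper bound of all rates, only makes the infimum one of a nonempty set.\<close>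
  define e where "e x = (if x \<in> (\<Union>j. K j) then Inf (insert 1 (\<alpha> ` {B \<in> \<B>. x \<in> B})) else 0)" for x
  have bdd: "bdd_below (insert 1 (\<alpha> ` {B \<in> \<B>. x \<in> B}))" for x
    using \<alpha>0 by (intro bdd_belowI[of _ 0]) auto
  have r': "strict_mono (r \<circ> s)" using r s(1) by (rule strict_mono_o)
  have "local_ld (r \<circ> s) P e"
    unfolding local_ld_def
  proof (intro conjI allI impI; (elim conjE)?)
    fix x show "0 \<le> e x" using \<alpha>0 unfolding e_def by (auto intro!: cInf_greatest)
  next
    fix x and c \<rho> :: real assume c: "0 \<le> c" "c < e x" "0 < \<rho>"
    then have x: "x \<in> (\<Union>j. K j)" unfolding e_def by (auto split: if_splits)
    then obtain B where B: "B \<in> \<B>" "x \<in> B" "B \<subseteq> ball x \<rho>" using basis[OF _ c(3)] by blast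
    have "e x \<le> \<alpha> B" using x B bdd unfolding e_def by (auto intro!: cInf_lower)
    then have "\<forall>\<^sub>F k in sequentially. c < ?a (s k) B"
      using c by (intro order_tendstoD(1)[OF \<alpha>[OF B(1)]]) simp
    then show "\<forall>\<^sub>F k in sequentially. c ^ (r \<circ> s) k \<le> measure (P ((r \<circ> s) k)) (ball x \<rho>)"
      using eventually_subseq_pos[OF r']
    proof eventually_elim
      case (elim k)
      interpret prob_space "P ((r \<circ> s) k)" by (rule prob_P)
      have "c ^ r (s k) \<le> ?a (s k) B ^ r (s k)" using elim c by (intro power_mono) auto
      also have "\<dots> = measure (P (r (s k))) B" using elim by simp
      also have "\<dots> \<le> measure (P ((r \<circ> s) k)) (ball x \<rho>)"
        using B(3) finite_measure_mono[of B "ball x \<rho>"] by (simp add: sets_P)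
      finally show ?case by simp
    qed
  next
    fix x c assume c: "e x < c"
    show "\<exists>\<rho>>0. \<forall>\<^sub>F k in sequentially. measure (P ((r \<circ> s) k)) (ball x \<rho>) \<le> c ^ (r \<circ> s) k"
    proof (cases "x \<in> (\<Union>j. K j)")
      case False
      then have "0 < c" using c unfolding e_def by (simp split: if_splits)
      then obtain j where j: "1 / Suc j < c" by (metis nat_approx_posE)
      have "open (- K j)" using compact_imp_closed[OF K(1)] by auto
      then obtain \<rho> where \<rho>: "0 < \<rho>" "ball x \<rho> \<subseteq> - K j" using False openE[of "- K j" x] by auto
      have "\<forall>\<^sub>F k in sequentially. measure (P ((r \<circ> s) k)) (ball x \<rho>) \<le> c ^ (r \<circ> s) k"
        using eventually_subseq[OF r' K(2)[of j]]
      proof eventually_elim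
        case (elim k)
        interpret prob_space "P ((r \<circ> s) k)" by (rule prob_P)
        have "measure (P ((r \<circ> s) k)) (ball x \<rho>) \<le> measure (P ((r \<circ> s) k)) (- K j)"
          using \<rho>(2) borel_compact[OF K(1)[of j]] by (intro finite_measure_mono) (auto simp: sets_P)
        also note elim
        also have "(1 / Suc j) ^ (r \<circ> s) k \<le> c ^ (r \<circ> s) k" using j by (intro power_mono) auto
        finally show ?case .
      qed
      then show ?thesis using \<rho> by blast
    next
      case True
      then have "Inf (insert 1 (\<alpha> ` {B \<in> \<B>. x \<in> B})) < c" using c by (simp add: e_def)
      then consider "1 < c" | B where "B \<in> \<B>" "x \<in> B" "\<alpha> B < c"
        using cInf_lessD[of "insert 1 (\<alpha> ` {B \<in> \<B>. x \<in> B})" c] by blast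
      then show ?thesis
      proof cases
        case 1
        have "measure (P n) (ball x 1) \<le> c ^ n" for n
          using order_trans[OF prob_space.prob_le_1[OF prob_P[of n], of "ball x 1"] one_le_power[of c n]] 1 by simp
        then show ?thesis by (intro exI[of _ 1]) auto
      next
        case 2
        obtain \<rho> where \<rho>: "0 < \<rho>" "ball x \<rho> \<subseteq> B" using openE[OF \<B>_open[OF 2(1)] 2(2)] by blast
        have "\<forall>\<^sub>F k in sequentially. ?a (s k) B < c"
          by (rule order_tendstoD(2)[OF \<alpha>[OF 2(1)] 2(3)])
        then have "\<forall>\<^sub>F k in sequentially. measure (P ((r \<circ> s) k)) (ball x \<rho>) \<le> c ^ (r \<circ> s) k"
          using eventually_subseq_pos[OF r']
        proof eventually_elim
          case (elim k)
          interpret prob_space "P ((r \<circ> s) k)" by (rule prob_P)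
          have "measure (P ((r \<circ> s) k)) (ball x \<rho>) \<le> measure (P (r (s k))) B"
            using \<rho>(2) \<B>_open[OF 2(1)] finite_measure_mono[of "ball x \<rho>" B] by (simp add: sets_P)
          also have "\<dots> = ?a (s k) B ^ r (s k)" using elim by simp
          also have "\<dots> \<le> c ^ r (s k)" using elim by (intro power_mono) (auto simp: real_root_ge_zero)
          finally show ?case by simp
        qed
        then show ?thesis using \<rho> by blast
      qed
    qed
  qed
  then show ?thesis using s(1) by blast
qed

end

section \<open>A continuous functional on the Skorohod space\<close>

text \<open>Evaluation at time \<open>t\<close> is not continuous in the J1 topology. The penalty \<open>m * \<bar>s - t\<bar>\<close> turns \<open>g\<close> at
  time \<open>t\<close> into a supremum over a window of width \<open>1 / m\<close> around \<open>t\<close>, which tolerates small time changes. It dominates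
  \<open>g (path_of Y t)\<close>, and for a trajectory continuous at \<open>t\<close> it is close to that value when \<open>m\<close> is large.\<close>

definition path_sup :: "('a::metric_space \<Rightarrow> real) \<Rightarrow> real \<Rightarrow> real \<Rightarrow> 'a skorohod \<Rightarrow> real"
  where "path_sup g m t Y = (SUP s\<in>{0..}. max 0 (g (path_of Y s) - m * \<bar>s - t\<bar>))"

context
  fixes g :: "'a::metric_space \<Rightarrow> real" and m t :: real
  assumes g: "\<And>x. 0 \<le> g x" "\<And>x. g x \<le> 1" and m: "0 < m" and t: "0 \<le> t"
begin

lemma path_sup_bdd: "bdd_above ((\<lambda>s. max 0 (g (path_of Y s) - m * \<bar>s - t\<bar>)) ` {0..})"
proof (rule bdd_aboveI2)
  fix s
  have "0 \<le> m * \<bar>s - t\<bar>" using m by simp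
  then show "max 0 (g (path_of Y s) - m * \<bar>s - t\<bar>) \<le> 1" using g(2)[of "path_of Y s"] by linarith
qed

lemma path_sup_ge:
  assumes "0 \<le> s" shows "g (path_of Y s) - m * \<bar>s - t\<bar> \<le> path_sup g m t Y"
  unfolding path_sup_def using assms by (intro cSUP_upper2[OF path_sup_bdd, of s]) auto

lemma path_sup_least:
  assumes "\<And>s. 0 \<le> s \<Longrightarrow> g (path_of Y s) - m * \<bar>s - t\<bar> \<le> c" "0 \<le> c"
  shows "path_sup g m t Y \<le> c"
  unfolding path_sup_def using assms by (intro cSUP_least) auto

lemma path_sup_nonneg: "0 \<le> path_sup g m t Y"
  unfolding path_sup_def by (intro cSUP_upper2[OF path_sup_bdd, of 0]) auto

lemma path_sup_le_1: "path_sup g m t Y \<le> 1"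
proof (rule path_sup_least)
  fix s
  have "0 \<le> m * \<bar>s - t\<bar>" using m by simp
  then show "g (path_of Y s) - m * \<bar>s - t\<bar> \<le> 1" using g(2)[of "path_of Y s"] by linarith
qed simp

lemma less_path_sup:
  assumes "0 \<le> c" "c < path_sup g m t Y"
  shows "\<exists>s\<ge>0. c < g (path_of Y s) - m * \<bar>s - t\<bar>"
  using path_sup_least[of Y c] assms by force

text \<open>Outside the window the penalised value is nonpositive, so only times up to \<open>t + 1 / m\<close> count. There
  a time change by less than \<open>\<epsilon>\<close> alters the penalty by at most \<open>m * \<epsilon>\<close>, and a change of position
  by less than \<open>\<epsilon>\<close> alters \<open>g\<close> by at most \<open>L * \<epsilon>\<close>. The extra unit of time ensures that the image of
  the time change covers the window.\<close>

lemma path_sup_nbhd: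
  assumes L: "L-lipschitz_on UNIV g" and \<epsilon>: "0 < \<epsilon>" "\<epsilon> \<le> 1"
    and Z: "Z \<in> skorohod_nbhd Y (t + 1 / m + 1) \<epsilon>"
  shows "\<bar>path_sup g m t Z - path_sup g m t Y\<bar> \<le> (L + m) * \<epsilon>"
proof -
  let ?T = "t + 1 / m + 1"
  obtain l where l: "l \<in> time_changes"
      "\<And>s. s \<in> {0..?T} \<Longrightarrow> \<bar>l s - s\<bar> < \<epsilon> \<and> dist (path_of Z s) (path_of Y (l s)) < \<epsilon>"
    using Z unfolding skorohod_nbhd_def by blast
  have mono: "strict_mono_on {0..} l" and onto: "l ` {0..} = {0..}"
    using l(1) unfolding time_changes_def by auto
  have L0: "0 \<le> L" using lipschitz_on_nonneg[OF L] .
  have c0: "0 \<le> (L + m) * \<epsilon>" using L0 m \<epsilon> by simp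
  have close: "\<bar>(g (path_of Z s) - m * \<bar>s - t\<bar>) - (g (path_of Y (l s)) - m * \<bar>l s - t\<bar>)\<bar> \<le> (L + m) * \<epsilon>"
    if s: "s \<in> {0..?T}" for s
  proof -
    have "\<bar>g (path_of Z s) - g (path_of Y (l s))\<bar> \<le> L * dist (path_of Z s) (path_of Y (l s))"
      using lipschitz_onD[OF L] by (simp add: dist_real_def)
    also have "\<dots> \<le> L * \<epsilon>" using l(2)[OF s] L0 by (intro mult_left_mono) auto
    finally have 1: "\<bar>g (path_of Z s) - g (path_of Y (l s))\<bar> \<le> L * \<epsilon>" .
    have "\<bar>m * \<bar>s - t\<bar> - m * \<bar>l s - t\<bar>\<bar> = m * \<bar>\<bar>s - t\<bar> - \<bar>l s - t\<bar>\<bar>"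
      using m by (simp add: right_diff_distrib[symmetric] abs_mult)
    also have "\<dots> \<le> m * \<epsilon>" using l(2)[OF s] m by (intro mult_left_mono) auto
    finally show ?thesis using 1 by (simp add: distrib_right)
  qed
  have far: "m * \<bar>s - t\<bar> \<ge> 1" if "s > t + 1 / m" for s
  proof -
    have "m * (1 / m) \<le> m * \<bar>s - t\<bar>" using that m by (intro mult_left_mono) auto
    then show ?thesis using m by simp
  qed
  have 1: "path_sup g m t Z \<le> path_sup g m t Y + (L + m) * \<epsilon>"
  proof (rule path_sup_least)
    fix s :: real assume s: "0 \<le> s"
    show "g (path_of Z s) - m * \<bar>s - t\<bar> \<le> path_sup g m t Y + (L + m) * \<epsilon>"
    proof (cases "s \<le> ?T")
      case True
      have "0 \<le> l s" using onto s by (metis atLeast_iff image_eqI)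
      then show ?thesis using close[of s] True s path_sup_ge[of "l s" Y] by auto
    next
      case False
      then show ?thesis using far[of s] g(2)[of "path_of Z s"] path_sup_nonneg[of Y] c0 by auto
    qed
  qed (use path_sup_nonneg[of Y] c0 in auto)
  have 2: "path_sup g m t Y \<le> path_sup g m t Z + (L + m) * \<epsilon>"
  proof (rule path_sup_least)
    fix s :: real assume s: "0 \<le> s"
    show "g (path_of Y s) - m * \<bar>s - t\<bar> \<le> path_sup g m t Z + (L + m) * \<epsilon>"
    proof (cases "s \<le> t + 1 / m")
      case True
      obtain s' where s': "0 \<le> s'" "s = l s'" using onto s by (metis atLeast_iff imageE)
      have "s' \<le> ?T"
      proof (rule ccontr)
        assume "\<not> s' \<le> ?T"
        moreover have "0 \<le> ?T" using t m by (simp add: field_simps)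
        ultimately have "l ?T < l s'" using mono by (auto simp: strict_mono_on_def)
        then show False using l(2)[of ?T] \<open>0 \<le> ?T\<close> True s' \<epsilon> by auto
      qed
      then show ?thesis using close[of s'] s' path_sup_ge[of s' Z] by auto
    next
      case False
      then show ?thesis using far[of s] g(2)[of "path_of Y s"] path_sup_nonneg[of Z] c0 by auto
    qed
  qed (use path_sup_nonneg[of Z] c0 in auto)
  from 1 2 show ?thesis by auto
qed

lemma continuous_path_sup:
  assumes L: "L-lipschitz_on UNIV g"
  shows "continuous_on UNIV (path_sup g m t)"
  unfolding continuous_on_open_vimage[OF open_UNIV]
proof (intro allI impI)
  fix B :: "real set" assume B: "open B"
  have L0: "0 \<le> L" using lipschitz_on_nonneg[OF L] .
  have "open (path_sup g m t -` B)"
    unfolding open_skorohod_def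
  proof
    fix Y assume "Y \<in> path_sup g m t -` B"
    then obtain \<eta> where \<eta>: "0 < \<eta>" "ball (path_sup g m t Y) \<eta> \<subseteq> B" using B openE by (metis vimageE)
    define \<epsilon> where "\<epsilon> = min 1 (\<eta> / (2 * (L + m)))"
    have \<epsilon>: "0 < \<epsilon>" "\<epsilon> \<le> 1" using \<eta> L0 m by (auto simp: \<epsilon>_def)
    have "(L + m) * \<epsilon> \<le> (L + m) * (\<eta> / (2 * (L + m)))" using L0 m by (intro mult_left_mono) (auto simp: \<epsilon>_def)
    also have "\<dots> = \<eta> / 2" using L0 m by (simp add: field_simps)
    finally have lt: "(L + m) * \<epsilon> < \<eta>" using \<eta>(1) by linarith
    have "skorohod_nbhd Y (t + 1 / m + 1) \<epsilon> \<subseteq> path_sup g m t -` B"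
    proof
      fix Z assume "Z \<in> skorohod_nbhd Y (t + 1 / m + 1) \<epsilon>"
      from path_sup_nbhd[OF L \<epsilon> this] lt
      have "path_sup g m t Z \<in> ball (path_sup g m t Y) \<eta>" by (simp add: dist_real_def abs_minus_commute)
      then show "Z \<in> path_sup g m t -` B" using \<eta>(2) by blast
    qed
    moreover have "0 < t + 1 / m + 1" using t m by (simp add: add_nonneg_pos add_pos_pos)
    ultimately show "\<exists>T>0. \<exists>\<epsilon>>0. skorohod_nbhd Y T \<epsilon> \<subseteq> path_sup g m t -` B" using \<epsilon> by blast
  qed
  then show "open (path_sup g m t -` B \<inter> UNIV)" by simp
qed

end

section \<open>Stationary processes with LD convergent kernels\<close>

text \<open>A property that holds eventually along all sequences \<open>z\<close> converging to \<open>x\<close> holds uniformly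
  near \<open>x\<close>: otherwise counterexamples in shrinking balls, at increasing indices, form such a sequence.\<close>

lemma sequential_uniform_near:
  fixes x :: "'a::metric_space"
  assumes seq: "\<And>s z. strict_mono (s :: nat \<Rightarrow> nat) \<Longrightarrow> (\<And>j. z j \<in> S (s j)) \<Longrightarrow> z \<longlonglongrightarrow> x \<Longrightarrow>
    \<forall>\<^sub>F j in sequentially. Q (s j) (z j)"
  shows "\<exists>\<rho>>0. \<forall>\<^sub>F k in sequentially. \<forall>z\<in>ball x \<rho>. z \<in> S k \<longrightarrow> Q k z"
proof (rule ccontr)
  assume neg: "\<not> ?thesis"
  have bad: "\<exists>k z. N < k \<and> z \<in> ball x (1 / Suc j) \<and> z \<in> S k \<and> \<not> Q k z" for N j :: nat
  proof -
    have "0 < 1 / real (Suc j)" by simp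
    with neg have "\<not> (\<forall>\<^sub>F k in sequentially. \<forall>z\<in>ball x (1 / Suc j). z \<in> S k \<longrightarrow> Q k z)" by blast
    then show ?thesis unfolding eventually_sequentially by (meson Suc_le_eq)
  qed
  let ?R = "\<lambda>j p. snd p \<in> ball x (1 / Suc j) \<and> snd p \<in> S (fst p) \<and> \<not> Q (fst p) (snd p)"
  have "\<exists>p. \<forall>j. ?R j (p j) \<and> fst (p j) < fst (p (Suc j))"
  proof (rule dependent_nat_choice)
    show "\<exists>p. ?R 0 p" using bad[of _ 0] by (metis fst_conv snd_conv)
    show "\<exists>q. ?R (Suc j) q \<and> fst p < fst q" for p j using bad[of "fst p" "Suc j"] by (metis fst_conv snd_conv)
  qed
  then obtain p where p: "\<And>j. ?R j (p j)" "\<And>j. fst (p j) < fst (p (Suc j))" by blast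
  have mono: "strict_mono (fst \<circ> p)" using p(2) by (simp add: strict_mono_Suc_iff)
  have "(snd \<circ> p) \<longlonglongrightarrow> x"
  proof (rule metric_tendsto_imp_tendsto[of "\<lambda>j. 1 / real (Suc j)" 0])
    show "(\<lambda>j. 1 / real (Suc j)) \<longlonglongrightarrow> 0" by (rule LIMSEQ_Suc[OF lim_1_over_n])
    show "\<forall>\<^sub>F j in sequentially. dist ((snd \<circ> p) j) x \<le> dist (1 / real (Suc j)) 0"
      using p(1) by (intro always_eventually) (auto simp: dist_commute less_imp_le)
  qed
  then have "\<forall>\<^sub>F j in sequentially. Q ((fst \<circ> p) j) ((snd \<circ> p) j)"
    using p(1) by (intro seq[OF mono]) (auto simp: o_def)
  then obtain j where "Q ((fst \<circ> p) j) ((snd \<circ> p) j)"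
    using eventually_happens[of _ sequentially] by auto
  then show False using p(1)[of j] by simp
qed

locale stationary_ld = tight_sequence P for P :: "nat \<Rightarrow> 'a::metric_space measure" +
  fixes M :: "'w measure"
    and X :: "nat \<Rightarrow> 'w \<Rightarrow> 'a skorohod"
    and \<kappa> :: "nat \<Rightarrow> 'a \<Rightarrow> 'a skorohod measure"
    and D :: "'a \<Rightarrow> 'a skorohod set \<Rightarrow> real"
    and A :: "'a set"
  assumes prob_M: "prob_space M"
    and process: "\<And>n t. 0 \<le> t \<Longrightarrow> (\<lambda>\<omega>. path_of (X n \<omega>) t) \<in> borel_measurable M"
    and invariant: "\<And>n t \<Gamma>. 0 \<le> t \<Longrightarrow> \<Gamma> \<in> sets borel \<Longrightarrow>
      measure M {\<omega> \<in> space M. path_of (X n \<omega>) t \<in> \<Gamma>} = measure (P n) \<Gamma>"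
    and rcd: "\<And>n. regular_conditional_distribution M (X n) (\<lambda>\<omega>. path_of (X n \<omega>) 0) (\<kappa> n)"
    and dev: "\<And>x. deviability (D x)"
    and kernel_ld: "\<And>r xs x. strict_mono r \<Longrightarrow> (\<And>k. xs k \<in> measure_support (P (r k))) \<Longrightarrow>
      xs \<longlonglongrightarrow> x \<Longrightarrow> ld_converges r (\<lambda>k. \<kappa> (r k) (xs k)) (D x)"
    and cont: "\<And>x Y. \<not> continuous_on {0..} (path_of Y) \<Longrightarrow> D x {Y} = 0"
    and usc: "upper_semicontinuous (\<lambda>(x, Y). D x {Y})"
    and level: "\<And>\<gamma> K. 0 < \<gamma> \<Longrightarrow> \<gamma> \<le> 1 \<Longrightarrow> compact K \<Longrightarrow>
      compact (\<Union>x\<in>K. {Y. \<gamma> \<le> D x {Y}})"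
    and markov: "\<And>x s Y. 0 \<le> s \<Longrightarrow>
      D x {Y} = D x (same_until s Y) * D (path_of Y s) {time_shift s Y}"
    and locally_finite: "\<And>K. compact K \<Longrightarrow> finite (A \<inter> K)"
    and attract: "\<And>x Y. D x {Y} = 1 \<Longrightarrow> (INF t\<in>{0..}. infdist (path_of Y t) A) = 0"
    and rest: "\<And>a Y. a \<in> A \<Longrightarrow> (\<And>t. 0 \<le> t \<Longrightarrow> path_of Y t = a) \<Longrightarrow> D a {Y} = 1"
    and communicate: "\<And>a a'. a \<in> A \<Longrightarrow> a' \<in> A \<Longrightarrow> \<exists>t>0. 0 < trans_dens D a t a'"
    and near: "\<And>\<epsilon>. 0 < \<epsilon> \<Longrightarrow> \<exists>\<delta>>0. \<forall>x. infdist x A < \<delta> \<longrightarrow>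
      (\<exists>s0>0. \<exists>s1>0. \<exists>a\<in>A. 1 - \<epsilon> < trans_dens D x s0 a \<and> 1 - \<epsilon> < trans_dens D a s1 x)"
    and local_control: "\<And>x \<epsilon>. 0 < \<epsilon> \<Longrightarrow> \<exists>\<delta>>0. \<exists>t0\<ge>0. \<exists>t1\<ge>0. \<forall>x'. dist x x' < \<delta> \<longrightarrow>
      1 - \<epsilon> < trans_dens D x t0 x' \<and> 1 - \<epsilon> < trans_dens D x' t1 x"
begin

lemma D_nonneg: "0 \<le> D x S" and D_le_1: "D x S \<le> 1"
  by (rule deviability_density[OF dev])+

lemma X_measurable: "X n \<in> borel_measurable M"
  and kernel_measurable: "\<kappa> n \<in> borel \<rightarrow>\<^sub>M prob_algebra borel"
  using rcd[of n] unfolding regular_conditional_distribution_def by auto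

lemma kernel_prob: "prob_space (\<kappa> n z)" and kernel_sets: "sets (\<kappa> n z) = sets borel"
  using measurable_space[OF kernel_measurable, of z n] by (auto simp: space_prob_algebra)

lemma kernel_measure_measurable:
  assumes "B \<in> sets borel" shows "(\<lambda>z. measure (\<kappa> n z) B) \<in> borel_measurable borel"
  using assms by (rule measurable_compose[OF kernel_measurable measurable_measure_prob_algebra])

definition joint :: "nat \<Rightarrow> real \<Rightarrow> 'a set \<Rightarrow> 'a set \<Rightarrow> real"
  where "joint n t \<Gamma> \<Gamma>' = measure M {\<omega> \<in> space M. path_of (X n \<omega>) 0 \<in> \<Gamma> \<and> path_of (X n \<omega>) t \<in> \<Gamma>'}"

lemma joint_sets:
  assumes "0 \<le> t" "\<Gamma> \<in> sets borel" "\<Gamma>' \<in> sets borel"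
  shows "{\<omega> \<in> space M. path_of (X n \<omega>) 0 \<in> \<Gamma> \<and> path_of (X n \<omega>) t \<in> \<Gamma>'} \<in> sets M"
proof -
  have "{\<omega> \<in> space M. path_of (X n \<omega>) 0 \<in> \<Gamma>} \<inter> {\<omega> \<in> space M. path_of (X n \<omega>) t \<in> \<Gamma>'} \<in> sets M"
    using measurable_sets[OF process[OF order_refl] assms(2), of n] measurable_sets[OF process[OF assms(1)] assms(3), of n]
    by (intro sets.Int) (auto simp: vimage_def Int_def conj_commute)
  moreover have "{\<omega> \<in> space M. path_of (X n \<omega>) 0 \<in> \<Gamma> \<and> path_of (X n \<omega>) t \<in> \<Gamma>'} =
    {\<omega> \<in> space M. path_of (X n \<omega>) 0 \<in> \<Gamma>} \<inter> {\<omega> \<in> space M. path_of (X n \<omega>) t \<in> \<Gamma>'}" by blast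
  ultimately show ?thesis by simp
qed

lemma event_sets:
  assumes "0 \<le> t" "\<Gamma> \<in> sets borel"
  shows "{\<omega> \<in> space M. path_of (X n \<omega>) t \<in> \<Gamma>} \<in> sets M"
  using joint_sets[OF assms(1) _ assms(2), of UNIV n] by simp

lemma path_event_sets:
  assumes "B \<in> sets borel" "\<Gamma> \<in> sets borel"
  shows "{\<omega> \<in> space M. X n \<omega> \<in> B \<and> path_of (X n \<omega>) 0 \<in> \<Gamma>} \<in> sets M"
proof -
  have "{\<omega> \<in> space M. X n \<omega> \<in> B} \<in> sets M"
    using measurable_sets[OF X_measurable assms(1), of n] by (simp add: vimage_def Int_def conj_commute)
  then have "{\<omega> \<in> space M. X n \<omega> \<in> B} \<inter> {\<omega> \<in> space M. path_of (X n \<omega>) 0 \<in> \<Gamma>} \<in> sets M"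
    using event_sets[OF order_refl assms(2)] by blast
  moreover have "{\<omega> \<in> space M. X n \<omega> \<in> B \<and> path_of (X n \<omega>) 0 \<in> \<Gamma>} =
    {\<omega> \<in> space M. X n \<omega> \<in> B} \<inter> {\<omega> \<in> space M. path_of (X n \<omega>) 0 \<in> \<Gamma>}" by blast
  ultimately show ?thesis by simp
qed

lemma initial_distr: "distr M borel (\<lambda>\<omega>. path_of (X n \<omega>) 0) = P n"
proof (rule measure_eqI)
  interpret M: prob_space M by (rule prob_M)
  interpret Pn: prob_space "P n" by (rule prob_P)
  fix \<Gamma> assume "\<Gamma> \<in> sets (distr M borel (\<lambda>\<omega>. path_of (X n \<omega>) 0))"
  then have \<Gamma>: "\<Gamma> \<in> sets borel" by simp
  have "(\<lambda>\<omega>. path_of (X n \<omega>) 0) -` \<Gamma> \<inter> space M = {\<omega> \<in> space M. path_of (X n \<omega>) 0 \<in> \<Gamma>}" by blast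
  then show "emeasure (distr M borel (\<lambda>\<omega>. path_of (X n \<omega>) 0)) \<Gamma> = emeasure (P n) \<Gamma>"
    using invariant[OF order_refl \<Gamma>, of n] process[of 0 n] \<Gamma>
    by (simp add: emeasure_distr M.emeasure_eq_measure Pn.emeasure_eq_measure)
qed (simp add: sets_P)

lemma path_event_integral:
  assumes "B \<in> sets borel" "\<Gamma> \<in> sets borel"
  shows "measure M {\<omega> \<in> space M. X n \<omega> \<in> B \<and> path_of (X n \<omega>) 0 \<in> \<Gamma>} =
    (\<integral>z. indicator \<Gamma> z * measure (\<kappa> n z) B \<partial>P n)"
  using rcd[of n] assms unfolding regular_conditional_distribution_def initial_distr
  by (simp add: set_lebesgue_integral_def)

lemma path_event_integrable:
  assumes "B \<in> sets borel" "\<Gamma> \<in> sets borel"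
  shows "integrable (P n) (\<lambda>z. indicator \<Gamma> z * measure (\<kappa> n z) B)"
proof -
  interpret prob_space "P n" by (rule prob_P)
  have "(\<lambda>z. indicator \<Gamma> z * measure (\<kappa> n z) B) \<in> borel_measurable (P n)"
    unfolding measurable_cong_sets[OF sets_P refl]
    using assms kernel_measure_measurable by (intro borel_measurable_times) auto
  then show ?thesis
    using prob_space.prob_le_1[OF kernel_prob]
    by (intro integrable_bounded_nonneg[of _ 1]) (auto simp: indicator_def)
qed

lemma support_sets: "measure_support (P n) \<in> sets borel"
  using open_measure_support_compl[of "P n"] by (metis borel_closed closed_open)

text \<open>Only the events defined by the whole trajectory and the initial position enter the conditional
  distribution, so the bounds on the kernel at the points of the support integrate to bounds on
  probabilities, up to the mass off the support.\<close>

lemma path_event_ge: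
  assumes B: "B \<in> sets borel" and \<Gamma>: "\<Gamma> \<in> sets borel" and c: "0 \<le> c"
    and le: "\<And>z. z \<in> \<Gamma> \<Longrightarrow> z \<in> measure_support (P n) \<Longrightarrow> c \<le> measure (\<kappa> n z) B"
  shows "c * (measure (P n) \<Gamma> - measure (P n) (- measure_support (P n)))
    \<le> measure M {\<omega> \<in> space M. X n \<omega> \<in> B \<and> path_of (X n \<omega>) 0 \<in> \<Gamma>}"
proof -
  interpret prob_space "P n" by (rule prob_P)
  let ?S = "measure_support (P n)"
  have s: "\<Gamma> \<inter> ?S \<in> sets borel" "- ?S \<in> sets borel" using \<Gamma> support_sets by auto
  have "measure (P n) \<Gamma> \<le> measure (P n) ((\<Gamma> \<inter> ?S) \<union> - ?S)"
    using s by (intro finite_measure_mono) (auto simp: sets_P)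
  also have "\<dots> \<le> measure (P n) (\<Gamma> \<inter> ?S) + measure (P n) (- ?S)"
    using s by (intro measure_Un_le) (auto simp: sets_P)
  finally have "c * (measure (P n) \<Gamma> - measure (P n) (- ?S)) \<le> c * measure (P n) (\<Gamma> \<inter> ?S)"
    using c by (intro mult_left_mono) auto
  also have "\<dots> = (\<integral>z. c * indicator (\<Gamma> \<inter> ?S) z \<partial>P n)" using s space_P by (simp add: sets_P)
  also have "\<dots> \<le> (\<integral>z. indicator \<Gamma> z * measure (\<kappa> n z) B \<partial>P n)"
  proof (rule integral_mono[OF _ path_event_integrable[OF B \<Gamma>]])
    show "integrable (P n) (\<lambda>z. c * indicator (\<Gamma> \<inter> ?S) z)"
      using s by (simp add: sets_P emeasure_eq_measure)
    show "c * indicator (\<Gamma> \<inter> ?S) z \<le> indicator \<Gamma> z * measure (\<kappa> n z) B" for z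
      using le[of z] by (auto simp: indicator_def)
  qed
  finally show ?thesis using path_event_integral[OF B \<Gamma>] by simp
qed

lemma path_event_le:
  assumes B: "B \<in> sets borel" and \<Gamma>: "\<Gamma> \<in> sets borel" and c: "0 \<le> c"
    and le: "\<And>z. z \<in> \<Gamma> \<Longrightarrow> z \<in> measure_support (P n) \<Longrightarrow> measure (\<kappa> n z) B \<le> c"
  shows "measure M {\<omega> \<in> space M. X n \<omega> \<in> B \<and> path_of (X n \<omega>) 0 \<in> \<Gamma>}
    \<le> c * measure (P n) \<Gamma> + measure (P n) (- measure_support (P n))"
proof -
  interpret prob_space "P n" by (rule prob_P)
  let ?S = "measure_support (P n)"
  have s: "- ?S \<in> sets borel" using support_sets by auto
  have "(\<integral>z. indicator \<Gamma> z * measure (\<kappa> n z) B \<partial>P n) \<le> (\<integral>z. c * indicator \<Gamma> z + indicator (- ?S) z \<partial>P n)"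
  proof (rule integral_mono[OF path_event_integrable[OF B \<Gamma>]])
    show "integrable (P n) (\<lambda>z. c * indicator \<Gamma> z + indicator (- ?S) z)"
      using s \<Gamma> by (simp add: sets_P emeasure_eq_measure)
    show "indicator \<Gamma> z * measure (\<kappa> n z) B \<le> c * indicator \<Gamma> z + indicator (- ?S) z" for z
      using le[of z] c prob_space.prob_le_1[OF kernel_prob, of n z B] by (auto simp: indicator_def)
  qed
  also have "\<dots> = c * measure (P n) \<Gamma> + measure (P n) (- ?S)"
    using s \<Gamma> space_P by (subst Bochner_Integration.integral_add) (auto simp: sets_P emeasure_eq_measure)
  finally show ?thesis using path_event_integral[OF B \<Gamma>] by simp
qed

lemma kernel_event_near:
  assumes r: "strict_mono r" and f: "continuous_on UNIV f" "\<And>Y. 0 \<le> f Y" "\<And>Y. f Y \<le> 1"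
  shows kernel_event_lower: "0 \<le> c \<Longrightarrow> c < f Y * D x {Y} \<Longrightarrow> \<exists>\<rho>>0. \<forall>\<^sub>F k in sequentially.
        \<forall>z\<in>ball x \<rho>. z \<in> measure_support (P (r k)) \<longrightarrow> c ^ r k \<le> measure (\<kappa> (r k) z) {Y. 0 < f Y}"
    and kernel_event_upper: "(\<And>Y. f Y * D x {Y} \<le> c') \<Longrightarrow> c' < c \<Longrightarrow> \<exists>\<rho>>0. \<forall>\<^sub>F k in sequentially.
        \<forall>z\<in>ball x \<rho>. z \<in> measure_support (P (r k)) \<longrightarrow> measure (\<kappa> (r k) z) {Y. 1 \<le> f Y} \<le> c ^ r k"
proof -
  have ld: "ld_converges (r \<circ> s) (\<lambda>j. \<kappa> ((r \<circ> s) j) (z j)) (D x)" "strict_mono (r \<circ> s)"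
    if "strict_mono s" "\<And>j. z j \<in> measure_support (P (r (s j)))" "z \<longlonglongrightarrow> x" for s z
    using kernel_ld[of "r \<circ> s" z x] that strict_mono_o[OF r that(1)] by auto
  show "\<exists>\<rho>>0. \<forall>\<^sub>F k in sequentially.
        \<forall>z\<in>ball x \<rho>. z \<in> measure_support (P (r k)) \<longrightarrow> c ^ r k \<le> measure (\<kappa> (r k) z) {Y. 0 < f Y}"
    if "0 \<le> c" "c < f Y * D x {Y}"
  proof (rule sequential_uniform_near)
    fix s z assume sz: "strict_mono s" "\<And>j. z j \<in> measure_support (P (r (s j)))" "z \<longlonglongrightarrow> x"
    show "\<forall>\<^sub>F j in sequentially. c ^ r (s j) \<le> measure (\<kappa> (r (s j)) (z j)) {Y. 0 < f Y}"
      using ld_converges_event_lower[OF ld[OF sz] kernel_prob kernel_sets dev f that] by simp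
  qed
  show "\<exists>\<rho>>0. \<forall>\<^sub>F k in sequentially.
        \<forall>z\<in>ball x \<rho>. z \<in> measure_support (P (r k)) \<longrightarrow> measure (\<kappa> (r k) z) {Y. 1 \<le> f Y} \<le> c ^ r k"
    if "\<And>Y. f Y * D x {Y} \<le> c'" "c' < c"
  proof (rule sequential_uniform_near)
    fix s z assume sz: "strict_mono s" "\<And>j. z j \<in> measure_support (P (r (s j)))" "z \<longlonglongrightarrow> x"
    show "\<forall>\<^sub>F j in sequentially. measure (\<kappa> (r (s j)) (z j)) {Y. 1 \<le> f Y} \<le> c ^ r (s j)"
      using ld_converges_event_upper[OF ld[OF sz] kernel_prob kernel_sets dev f that] by simp
  qed
qed

end

context stationary_ld
begin

lemma joint_mono:
  assumes "0 \<le> t" "\<Gamma>1 \<subseteq> \<Gamma>2" "\<Gamma>1' \<subseteq> \<Gamma>2'" "\<Gamma>2 \<in> sets borel" "\<Gamma>2' \<in> sets borel"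
  shows "joint n t \<Gamma>1 \<Gamma>1' \<le> joint n t \<Gamma>2 \<Gamma>2'"
proof -
  interpret M: prob_space M by (rule prob_M)
  show ?thesis unfolding joint_def
    using assms by (intro M.finite_measure_mono joint_sets) auto
qed

text \<open>Both sides equal the probability of \<open>B\<close> under the invariant distribution minus the probability of being
  in \<open>B\<close> at both times.\<close>

lemma joint_flux:
  assumes t: "0 \<le> t" and B: "B \<in> sets borel"
  shows "joint n t B (- B) = joint n t (- B) B"
proof -
  interpret M: prob_space M by (rule prob_M)
  have B': "- B \<in> sets borel" using B by auto
  have "measure (P n) B = measure M ({\<omega> \<in> space M. path_of (X n \<omega>) 0 \<in> B \<and> path_of (X n \<omega>) t \<in> B} \<union>
      {\<omega> \<in> space M. path_of (X n \<omega>) 0 \<in> B \<and> path_of (X n \<omega>) t \<in> - B})"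
    unfolding invariant[OF order_refl B, of n, symmetric] by (rule arg_cong[of _ _ "measure M"]) blast
  also have "\<dots> = joint n t B B + joint n t B (- B)"
    unfolding joint_def using joint_sets[OF t B B] joint_sets[OF t B B']
    by (intro M.finite_measure_Union) auto
  finally have 1: "measure (P n) B = joint n t B B + joint n t B (- B)" .
  have "measure (P n) B = measure M ({\<omega> \<in> space M. path_of (X n \<omega>) 0 \<in> B \<and> path_of (X n \<omega>) t \<in> B} \<union>
      {\<omega> \<in> space M. path_of (X n \<omega>) 0 \<in> - B \<and> path_of (X n \<omega>) t \<in> B})"
    unfolding invariant[OF t B, of n, symmetric] by (rule arg_cong[of _ _ "measure M"]) blast
  also have "\<dots> = joint n t B B + joint n t (- B) B"
    unfolding joint_def using joint_sets[OF t B B] joint_sets[OF t B' B]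
    by (intro M.finite_measure_Union) auto
  finally show ?thesis using 1 by simp
qed

text \<open>Apply the lower kernel bound to \<open>f Z = 1 - path_sup g m t Z\<close> with \<open>g\<close> the complement of a bump
  around \<open>path_of Y t\<close>. If \<open>f\<close> is positive at a trajectory, then the trajectory is near \<open>path_of Y t\<close> at time \<open>t\<close>, and \<open>f Y\<close> is
  close to one since \<open>Y\<close>, having positive weight, is continuous.\<close>

lemma joint_ball_lower:
  assumes ld: "local_ld r P e" and r: "strict_mono r"
    and c: "0 \<le> c" "c < e x * D x {Y}" and t: "0 \<le> t" and \<rho>: "0 < \<rho>"
  shows "\<forall>\<^sub>F k in sequentially. c ^ r k \<le> joint (r k) t (ball x \<rho>) (ball (path_of Y t) \<rho>)"
proof -
  let ?y = "path_of Y t" and ?S = "\<lambda>n. measure_support (P n)"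
  have pos: "0 < e x" "0 < D x {Y}"
    using c local_ld_nonneg[OF ld, of x] D_nonneg[of x "{Y}"] by (auto simp: less_le)
  \<comment> \<open>Factor \<open>c < a * b\<close> with \<open>a < a1 < e x\<close> and \<open>b < \<theta> * D x {Y}\<close>, \<open>\<theta> < 1\<close>; the gap between \<open>a\<close> and \<open>a1\<close> absorbs
    the mass off the support.\<close>
  have "c / e x < D x {Y}" using c pos by (simp add: field_simps)
  then obtain b where b: "c / e x < b" "b < D x {Y}" using dense by blast
  have b0: "0 < b" using b c pos by (meson divide_nonneg_pos le_less_trans)
  have "c / b < e x" using b b0 pos by (simp add: field_simps)
  then obtain a where a: "c / b < a" "a < e x" using dense by blast
  have a0: "0 < a" using a c b0 by (meson divide_nonneg_pos le_less_trans)
  obtain a1 where a1: "a < a1" "a1 < e x" using dense[OF a(2)] by blast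
  have "b / D x {Y} < 1" using b pos by simp
  then obtain \<theta> where \<theta>: "b / D x {Y} < \<theta>" "\<theta> < 1" using dense by blast
  have cY: "continuous_on {0..} (path_of Y)" using cont[of Y x] pos by force
  define g where "g z = 1 - bump ?y \<rho> z" for z
  have g: "\<And>z. 0 \<le> g z" "\<And>z. g z \<le> 1" using bump_range by (auto simp: g_def)
  have gL: "(2 / \<rho>)-lipschitz_on UNIV g"
    using bump_lipschitz[OF \<rho>, of ?y] by (auto simp: lipschitz_on_def g_def dist_real_def abs_minus_commute)
  have "continuous_on {0..} (\<lambda>s. bump ?y \<rho> (path_of Y s))"
    using continuous_on_compose2[OF continuous_bump[OF \<rho>, of UNIV] cY] by simp
  then obtain \<eta> where \<eta>: "0 < \<eta>"
      "\<And>s. 0 \<le> s \<Longrightarrow> dist s t < \<eta> \<Longrightarrow> dist (bump ?y \<rho> (path_of Y s)) (bump ?y \<rho> ?y) < 1 - \<theta>"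
    unfolding continuous_on_iff using t \<theta>(2) by (metis atLeast_iff diff_gt_0_iff_gt)
  define m where "m = 1 / \<eta>"
  have m: "0 < m" using \<eta> by (simp add: m_def)
  define f where "f Z = 1 - path_sup g m t Z" for Z
  have f: "continuous_on UNIV f" "\<And>Z. 0 \<le> f Z" "\<And>Z. f Z \<le> 1"
    using continuous_path_sup[OF g m t gL] path_sup_nonneg[OF g m t] path_sup_le_1[OF g m t]
    by (auto simp: f_def intro!: continuous_intros)
  have "path_sup g m t Y \<le> 1 - \<theta>"
  proof (rule path_sup_least[OF g m t])
    fix s :: real assume s: "0 \<le> s"
    show "g (path_of Y s) - m * \<bar>s - t\<bar> \<le> 1 - \<theta>"
    proof (cases "dist s t < \<eta>")
      case True
      have "0 \<le> m * \<bar>s - t\<bar>" using m by simp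
      then show ?thesis using \<eta>(2)[OF s True] unfolding g_def by (simp add: bump_center dist_real_def)
    next
      case False
      then have "1 \<le> m * \<bar>s - t\<bar>" using \<eta>(1) by (simp add: m_def dist_real_def field_simps)
      then show ?thesis using g(2)[of "path_of Y s"] \<theta>(2) by linarith
    qed
  qed (use \<theta> in simp)
  then have "\<theta> * D x {Y} \<le> f Y * D x {Y}" using pos by (intro mult_right_mono) (auto simp: f_def)
  moreover have "b < \<theta> * D x {Y}" using \<theta>(1) pos by (simp add: field_simps)
  ultimately have bf: "b < f Y * D x {Y}" by linarith
  let ?B = "{Z. 0 < f Z}"
  have B: "?B \<in> sets borel"
    using borel_measurable_continuous_onI[OF f(1)] by measurable
  obtain \<rho>1 where \<rho>1: "0 < \<rho>1" "\<forall>\<^sub>F k in sequentially.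
      \<forall>z\<in>ball x \<rho>1. z \<in> ?S (r k) \<longrightarrow> b ^ r k \<le> measure (\<kappa> (r k) z) ?B"
    using kernel_event_lower[OF r f less_imp_le[OF b0] bf] by blast
  define \<rho>2 where "\<rho>2 = min \<rho> \<rho>1"
  have \<rho>2: "0 < \<rho>2" using \<rho> \<rho>1 by (simp add: \<rho>2_def)
  have "0 \<le> a1" using a0 a1 by simp
  from local_ld_lower[OF ld this a1(2) \<rho>2] off_support_small[OF r a0]
    eventually_mult_power_le[OF r less_imp_le[OF a0] a1(1), of 2] \<rho>1(2)
  show ?thesis
  proof eventually_elim
    case (elim k)
    interpret M: prob_space M by (rule prob_M)
    have "c ^ r k \<le> (b * a) ^ r k" using a(1) b0 c by (intro power_mono) (auto simp: field_simps)
    also have "\<dots> = b ^ r k * a ^ r k" by (rule power_mult_distrib)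
    also have "\<dots> \<le> b ^ r k * (measure (P (r k)) (ball x \<rho>2) - measure (P (r k)) (- ?S (r k)))"
      using elim(1,2,3) b0 by (intro mult_left_mono) auto
    also have "\<dots> \<le> measure M {\<omega> \<in> space M. X (r k) \<omega> \<in> ?B \<and> path_of (X (r k) \<omega>) 0 \<in> ball x \<rho>2}"
      using elim(4) b0 by (intro path_event_ge B) (auto simp: \<rho>2_def)
    also have "\<dots> \<le> joint (r k) t (ball x \<rho>) (ball ?y \<rho>)"
      unfolding joint_def
    proof (intro M.finite_measure_mono joint_sets t)
      have "path_of Z t \<in> ball ?y \<rho>" if "0 < f Z" for Z
      proof -
        have "g (path_of Z t) < 1" using path_sup_ge[where g = g and m = m and t = t and s = t and Y = Z, OF g m t t] that by (simp add: f_def)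
        then show ?thesis by (intro bump_pos[OF \<rho>]) (simp add: g_def)
      qed
      then show "{\<omega> \<in> space M. X (r k) \<omega> \<in> ?B \<and> path_of (X (r k) \<omega>) 0 \<in> ball x \<rho>2}
          \<subseteq> {\<omega> \<in> space M. path_of (X (r k) \<omega>) 0 \<in> ball x \<rho> \<and> path_of (X (r k) \<omega>) t \<in> ball ?y \<rho>}"
        by (auto simp: \<rho>2_def)
    qed auto
    finally show ?case .
  qed
qed

text \<open>Closeness to \<open>y\<close> at time \<open>t\<close> is dominated by \<open>path_sup\<close> of a bump around \<open>y\<close> with \<open>m = 1\<close>,
  whose window consists of the times within one unit of \<open>t\<close>. This imprecision in time is
  harmless, because only limits of large times matter.\<close>

lemma joint_ball_upper:
  assumes ld: "local_ld r P e" and r: "strict_mono r"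
    and c: "0 \<le> c'" "c' < c" and t: "0 \<le> t" and \<rho>0: "0 < \<rho>0"
    and bound: "\<And>Y s. 0 \<le> s \<Longrightarrow> \<bar>s - t\<bar> \<le> 1 \<Longrightarrow> path_of Y s \<in> ball y \<rho>0 \<Longrightarrow> e x * D x {Y} \<le> c'"
  shows "\<exists>\<rho>>0. \<forall>\<^sub>F k in sequentially. joint (r k) t (ball x \<rho>) (ball y \<rho>) \<le> c ^ r k"
proof -
  let ?S = "\<lambda>n. measure_support (P n)"
  define f where "f = path_sup (bump y \<rho>0) 1 t"
  have f: "continuous_on UNIV f" "\<And>Z. 0 \<le> f Z" "\<And>Z. f Z \<le> 1"
    unfolding f_def
    using continuous_path_sup[OF bump_range _ t bump_lipschitz[OF \<rho>0], of 1]
      path_sup_nonneg[OF bump_range _ t, of 1] path_sup_le_1[OF bump_range _ t, of 1] by auto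
  have bound': "e x * (f Z * D x {Z}) \<le> c'" for Z
  proof (cases "0 < f Z")
    case True
    then obtain s where s: "0 \<le> s" "0 < bump y \<rho>0 (path_of Z s) - 1 * \<bar>s - t\<bar>"
      using less_path_sup[where g = "bump y \<rho>0" and m = 1 and t = t and c = 0 and Y = Z, OF bump_range _ t] unfolding f_def by auto
    then have "\<bar>s - t\<bar> \<le> 1" using bump_range(2)[of y \<rho>0 "path_of Z s"] by simp
    moreover have "path_of Z s \<in> ball y \<rho>0" using s by (intro bump_pos[OF \<rho>0]) simp
    ultimately have "e x * D x {Z} \<le> c'" using bound s by blast
    moreover have "e x * (f Z * D x {Z}) \<le> e x * (1 * D x {Z})"
      using f D_nonneg local_ld_nonneg[OF ld] by (intro mult_left_mono mult_right_mono) auto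
    ultimately show ?thesis by simp
  next
    case False
    then have "f Z = 0" using f(2)[of Z] by simp
    then show ?thesis using c by simp
  qed
  obtain c'' where c'': "c' < c''" "c'' < c" using dense[OF c(2)] by blast
  have c''0: "0 < c''" using c c'' by simp
  obtain b' b a where ab: "\<And>Z. f Z * D x {Z} \<le> b'" "b' < b" "e x < a" "0 < b" "a * b < c''"
  proof (cases "e x = 0")
    case True
    have "f Z * D x {Z} \<le> 1" for Z using f(2,3)[of Z] D_nonneg[of x "{Z}"] D_le_1[of x "{Z}"] by (simp add: mult_le_one)
    then show thesis using that[of 1 2 "c'' / 4"] True c''0 by simp
  next
    case False
    then have e: "0 < e x" using local_ld_nonneg[OF ld, of x] by simp
    have "c' / e x < c'' / e x" using c'' e by (simp add: divide_strict_right_mono)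
    then obtain b where b: "c' / e x < b" "b < c'' / e x" using dense by blast
    have b0: "0 < b" using b(1) c(1) e by (meson divide_nonneg_pos le_less_trans)
    have "e x < c'' / b" using b b0 e by (simp add: field_simps)
    then obtain a where a: "e x < a" "a < c'' / b" using dense by blast
    have "f Z * D x {Z} \<le> c' / e x" for Z using bound'[of Z] e by (simp add: field_simps)
    then show thesis using that[of "c' / e x" b a] a b b0 by (simp add: field_simps)
  qed
  let ?B = "{Z. 1 \<le> f Z}"
  have B: "?B \<in> sets borel"
    using borel_measurable_continuous_onI[OF f(1)] by measurable
  obtain \<rho>1 where \<rho>1: "0 < \<rho>1" "\<forall>\<^sub>F k in sequentially.
      \<forall>z\<in>ball x \<rho>1. z \<in> ?S (r k) \<longrightarrow> measure (\<kappa> (r k) z) ?B \<le> b ^ r k"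
    using kernel_event_upper[OF r f ab(1,2)] by blast
  obtain \<rho>2 where \<rho>2: "0 < \<rho>2" "\<forall>\<^sub>F k in sequentially. measure (P (r k)) (ball x \<rho>2) \<le> a ^ r k"
    using local_ld_upper[OF ld ab(3)] by blast
  define \<rho> where "\<rho> = Min {\<rho>1, \<rho>2, \<rho>0 / 2}"
  have \<rho>: "0 < \<rho>" "\<rho> \<le> \<rho>1" "\<rho> \<le> \<rho>2" "\<rho> \<le> \<rho>0 / 2" using \<rho>1 \<rho>2 \<rho>0 by (auto simp: \<rho>_def)
  have "\<forall>\<^sub>F k in sequentially. joint (r k) t (ball x \<rho>) (ball y \<rho>) \<le> c ^ r k"
    using \<rho>1(2) \<rho>2(2) off_support_small[OF r c''0] eventually_mult_power_le[OF r less_imp_le[OF c''0] c''(2), of 2]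
  proof eventually_elim
    case (elim k)
    interpret M: prob_space M by (rule prob_M)
    interpret Pn: prob_space "P (r k)" by (rule prob_P)
    have "joint (r k) t (ball x \<rho>) (ball y \<rho>)
        \<le> measure M {\<omega> \<in> space M. X (r k) \<omega> \<in> ?B \<and> path_of (X (r k) \<omega>) 0 \<in> ball x \<rho>}"
      unfolding joint_def
    proof (intro M.finite_measure_mono path_event_sets B)
      have "1 \<le> f Z" if "path_of Z t \<in> ball y \<rho>" for Z
        using path_sup_ge[where g = "bump y \<rho>0" and m = 1 and t = t and s = t and Y = Z, OF bump_range _ t t] bump_eq_1[OF \<rho>0, of "path_of Z t" y] that \<rho>(4)
        by (auto simp: f_def)
      then show "{\<omega> \<in> space M. path_of (X (r k) \<omega>) 0 \<in> ball x \<rho> \<and> path_of (X (r k) \<omega>) t \<in> ball y \<rho>}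
          \<subseteq> {\<omega> \<in> space M. X (r k) \<omega> \<in> ?B \<and> path_of (X (r k) \<omega>) 0 \<in> ball x \<rho>}"
        by blast
    qed auto
    also have "\<dots> \<le> b ^ r k * measure (P (r k)) (ball x \<rho>) + measure (P (r k)) (- ?S (r k))"
      using elim(1) ab \<rho> by (intro path_event_le B) auto
    also have "measure (P (r k)) (ball x \<rho>) \<le> measure (P (r k)) (ball x \<rho>2)"
      using \<rho> by (intro Pn.finite_measure_mono) (auto simp: sets_P)
    also have "\<dots> \<le> a ^ r k" by (rule elim)
    also have "b ^ r k * a ^ r k = (a * b) ^ r k" by (simp add: power_mult_distrib mult.commute)
    also have "\<dots> \<le> c'' ^ r k" using ab local_ld_nonneg[OF ld, of x] by (intro power_mono) auto
    finally show ?case using elim ab by (simp add: mult_left_mono)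
  qed
  then show ?thesis using \<rho> by blast
qed

text \<open>If no pair \<open>(x, y)\<close> qualified, then each pair would have a neighbourhood that the pair of positions at
  the times \<open>0\<close> and \<open>t\<close> visits, inside \<open>B1 \<times> B2\<close>, with probability at most \<open>a ^ r k\<close>: by
  \<open>joint_ball_upper\<close> on the closures, and trivially elsewhere. Finitely many of them cover \<open>K \<times> K\<close>.\<close>

lemma joint_limit_pair:
  assumes ld: "local_ld r P e" and r: "strict_mono r"
    and t: "0 \<le> t" and B: "B1 \<in> sets borel" "B2 \<in> sets borel"
    and c: "0 \<le> c" "c < w" and big: "\<forall>\<^sub>F k in sequentially. w ^ r k \<le> joint (r k) t B1 B2"
  shows "\<exists>x\<in>closure B1. \<exists>y\<in>closure B2. \<forall>\<rho>>0. \<exists>Y s. 0 \<le> s \<and> \<bar>s - t\<bar> \<le> 1 \<and>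
    path_of Y s \<in> ball y \<rho> \<and> c < e x * D x {Y}"
proof (rule ccontr)
  assume neg: "\<not> ?thesis"
  obtain a where a: "c < a" "a < w" using dense[OF c(2)] by blast
  obtain b where b: "a < b" "b < w" using dense[OF a(2)] by blast
  obtain b2 where b2: "b < b2" "b2 < w" using dense[OF b(2)] by blast
  have a0: "0 < a" and b0: "0 < b" using a b c by auto
  obtain K where K: "compact K" "\<forall>\<^sub>F k in sequentially. measure (P (r k)) (- K) \<le> b ^ r k"
    using tight_compact[OF r b0] by blast
  \<comment> \<open>The cover consists of rectangles because general open sets of the product need not be in the
    product sigma-algebra. They are nonempty so that their projections are the sides.\<close>
  let ?ev = "\<lambda>k U. {\<omega> \<in> space M. path_of (X (r k) \<omega>) 0 \<in> fst ` U \<inter> B1 \<and> path_of (X (r k) \<omega>) t \<in> snd ` U \<inter> B2}"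
  let ?R = "\<lambda>U. \<exists>U1 U2. U = U1 \<times> U2 \<and> open U1 \<and> open U2 \<and> U1 \<noteq> {} \<and> U2 \<noteq> {}"
  let ?\<mu> = "\<lambda>U k. joint (r k) t (fst ` U \<inter> B1) (snd ` U \<inter> B2)"
  have zero: "joint n t {} \<Gamma> = 0" "joint n t \<Gamma> {} = 0" for n \<Gamma> by (simp_all add: joint_def)
  have RI: "?R (U1 \<times> U2)" if "open U1" "open U2" "U1 \<noteq> {}" "U2 \<noteq> {}" for U1 U2
    using that by blast
  have loc: "\<exists>U. p \<in> U \<and> open U \<and> ?R U \<and> (\<forall>\<^sub>F k in sequentially. ?\<mu> U k \<le> a ^ r k)" for p
  proof -
    obtain x y where p: "p = (x, y)" by (cases p)
    consider "x \<notin> closure B1" | "y \<notin> closure B2" | "x \<in> closure B1" "y \<in> closure B2" by blast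
    then show ?thesis
    proof cases
      case 1
      have "- closure B1 \<inter> B1 = {}" using closure_subset by blast
      then show ?thesis
        using 1 p a0 by (intro exI[of _ "(- closure B1) \<times> UNIV"])
          (auto simp: zero open_Compl fst_image_times intro!: open_Times RI)
    next
      case 2
      have "- closure B2 \<inter> B2 = {}" using closure_subset by blast
      then show ?thesis
        using 2 p a0 by (intro exI[of _ "UNIV \<times> (- closure B2)"])
          (auto simp: zero open_Compl snd_image_times intro!: open_Times RI)
    next
      case 3
      then obtain \<rho>0 where \<rho>0: "0 < \<rho>0" "\<And>Y s. 0 \<le> s \<Longrightarrow> \<bar>s - t\<bar> \<le> 1 \<Longrightarrow> path_of Y s \<in> ball y \<rho>0 \<Longrightarrow> e x * D x {Y} \<le> c"
        using neg by (metis not_less)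
      have "\<exists>\<rho>>0. \<forall>\<^sub>F k in sequentially. joint (r k) t (ball x \<rho>) (ball y \<rho>) \<le> a ^ r k"
        by (rule joint_ball_upper[OF ld r c(1) a(1) t \<rho>0])
      then obtain \<rho> where \<rho>: "0 < \<rho>" "\<forall>\<^sub>F k in sequentially. joint (r k) t (ball x \<rho>) (ball y \<rho>) \<le> a ^ r k"
        by auto
      have "\<forall>\<^sub>F k in sequentially. ?\<mu> (ball x \<rho> \<times> ball y \<rho>) k \<le> a ^ r k"
        using \<rho>(2)
      proof eventually_elim
        case (elim k)
        have "?\<mu> (ball x \<rho> \<times> ball y \<rho>) k \<le> joint (r k) t (ball x \<rho>) (ball y \<rho>)"
          using t by (intro joint_mono) auto
        with elim show ?case by simp
      qed
      moreover have "ball x \<rho> \<noteq> {}" "ball y \<rho> \<noteq> {}" using \<rho>(1) by auto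
      ultimately show ?thesis using p \<rho>(1)
        by (intro exI[of _ "ball x \<rho> \<times> ball y \<rho>"] conjI RI)
          (auto intro: open_Times)
    qed
  qed
  obtain \<U> where \<U>: "finite \<U>" "K \<times> K \<subseteq> \<Union>\<U>" "\<And>U. U \<in> \<U> \<Longrightarrow> open U \<and> ?R U"
      "\<forall>\<^sub>F k in sequentially. (\<Sum>U\<in>\<U>. ?\<mu> U k) \<le> b ^ r k"
    by (rule finite_cover_sum_le[OF r compact_Times[OF K(1) K(1)] less_imp_le[OF a0] b(1), of ?R ?\<mu>, OF loc]) (rule that)
  have Kb: "- K \<in> sets borel" using borel_compact[OF K(1)] by auto
  have "\<forall>\<^sub>F k in sequentially. joint (r k) t B1 B2 \<le> b2 ^ r k"
    using \<U>(4) K(2) eventually_mult_power_le[OF r less_imp_le[OF b0] b2(1), of 3]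
  proof eventually_elim
    case (elim k)
    interpret M: prob_space M by (rule prob_M)
    let ?K0 = "{\<omega> \<in> space M. path_of (X (r k) \<omega>) 0 \<in> - K}"
    let ?Kt = "{\<omega> \<in> space M. path_of (X (r k) \<omega>) t \<in> - K}"
    have Ks: "?K0 \<in> sets M" "?Kt \<in> sets M" using event_sets[OF _ Kb] t by auto
    have evs: "?ev k U \<in> sets M" if U: "U \<in> \<U>" for U
    proof -
      obtain U1 U2 where "U = U1 \<times> U2" "open U1" "open U2" "U1 \<noteq> {}" "U2 \<noteq> {}" using \<U>(3)[OF U] by blast
      then show ?thesis using B by (intro joint_sets t) (auto simp: fst_image_times snd_image_times)
    qed
    have UNs: "(\<Union>U\<in>\<U>. ?ev k U) \<in> sets M" using evs \<U>(1) by (intro sets.finite_UN) auto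
    have "joint (r k) t B1 B2 \<le> measure M ((\<Union>U\<in>\<U>. ?ev k U) \<union> (?K0 \<union> ?Kt))"
      unfolding joint_def
    proof (intro M.finite_measure_mono subsetI)
      fix \<omega> assume \<omega>: "\<omega> \<in> {\<omega> \<in> space M. path_of (X (r k) \<omega>) 0 \<in> B1 \<and> path_of (X (r k) \<omega>) t \<in> B2}"
      show "\<omega> \<in> (\<Union>U\<in>\<U>. ?ev k U) \<union> (?K0 \<union> ?Kt)"
      proof (cases "path_of (X (r k) \<omega>) 0 \<in> K \<and> path_of (X (r k) \<omega>) t \<in> K")
        case True
        then obtain U where U: "U \<in> \<U>" "(path_of (X (r k) \<omega>) 0, path_of (X (r k) \<omega>) t) \<in> U"
          using \<U>(2) by blast
        then have "path_of (X (r k) \<omega>) 0 \<in> fst ` U" "path_of (X (r k) \<omega>) t \<in> snd ` U"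
          by (force simp: image_iff)+
        then show ?thesis using U(1) \<omega> by blast
      next
        case False then show ?thesis using \<omega> by blast
      qed
    qed (use Ks UNs in auto)
    also have "\<dots> \<le> measure M (\<Union>U\<in>\<U>. ?ev k U) + measure M (?K0 \<union> ?Kt)"
      using Ks UNs by (intro measure_Un_le) auto
    also have "measure M (?K0 \<union> ?Kt) \<le> measure M ?K0 + measure M ?Kt"
      using Ks by (intro measure_Un_le) auto
    also have "measure M ?K0 = measure (P (r k)) (- K)" by (rule invariant[OF order_refl Kb])
    also have "measure M ?Kt = measure (P (r k)) (- K)" by (rule invariant[OF t Kb])
    also have "measure M (\<Union>U\<in>\<U>. ?ev k U) \<le> (\<Sum>U\<in>\<U>. measure M (?ev k U))"
      using evs \<U>(1) by (intro measure_UNION_le) auto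
    also have "\<dots> = (\<Sum>U\<in>\<U>. ?\<mu> U k)" by (simp add: joint_def)
    finally show ?case using elim by simp
  qed
  then show False using eventually_power_contradiction[OF r _ b2(2) big] b0 b2 by simp
qed

end

section \<open>Trajectories, reachability and attraction to \<open>A\<close>\<close>

lemma continuous_in_cadlag_paths:
  fixes f :: "real \<Rightarrow> 'a::topological_space"
  assumes f: "continuous_on {0..} f" "f \<in> extensional {0..}"
  shows "f \<in> cadlag_paths"
proof -
  have lim: "(f \<longlongrightarrow> f t) (at t within {0..})" if "0 \<le> t" for t
    using f(1) that by (simp add: continuous_on_def)
  have "(f \<longlongrightarrow> f t) (at_right t)" if "0 \<le> t" for t
    by (rule tendsto_within_subset[OF lim[OF that]]) (use that in auto)
  moreover have "\<exists>l. (f \<longlongrightarrow> l) (at_left t)" if "0 < t" for t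
  proof -
    have "(f \<longlongrightarrow> f t) (at t within {0<..<t})"
      by (rule tendsto_within_subset[OF lim]) (use that in auto)
    moreover have "at t within {0<..<t} = at_left t"
      by (rule at_within_nhd[of t "{0<..}"]) (use that in auto)
    ultimately show ?thesis by auto
  qed
  ultimately show ?thesis using f(2) by (auto simp: cadlag_paths_def)
qed

lemma path_eqI:
  assumes "\<And>t. 0 \<le> t \<Longrightarrow> path_of Y t = path_of Z t"
  shows "Y = Z"
proof -
  have "path_of Y = path_of Z"
    using path_of[of Y] path_of[of Z] assms
    by (intro extensionalityI[of _ "{0..}"]) (auto simp: cadlag_paths_def)
  then show ?thesis by (simp add: path_of_inject)
qed

lemma concat_path:
  assumes Y: "continuous_on {0..} (path_of Y)" and Z: "continuous_on {0..} (path_of Z)"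
    and s: "0 \<le> s" and eq: "path_of Y s = path_of Z 0"
  obtains W where "\<And>u. u \<in> {0..s} \<Longrightarrow> path_of W u = path_of Y u" "time_shift s W = Z"
proof -
  define f where "f = restrict (\<lambda>u. if u \<le> s then path_of Y u else path_of Z (u - s)) {0..}"
  have "continuous_on {s..} (\<lambda>u. path_of Z (u - s))"
    by (rule continuous_on_compose2[OF Z]) (auto intro!: continuous_intros)
  moreover have "continuous_on {0..s} (path_of Y)" using Y by (rule continuous_on_subset) auto
  ultimately have "continuous_on ({0..s} \<union> {s..}) (\<lambda>u. if u \<le> s then path_of Y u else path_of Z (u - s))"
    using eq by (intro continuous_on_If) auto
  moreover have "{0..s} \<union> {s..} = {0..}" using s by auto
  moreover have "continuous_on {0..} f \<longleftrightarrow>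
      continuous_on {0..} (\<lambda>u. if u \<le> s then path_of Y u else path_of Z (u - s))"
    by (rule continuous_on_cong) (auto simp: f_def)
  ultimately have "continuous_on {0..} f" by simp
  then have "f \<in> cadlag_paths" by (intro continuous_in_cadlag_paths) (auto simp: f_def)
  then have W: "path_of (Skorohod f) = f" by (simp add: Skorohod_inverse)
  show thesis
  proof (rule that[of "Skorohod f"])
    show "path_of (Skorohod f) u = path_of Y u" if "u \<in> {0..s}" for u
      unfolding W using that by (simp add: f_def)
    show "time_shift s (Skorohod f) = Z"
    proof (rule path_eqI)
      fix t :: real assume "0 \<le> t"
      then show "path_of (time_shift s (Skorohod f)) t = path_of Z t"
        unfolding path_of_time_shift[OF s \<open>0 \<le> t\<close>] W using s eq by (cases "t = 0") (auto simp: f_def)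
    qed
  qed
qed

lemma mult_le_of_less:
  fixes a b d :: real
  assumes "\<And>c. 0 \<le> c \<Longrightarrow> c < a \<Longrightarrow> c * b \<le> d" "0 \<le> b" "0 \<le> d"
  shows "a * b \<le> d"
proof (rule ccontr)
  assume "\<not> a * b \<le> d"
  then have "d < a * b" by simp
  then have "0 < b" using assms(2,3) by (cases "b = 0") auto
  then have "d / b < a" using \<open>d < a * b\<close> by (simp add: field_simps)
  then obtain c where c: "d / b < c" "c < a" using dense by blast
  moreover have "0 \<le> d / b" using assms by simp
  ultimately have "c * b \<le> d" using assms(1)[of c] by simp
  with c \<open>0 < b\<close> show False by (simp add: field_simps)
qed

lemma deviability_mono:
  assumes "deviability E" "x \<in> S" shows "E {x} \<le> E S"
proof -
  have "bdd_above ((\<lambda>x. E {x}) ` S)"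
    using deviability_density(2)[OF assms(1)] by (intro bdd_aboveI2)
  then show ?thesis
    unfolding deviability_density(3)[OF assms(1), of S] using assms(2) by (intro sup0_upper) auto
qed

lemma less_deviability:
  assumes "deviability E" "0 \<le> c" "c < E S" shows "\<exists>x\<in>S. c < E {x}"
  using less_sup0[OF assms(2), of "(\<lambda>x. E {x}) ` S"] assms(3)
  unfolding deviability_density(3)[OF assms(1), of S] by blast

context stationary_ld
begin

lemma trans_dens_ge: "path_of Y t = y \<Longrightarrow> D x {Y} \<le> trans_dens D x t y"
  unfolding trans_dens_def by (intro sup0_upper bdd_aboveI2[of _ _ 1] D_le_1) auto

lemma less_trans_dens: "0 \<le> c \<Longrightarrow> c < trans_dens D x t y \<Longrightarrow> \<exists>Y. path_of Y t = y \<and> c < D x {Y}"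
  unfolding trans_dens_def by (drule (1) less_sup0) auto

text \<open>On \<open>A\<close> this is the limit of the transition densities for large times (\<open>lim_dens_A\<close> below). Taking a
  supremum over all times gives a definition that makes sense everywhere.\<close>

definition reach :: "'a \<Rightarrow> 'a \<Rightarrow> real"
  where "reach x y = sup0 {D x {Y} | Y t. 0 \<le> t \<and> path_of Y t = y}"

lemma reach_bdd: "bdd_above {D x {Y} | Y t. 0 \<le> t \<and> path_of Y t = y}"
  by (rule bdd_aboveI[of _ 1]) (auto intro: D_le_1)

lemma reach_ge: "0 \<le> t \<Longrightarrow> path_of Y t = y \<Longrightarrow> D x {Y} \<le> reach x y"
  unfolding reach_def by (intro sup0_upper reach_bdd) auto

lemma less_reach: "0 \<le> c \<Longrightarrow> c < reach x y \<Longrightarrow> \<exists>Y t. 0 \<le> t \<and> path_of Y t = y \<and> c < D x {Y}"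
  unfolding reach_def by (drule (1) less_sup0) auto

lemma reach_least: "(\<And>Y t. 0 \<le> t \<Longrightarrow> path_of Y t = y \<Longrightarrow> D x {Y} \<le> c) \<Longrightarrow> 0 \<le> c \<Longrightarrow> reach x y \<le> c"
  unfolding reach_def by (intro sup0_least) auto

lemma reach_nonneg: "0 \<le> reach x y"
  unfolding reach_def by (intro sup0_nonneg reach_bdd) (auto intro: D_nonneg)

lemma reach_le_1: "reach x y \<le> 1"
  by (intro reach_least D_le_1) auto

lemma trans_dens_le_reach: "0 \<le> t \<Longrightarrow> trans_dens D x t y \<le> reach x y"
  unfolding trans_dens_def by (intro sup0_least) (auto intro: reach_ge reach_nonneg)

lemma prefix_le_reach:
  assumes "0 \<le> s" shows "D x (same_until s Y) \<le> reach x (path_of Y s)"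
proof (rule dense_le)
  fix c assume c: "c < D x (same_until s Y)"
  show "c \<le> reach x (path_of Y s)"
  proof (cases "0 \<le> c")
    case True
    then obtain Z where "Z \<in> same_until s Y" "c < D x {Z}" using less_deviability[OF dev True c] by blast
    then show ?thesis using reach_ge[OF assms, of Z "path_of Y s" x] assms by (auto simp: same_until_def)
  qed (use reach_nonneg[of x "path_of Y s"] in simp)
qed

lemma path_le_reach_reach:
  assumes "0 \<le> s" "s \<le> t"
  shows "D x {Y} \<le> reach x (path_of Y s) * reach (path_of Y s) (path_of Y t)"
  unfolding markov[OF assms(1), of x Y]
proof (rule mult_mono)
  show "D (path_of Y s) {time_shift s Y} \<le> reach (path_of Y s) (path_of Y t)"
    using assms by (intro reach_ge[of "t - s"]) (auto simp: path_of_time_shift)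
qed (auto intro: prefix_le_reach assms D_nonneg reach_nonneg)

text \<open>Weight one forces a visit near \<open>A\<close>. Around a pair \<open>(x, Y)\<close> of a starting point and a
  trajectory, either the weight stays below some \<open>c < 1\<close>, an open condition by upper semicontinuity, or
  the weight is one and nearby trajectories visit the neighbourhood of \<open>A\<close> before a common
  time. Finitely many such neighbourhoods cover the compact set of pairs of weight at least \<open>1 / 2\<close>.\<close>

lemma near_A_uniform:
  assumes K: "compact K" and \<delta>: "0 < \<delta>"
  shows "\<exists>c T. 0 \<le> c \<and> c < 1 \<and> 0 \<le> T \<and> (\<forall>x\<in>K. \<forall>Y. c < D x {Y} \<longrightarrow> (\<exists>s\<in>{0..T}. infdist (path_of Y s) A < \<delta>))"
proof -
  define K' where "K' = (\<Union>x\<in>K. {Y. 1 / 2 \<le> D x {Y}})"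
  have K': "compact K'" unfolding K'_def by (intro level K) auto
  let ?Q = "\<lambda>U c T. c < 1 \<and> (\<forall>(x, Y)\<in>U. c < D x {Y} \<longrightarrow> (\<exists>s\<in>{0..T}. infdist (path_of Y s) A < \<delta>))"
  define R where "R p U c T \<longleftrightarrow> p \<in> U \<and> open U \<and> ?Q U c T" for p U c T
  have "\<exists>U c T. p \<in> U \<and> open U \<and> ?Q U c T" for p
  proof -
    obtain x Y where p: "p = (x, Y)" by (cases p)
    show ?thesis
    proof (cases "D x {Y} = 1")
      case False
      then have "D x {Y} < 1" using D_le_1[of x "{Y}"] by simp
      then obtain c where c: "D x {Y} < c" "c < 1" using dense by blast
      let ?U = "{p. (case p of (x, Y) \<Rightarrow> D x {Y}) < c}"
      have "open ?U" using usc unfolding upper_semicontinuous_def by blast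
      then show ?thesis using p c by (intro exI[of _ ?U] exI[of _ c] exI[of _ 1]) auto
    next
      case True
      define g where "g z = max 0 (min 1 (\<delta> - infdist z A))" for z
      have g: "\<And>z. 0 \<le> g z" "\<And>z. g z \<le> 1" by (auto simp: g_def)
      have gL: "1-lipschitz_on UNIV g"
      proof (rule lipschitz_onI)
        fix u v :: 'a
        have "\<bar>infdist u A - infdist v A\<bar> \<le> dist u v" by (rule infdist_triangle_abs)
        then show "dist (g u) (g v) \<le> 1 * dist u v" unfolding g_def dist_real_def by linarith
      qed simp
      \<comment> \<open>Visiting the \<open>\<delta>\<close>-neighbourhood of \<open>A\<close> before time \<open>1 / m\<close> follows from the open
        condition \<open>0 < path_sup g m 0 Z\<close>, and \<open>m\<close> is small enough for \<open>Y\<close> to satisfy it.\<close>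
      have "(INF t\<in>{0..}. infdist (path_of Y t) A) < \<delta>" using attract[OF True] \<delta> by simp
      then obtain t where t: "0 \<le> t" "infdist (path_of Y t) A < \<delta>"
        by (subst (asm) cINF_less_iff) (auto intro!: bdd_belowI2[of _ 0] infdist_nonneg)
      have gt: "0 < g (path_of Y t)" using t \<delta> by (simp add: g_def)
      define m where "m = g (path_of Y t) / (t + 1)"
      have m: "0 < m" "m * t < g (path_of Y t)" using gt t by (auto simp: m_def field_simps)
      let ?U = "UNIV \<times> (path_sup g m 0 -` {0<..})"
      have "open (path_sup g m 0 -` {0<..})"
        using continuous_path_sup[OF g m(1) order_refl gL] by (simp add: open_vimage)
      then have "open ?U" by (intro open_Times) auto
      moreover have "p \<in> ?U"
        using path_sup_ge[where g = g and m = m and t = 0 and Y = Y and s = t, OF g m(1) order_refl t(1)] m(2) t(1) p by simp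
      moreover have "\<exists>s\<in>{0..1 / m}. infdist (path_of Z s) A < \<delta>" if pos: "0 < path_sup g m 0 Z" for Z
      proof -
        obtain s where s: "0 \<le> s" "0 < g (path_of Z s) - m * \<bar>s - 0\<bar>"
          using less_path_sup[where g = g and m = m and t = 0 and Y = Z and c = 0, OF g m(1) order_refl order_refl pos] by blast
        have "m * s \<le> 1" using s g(2)[of "path_of Z s"] by simp
        then have "s \<le> 1 / m" using m by (simp add: field_simps)
        moreover have "0 < g (path_of Z s)" using s m by (smt (verit) mult_nonneg_nonneg)
        then have "infdist (path_of Z s) A < \<delta>" by (simp add: g_def)
        ultimately show ?thesis using s by auto
      qed
      ultimately show ?thesis by (intro exI[of _ ?U] exI[of _ 0] exI[of _ "1 / m"]) auto
    qed
  qed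
  then have "\<exists>U c T. R p U c T" for p unfolding R_def .
  then obtain U c T where UcT: "\<And>p. R p (U p) (c p) (T p)" by metis
  have U: "p \<in> U p" "open (U p)" "?Q (U p) (c p) (T p)" for p using UcT[of p] unfolding R_def by blast+
  obtain F where F: "finite F" "K \<times> K' \<subseteq> (\<Union>p\<in>F. U p)"
  proof (rule compactE_image[OF compact_Times[OF K K'], of UNIV U])
    show "K \<times> K' \<subseteq> \<Union> (range U)" using U(1) by blast
  qed (use U(2) in auto)
  define c0 where "c0 = Max (insert (1 / 2) (c ` F))"
  define T0 where "T0 = Max (insert 1 (T ` F))"
  have c1: "c p < 1" for p using U(3)[of p] by blast
  have c0: "1 / 2 \<le> c0" "\<And>p. p \<in> F \<Longrightarrow> c p \<le> c0" unfolding c0_def using F(1) by (intro Max_ge; simp)+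
  have c0': "c0 < 1" using F(1) c1 by (simp add: c0_def)
  have T0: "1 \<le> T0" "\<And>p. p \<in> F \<Longrightarrow> T p \<le> T0" using F(1) by (auto simp: T0_def)
  have "\<exists>s\<in>{0..T0}. infdist (path_of Y s) A < \<delta>" if x: "x \<in> K" and Y: "c0 < D x {Y}" for x Y
  proof -
    have "Y \<in> K'" using x Y c0(1) by (auto simp: K'_def intro!: bexI[of _ x])
    then obtain p where p: "p \<in> F" "(x, Y) \<in> U p" using x F(2) by blast
    then have "\<exists>s\<in>{0..T p}. infdist (path_of Y s) A < \<delta>" using U(3)[of p] Y c0(2)[OF p(1)] by fastforce
    then show ?thesis using T0(2)[OF p(1)] by fastforce
  qed
  then show ?thesis using c0(1) c0' T0(1) by (intro exI[of _ c0] exI[of _ T0]) auto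
qed

text \<open>The weight is the product of the weights of the pieces of length \<open>T\<close>; if it exceeds \<open>c ^ N\<close> then one of the
  first \<open>N\<close> pieces has weight above \<open>c\<close>.\<close>

lemma near_A_iterate:
  assumes T: "0 \<le> T" and c: "0 \<le> c"
    and near: "\<And>x Y. x \<in> K \<Longrightarrow> c < D x {Y} \<Longrightarrow> \<exists>s\<in>{0..T}. infdist (path_of Y s) A < \<delta>"
  shows "x \<in> K \<Longrightarrow> (\<And>s. s \<in> {0..real N * T} \<Longrightarrow> path_of Y s \<in> K) \<Longrightarrow> c ^ N < D x {Y} \<Longrightarrow>
    \<exists>s\<in>{0..real N * T}. infdist (path_of Y s) A < \<delta>"
proof (induction N arbitrary: x Y)
  case 0
  then show ?case using D_le_1[of x "{Y}"] by simp
next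
  case (Suc N)
  have NT: "0 \<le> real N * T" using T by simp
  have Suc_T: "real (Suc N) * T = T + real N * T" by (simp add: algebra_simps)
  show ?case
  proof (cases "c < D x (same_until T Y)")
    case True
    then obtain Z where Z: "Z \<in> same_until T Y" "c < D x {Z}" using less_deviability[OF dev c True] by blast
    then obtain s where "s \<in> {0..T}" "infdist (path_of Z s) A < \<delta>" using near Suc.prems(1) by blast
    moreover have "s \<in> {0..T + real N * T}" using \<open>s \<in> {0..T}\<close> NT unfolding atLeastAtMost_iff by linarith
    ultimately show ?thesis using Z(1) unfolding Suc_T by (intro bexI[of _ s]) (auto simp: same_until_def)
  next
    case False
    have "c ^ Suc N < D x (same_until T Y) * D (path_of Y T) {time_shift T Y}"
      using Suc.prems(3) unfolding markov[OF T, of x Y] .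
    also have "\<dots> \<le> c * D (path_of Y T) {time_shift T Y}"
      using False by (intro mult_right_mono D_nonneg) auto
    finally have "c * c ^ N < c * D (path_of Y T) {time_shift T Y}" by simp
    then have "c ^ N < D (path_of Y T) {time_shift T Y}" using c by (simp add: mult_less_cancel_left)
    moreover have "T \<in> {0..real (Suc N) * T}" unfolding Suc_T atLeastAtMost_iff using NT T by linarith
    then have "path_of Y T \<in> K" by (rule Suc.prems(2))
    moreover have "path_of (time_shift T Y) s \<in> K" if "s \<in> {0..real N * T}" for s
    proof -
      have "T + s \<in> {0..real (Suc N) * T}" unfolding Suc_T using that T by simp
      then show ?thesis using Suc.prems(2)[of "T + s"] that T by (simp add: path_of_time_shift)
    qed
    ultimately obtain s where s: "s \<in> {0..real N * T}" "infdist (path_of (time_shift T Y) s) A < \<delta>"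
      using Suc.IH by blast
    then show ?thesis using T unfolding Suc_T
      by (intro bexI[of _ "T + s"]) (auto simp: path_of_time_shift)
  qed
qed

end

section \<open>Consequences of stationarity for limit densities\<close>

locale stationary_limit = stationary_ld P M X \<kappa> D A
  for P :: "nat \<Rightarrow> 'a::metric_space measure" and M :: "'w measure" and X \<kappa> D A +
  fixes r :: "nat \<Rightarrow> nat" and e :: "'a \<Rightarrow> real"
  assumes r: "strict_mono r" and ld: "local_ld r P e"
begin

lemmas e_nonneg = local_ld_nonneg[OF ld] and e_le_1 = local_ld_le_1[OF ld r]

lemma e_path:
  assumes t: "0 \<le> t" shows "e x * D x {Y} \<le> e (path_of Y t)"
proof (rule ccontr)
  assume "\<not> ?thesis"
  then obtain c where c: "e (path_of Y t) < c" "c < e x * D x {Y}" using dense by (metis not_le)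
  obtain b where b: "e (path_of Y t) < b" "b < c" using dense[OF c(1)] by blast
  obtain \<rho> where \<rho>: "0 < \<rho>" "\<forall>\<^sub>F k in sequentially. measure (P (r k)) (ball (path_of Y t) \<rho>) \<le> b ^ r k"
    using local_ld_upper[OF ld b(1)] by blast
  have b0: "0 \<le> b" "0 \<le> c" using e_nonneg[of "path_of Y t"] b by auto
  have "\<forall>\<^sub>F k in sequentially. c ^ r k \<le> measure (P (r k)) (ball (path_of Y t) \<rho>)"
    using joint_ball_lower[OF ld r b0(2) c(2) t \<rho>(1)]
  proof eventually_elim
    case (elim k)
    have "joint (r k) t (ball x \<rho>) (ball (path_of Y t) \<rho>) \<le> joint (r k) t UNIV (ball (path_of Y t) \<rho>)"
      using t by (intro joint_mono) auto
    also have "\<dots> = measure (P (r k)) (ball (path_of Y t) \<rho>)"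
      using invariant[OF t, of "ball (path_of Y t) \<rho>" "r k"] by (simp add: joint_def)
    finally show ?case using elim by simp
  qed
  then show False using eventually_power_contradiction[OF r b0(1) b(2) _ \<rho>(2)] by blast
qed

text \<open>The conditional laws are tied to the initial point only through the process itself. If \<open>e x\<close> is
  positive, \<open>joint_ball_lower\<close> at time zero would give positive probability to starting in two
  disjoint balls. At a point where \<open>e\<close> vanishes the trajectories of positive weight may start elsewhere, and
  this is why the lemmas on concatenation below assume \<open>0 < e x\<close>.\<close>

lemma path_starts:
  assumes "0 < e x" "0 < D x {Y}" shows "path_of Y 0 = x"
proof (rule ccontr)
  assume neq: "path_of Y 0 \<noteq> x"
  define \<rho> where "\<rho> = dist x (path_of Y 0) / 2"
  have \<rho>: "0 < \<rho>" using neq by (simp add: \<rho>_def)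
  have disj: "ball x \<rho> \<inter> ball (path_of Y 0) \<rho> = {}"
    by (rule disjoint_ballI) (simp add: \<rho>_def)
  have "0 < e x * D x {Y}" using assms by simp
  then obtain c where c: "0 < c" "c < e x * D x {Y}" using dense by blast
  have "joint n 0 (ball x \<rho>) (ball (path_of Y 0) \<rho>) = 0" for n
  proof -
    have "{\<omega> \<in> space M. path_of (X n \<omega>) 0 \<in> ball x \<rho> \<and> path_of (X n \<omega>) 0 \<in> ball (path_of Y 0) \<rho>} = {}"
      using disj by blast
    then show ?thesis unfolding joint_def by (simp only: measure_empty)
  qed
  then have "\<forall>\<^sub>F k in sequentially. c ^ r k \<le> 0"
    using joint_ball_lower[OF ld r less_imp_le[OF c(1)] c(2) order_refl \<rho>] by simp
  then obtain k where "c ^ r k \<le> 0" using eventually_happens[of _ sequentially] by auto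
  moreover have "0 < c ^ r k" using c(1) by simp
  ultimately show False by linarith
qed

text \<open>The junction point \<open>path_of Y s\<close> inherits positive density from \<open>x\<close>, so \<open>Z\<close> does start there and the
  concatenated trajectory is continuous.\<close>

lemma path_concat:
  assumes x: "0 < e x" "0 < D x {Y}" and s: "0 \<le> s" and Z: "0 < D (path_of Y s) {Z}"
  obtains W where "D x {Y} * D (path_of Y s) {Z} \<le> D x {W}" "\<And>t. 0 \<le> t \<Longrightarrow> path_of W (s + t) = path_of Z t"
proof -
  have "0 < e x * D x {Y}" using x by simp
  then have "0 < e (path_of Y s)" using e_path[OF s] by (rule less_le_trans)
  then have start: "path_of Y s = path_of Z 0" using path_starts Z by metis
  have "continuous_on {0..} (path_of Y)" "continuous_on {0..} (path_of Z)"
    using cont[of Y x] cont[of Z "path_of Y s"] x Z by force+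
  then obtain W where W: "\<And>u. u \<in> {0..s} \<Longrightarrow> path_of W u = path_of Y u" "time_shift s W = Z"
    using concat_path[OF _ _ s start] by blast
  have "Y \<in> same_until s W" using W(1) by (auto simp: same_until_def)
  then have "D x {Y} \<le> D x (same_until s W)" by (rule deviability_mono[OF dev])
  then have "D x {Y} * D (path_of Y s) {Z} \<le> D x (same_until s W) * D (path_of Y s) {Z}"
    by (intro mult_right_mono D_nonneg)
  also have "\<dots> = D x {W}" using markov[OF s, of x W] W s by simp
  finally show thesis using that[of W] W(2) s path_of_time_shift[OF s, of _ W] by auto
qed

lemma e_reach: "e x * reach x y \<le> e y"
proof -
  have "reach x y * e x \<le> e y"
  proof (rule mult_le_of_less[OF _ e_nonneg e_nonneg])
    fix c assume "0 \<le> c" "c < reach x y"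
    then obtain Y t where Y: "0 \<le> t" "path_of Y t = y" "c < D x {Y}" using less_reach by blast
    have "c * e x \<le> D x {Y} * e x" using Y by (intro mult_right_mono e_nonneg) auto
    also have "\<dots> \<le> e y" using e_path[OF Y(1), of x Y] Y(2) by (simp add: mult.commute)
    finally show "c * e x \<le> e y" .
  qed
  then show ?thesis by (simp add: mult.commute)
qed

lemma reach_trans:
  assumes x: "0 < e x" shows "reach x y * reach y z \<le> reach x z"
proof (rule mult_le_of_less[OF _ reach_nonneg reach_nonneg])
  fix c assume "0 \<le> c" "c < reach x y"
  then obtain Y s where Y: "0 \<le> s" "path_of Y s = y" "c < D x {Y}" using less_reach by blast
  have DY: "0 < D x {Y}" using Y \<open>0 \<le> c\<close> by simp
  have "reach y z * D x {Y} \<le> reach x z"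
  proof (rule mult_le_of_less[OF _ D_nonneg reach_nonneg])
    fix c' assume "0 \<le> c'" "c' < reach y z"
    then obtain Z t where Z: "0 \<le> t" "path_of Z t = z" "c' < D y {Z}" using less_reach by blast
    have "0 < D (path_of Y s) {Z}" using Z Y \<open>0 \<le> c'\<close> by simp
    then obtain W where W: "D x {Y} * D (path_of Y s) {Z} \<le> D x {W}" "\<And>t. 0 \<le> t \<Longrightarrow> path_of W (s + t) = path_of Z t"
      using path_concat[OF x DY Y(1)] by blast
    have "c' * D x {Y} \<le> D (path_of Y s) {Z} * D x {Y}" using Z Y by (intro mult_right_mono D_nonneg) auto
    also have "\<dots> \<le> D x {W}" using W(1) by (simp add: mult.commute)
    also have "\<dots> \<le> reach x z" using W(2)[OF Z(1)] Z Y by (intro reach_ge[of "s + t"]) auto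
    finally show "c' * D x {Y} \<le> reach x z" .
  qed
  moreover have "c * reach y z \<le> D x {Y} * reach y z" using Y by (intro mult_right_mono reach_nonneg) auto
  ultimately show "c * reach y z \<le> reach x z" by (simp add: mult.commute)
qed

text \<open>A trajectory with \<open>\<gamma> \<le> e x * D x {Y}\<close> stays in the compact set \<open>{x. \<gamma> \<le> e x}\<close>, so
  \<open>near_A_iterate\<close> applies once \<open>c ^ N < \<gamma>\<close>.\<close>

lemma long_path_near_A:
  assumes \<gamma>: "0 < \<gamma>" and \<epsilon>: "0 < \<epsilon>"
  shows "\<exists>T\<ge>0. \<forall>x Y t. T \<le> t \<longrightarrow> \<gamma> \<le> e x * D x {Y} \<longrightarrow>
    (\<exists>a\<in>A. \<exists>s\<in>{0..t}. 1 - \<epsilon> < reach (path_of Y s) a \<and> 1 - \<epsilon> < reach a (path_of Y s))"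
proof -
  obtain \<delta> where \<delta>: "0 < \<delta>" "\<And>x. infdist x A < \<delta> \<Longrightarrow>
      \<exists>s0>0. \<exists>s1>0. \<exists>a\<in>A. 1 - \<epsilon> < trans_dens D x s0 a \<and> 1 - \<epsilon> < trans_dens D a s1 x"
    using near[OF \<epsilon>] by blast
  have near': "\<exists>a\<in>A. 1 - \<epsilon> < reach x a \<and> 1 - \<epsilon> < reach a x" if x: "infdist x A < \<delta>" for x
  proof -
    obtain s0 s1 a where "0 < s0" "0 < s1" "a \<in> A" "1 - \<epsilon> < trans_dens D x s0 a" "1 - \<epsilon> < trans_dens D a s1 x"
      using \<delta>(2)[OF x] by blast
    then show ?thesis
      using trans_dens_le_reach[of s0 x a] trans_dens_le_reach[of s1 a x] by (intro bexI[of _ a]) auto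
  qed
  let ?K = "{x. \<gamma> \<le> e x}"
  obtain c T where cT: "0 \<le> c" "c < 1" "0 \<le> T"
      "\<And>x Y. x \<in> ?K \<Longrightarrow> c < D x {Y} \<Longrightarrow> \<exists>s\<in>{0..T}. infdist (path_of Y s) A < \<delta>"
    using near_A_uniform[OF local_ld_compact[OF ld r \<gamma>] \<delta>(1)] by blast
  obtain N where N: "c ^ N < \<gamma>" using real_arch_pow_inv[OF \<gamma> cT(2)] by blast
  have "\<exists>a\<in>A. \<exists>s\<in>{0..t}. 1 - \<epsilon> < reach (path_of Y s) a \<and> 1 - \<epsilon> < reach a (path_of Y s)"
    if t: "real N * T \<le> t" and Y: "\<gamma> \<le> e x * D x {Y}" for x Y t
  proof -
    have "e x * D x {Y} \<le> 1 * D x {Y}" using e_le_1 by (intro mult_right_mono D_nonneg) auto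
    then have "c ^ N < D x {Y}" using N Y by simp
    moreover have "e x * D x {Y} \<le> e x * 1" using D_le_1 e_nonneg by (intro mult_left_mono) auto
    then have "x \<in> ?K" using Y by simp
    moreover have "path_of Y s \<in> ?K" if "s \<in> {0..real N * T}" for s
      using e_path[of s x Y] that Y by simp
    ultimately have "\<exists>s\<in>{0..real N * T}. infdist (path_of Y s) A < \<delta>"
      by (intro near_A_iterate[OF cT(3,1,4)])
    then obtain s where s: "s \<in> {0..real N * T}" "infdist (path_of Y s) A < \<delta>" by blast
    from near'[OF s(2)] obtain a where "a \<in> A" "1 - \<epsilon> < reach (path_of Y s) a" "1 - \<epsilon> < reach a (path_of Y s)"
      by blast
    moreover have "s \<in> {0..t}" using s(1) t by simp
    ultimately show ?thesis by blast
  qed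
  then show ?thesis using cT(3) by (intro exI[of _ "real N * T"]) auto
qed

text \<open>The detour from the trajectory to \<open>a\<close> and back costs a factor \<open>\<nu>\<close> each way, hence the square
  root of \<open>\<eta>\<close>.\<close>

lemma long_path_via_A:
  assumes \<gamma>: "0 < \<gamma>" and \<eta>: "\<eta> < 1"
  shows "\<exists>T\<ge>0. \<forall>x Y t. T \<le> t \<longrightarrow> \<gamma> \<le> e x * D x {Y} \<longrightarrow>
    (\<exists>a\<in>A. \<eta> * \<gamma> \<le> e x * (reach x a * reach a (path_of Y t)))"
proof -
  define \<nu> where "\<nu> = sqrt (max \<eta> 0)"
  have \<nu>: "0 \<le> \<nu>" "\<nu> < 1" "\<eta> \<le> \<nu> * \<nu>" using \<eta> by (auto simp: \<nu>_def)
  obtain T where T: "0 \<le> T" "\<And>x Y t. T \<le> t \<Longrightarrow> \<gamma> \<le> e x * D x {Y} \<Longrightarrow>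
      \<exists>a\<in>A. \<exists>s\<in>{0..t}. \<nu> < reach (path_of Y s) a \<and> \<nu> < reach a (path_of Y s)"
    using long_path_near_A[OF \<gamma>, of "1 - \<nu>"] \<nu>(2) by auto
  have "\<exists>a\<in>A. \<eta> * \<gamma> \<le> e x * (reach x a * reach a (path_of Y t))"
    if t: "T \<le> t" and Y: "\<gamma> \<le> e x * D x {Y}" for x Y t
  proof -
    let ?y = "path_of Y t"
    obtain a s where a: "a \<in> A" "s \<in> {0..t}" "\<nu> < reach (path_of Y s) a" "\<nu> < reach a (path_of Y s)"
      using T(2)[OF t Y] by blast
    let ?w = "path_of Y s"
    have ex: "0 < e x" using Y \<gamma> e_nonneg[of x] by (cases "e x = 0") auto
    have ew: "0 < e ?w" using e_path[of s x Y] a(2) Y \<gamma> by simp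
    have "0 < e ?w * reach ?w a" using ew a(3) \<nu>(1) by simp
    then have ea: "0 < e a" using e_reach[of ?w a] by linarith
    have "\<eta> * \<gamma> \<le> (\<nu> * \<nu>) * \<gamma>" using \<nu> \<gamma> by (intro mult_right_mono) auto
    also have "\<dots> \<le> (\<nu> * \<nu>) * (e x * (reach x ?w * reach ?w ?y))"
    proof (intro mult_left_mono)
      have "e x * D x {Y} \<le> e x * (reach x ?w * reach ?w ?y)"
        using a(2) ex by (intro mult_left_mono path_le_reach_reach) auto
      with Y show "\<gamma> \<le> e x * (reach x ?w * reach ?w ?y)" by simp
    qed (use \<nu> in simp)
    also have "\<dots> = e x * ((reach x ?w * \<nu>) * (\<nu> * reach ?w ?y))" by (simp add: algebra_simps)
    also have "\<dots> \<le> e x * ((reach x ?w * reach ?w a) * (reach a ?w * reach ?w ?y))"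
      using a ex \<nu>(1) by (intro mult_left_mono mult_mono mult_right_mono mult_nonneg_nonneg reach_nonneg) auto
    also have "\<dots> \<le> e x * (reach x a * reach a ?y)"
      using ex ea by (intro mult_left_mono mult_mono reach_trans mult_nonneg_nonneg reach_nonneg) auto
    finally show ?thesis using a(1) by blast
  qed
  then show ?thesis using T(1) by blast
qed

text \<open>By stationarity the mass near \<open>y\<close> at a late time came from somewhere; this gives a trajectory that
  ends near \<open>y\<close>, and local controllability extends it to \<open>y\<close> at the cost of a factor \<open>1 - \<epsilon>\<close>.\<close>

lemma long_path_exists:
  assumes c: "0 \<le> c" "c < e y" and T: "0 \<le> T"
  shows "\<exists>x Y t. T \<le> t \<and> path_of Y t = y \<and> c < e x * D x {Y}"
proof -
  obtain w where w: "c < w" "w < e y" using dense[OF c(2)] by blast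
  obtain c1 where c1: "c < c1" "c1 < w" using dense[OF w(1)] by blast
  have c10: "0 < c1" using c c1 by simp
  define \<epsilon> where "\<epsilon> = 1 - c / c1"
  have \<epsilon>: "0 < \<epsilon>" "\<epsilon> \<le> 1" using c c1 c10 by (auto simp: \<epsilon>_def field_simps)
  obtain \<delta> t1 where \<delta>: "0 < \<delta>" "0 \<le> t1" "\<And>x'. dist y x' < \<delta> \<Longrightarrow> 1 - \<epsilon> < trans_dens D x' t1 y"
    using local_control[OF \<epsilon>(1), of y] by blast
  let ?B = "ball y (\<delta> / 2)"
  have t: "0 \<le> T + 1" "0 \<le> w" using T c w by auto
  have \<delta>2: "0 < \<delta> / 2" using \<delta> by simp
  have "\<forall>\<^sub>F k in sequentially. w ^ r k \<le> joint (r k) (T + 1) UNIV ?B"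
    using local_ld_lower[OF ld t(2) w(2) \<delta>2] invariant[OF t(1), of ?B] by (simp add: joint_def)
  then obtain x y' where xy: "y' \<in> closure ?B" "\<forall>\<rho>>0. \<exists>Y s. 0 \<le> s \<and> \<bar>s - (T + 1)\<bar> \<le> 1 \<and>
      path_of Y s \<in> ball y' \<rho> \<and> c1 < e x * D x {Y}"
    using joint_limit_pair[OF ld r t(1) _ _ less_imp_le[OF c10] c1(2), of UNIV ?B] by auto
  obtain Y s where Y: "0 \<le> s" "\<bar>s - (T + 1)\<bar> \<le> 1" "path_of Y s \<in> ball y' (\<delta> / 2)" "c1 < e x * D x {Y}"
    using xy(2) \<delta>2 by blast
  have "0 < e x * D x {Y}" using Y(4) c10 by simp
  then have pos: "0 < e x" "0 < D x {Y}"
    using e_nonneg[of x] D_nonneg[of x "{Y}"] by (auto simp: zero_less_mult_iff)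
  have "y' \<in> cball y (\<delta> / 2)" using xy(1) closure_minimal[OF ball_subset_cball closed_cball] by blast
  then have "dist y (path_of Y s) < \<delta>" using Y(3) dist_triangle[of y "path_of Y s" y'] by simp
  then obtain Z where Z: "path_of Z t1 = y" "1 - \<epsilon> < D (path_of Y s) {Z}"
    using less_trans_dens[of "1 - \<epsilon>"] \<delta>(3) \<epsilon>(2) by (metis diff_ge_0_iff_ge)
  have "0 < D (path_of Y s) {Z}" using Z \<epsilon> by simp
  then obtain W where W: "D x {Y} * D (path_of Y s) {Z} \<le> D x {W}" "\<And>t. 0 \<le> t \<Longrightarrow> path_of W (s + t) = path_of Z t"
    using path_concat[OF pos Y(1)] by blast
  have "c = c1 * (1 - \<epsilon>)" using c10 by (simp add: \<epsilon>_def)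
  also have "\<dots> \<le> c1 * D (path_of Y s) {Z}" using Z c10 by (intro mult_left_mono) auto
  also have "\<dots> < (e x * D x {Y}) * D (path_of Y s) {Z}"
    using Y(4) \<open>0 < D (path_of Y s) {Z}\<close> by (rule mult_strict_right_mono)
  also have "\<dots> \<le> e x * D x {W}" using W(1) pos by (simp add: mult.assoc mult_left_mono)
  finally have "c < e x * D x {W}" .
  moreover have "path_of W (s + t1) = y" using W(2)[OF \<delta>(2)] Z(1) by simp
  moreover have "T \<le> s + t1" using Y(2) \<delta>(2) by simp
  ultimately show ?thesis by blast
qed

text \<open>Divert a long trajectory that ends at \<open>y\<close> through \<open>A\<close>.\<close>

lemma e_from_A:
  assumes "0 \<le> c" "c < e y" shows "\<exists>a\<in>A. c < e a * reach a y"
proof -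
  obtain c2 where c2: "c < c2" "c2 < e y" using dense[OF assms(2)] by blast
  have c20: "0 < c2" using assms c2 by simp
  have "c / c2 < 1" using c2 c20 by simp
  then obtain \<eta> where \<eta>: "c / c2 < \<eta>" "\<eta> < 1" using dense by blast
  obtain T where T: "0 \<le> T" "\<And>x Y t. T \<le> t \<Longrightarrow> c2 \<le> e x * D x {Y} \<Longrightarrow>
      \<exists>a\<in>A. \<eta> * c2 \<le> e x * (reach x a * reach a (path_of Y t))"
    using long_path_via_A[OF c20 \<eta>(2)] by blast
  obtain x Y t where Y: "T \<le> t" "path_of Y t = y" "c2 < e x * D x {Y}"
    using long_path_exists[OF less_imp_le[OF c20] c2(2) T(1)] by blast
  then obtain a where a: "a \<in> A" "\<eta> * c2 \<le> e x * (reach x a * reach a y)"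
    using T(2)[OF Y(1) less_imp_le[OF Y(3)]] by blast
  have "c < \<eta> * c2" using \<eta>(1) c20 by (simp add: field_simps)
  also note a(2)
  also have "e x * (reach x a * reach a y) = (e x * reach x a) * reach a y" by simp
  also have "\<dots> \<le> e a * reach a y" by (intro mult_right_mono e_reach reach_nonneg)
  finally show ?thesis using a(1) by blast
qed

text \<open>Trajectories of weight almost one exist from every point, and they last forever, so they can be diverted
  to \<open>A\<close>.\<close>

lemma reach_A:
  assumes y: "0 < e y" and \<eta>: "\<eta> < 1" shows "\<exists>a\<in>A. \<eta> < reach y a"
proof -
  obtain \<nu> where \<nu>: "max \<eta> 0 < \<nu>" "\<nu> < 1" using dense[of "max \<eta> 0" 1] \<eta> by auto
  define \<mu> where "\<mu> = sqrt \<nu>"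
  have \<mu>: "0 < \<mu>" "\<mu> < 1" "\<mu> * \<mu> = \<nu>" using \<nu> by (auto simp: \<mu>_def)
  have "\<mu> < sup0 (range (\<lambda>Y. D y {Y}))" using deviability_density(4)[OF dev] \<mu> by simp
  then obtain Y where Y: "\<mu> < D y {Y}" using less_sup0[OF less_imp_le[OF \<mu>(1)]] by blast
  have "0 < \<mu> * e y" using \<mu> y by simp
  then obtain T where T: "0 \<le> T" "\<And>x Y t. T \<le> t \<Longrightarrow> \<mu> * e y \<le> e x * D x {Y} \<Longrightarrow>
      \<exists>a\<in>A. \<mu> * (\<mu> * e y) \<le> e x * (reach x a * reach a (path_of Y t))"
    using long_path_via_A[OF _ \<mu>(2)] by blast
  have "\<mu> * e y \<le> e y * D y {Y}" using Y y by simp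
  then obtain a where a: "a \<in> A" "\<mu> * (\<mu> * e y) \<le> e y * (reach y a * reach a (path_of Y T))"
    using T(2)[OF order_refl] by blast
  have "reach y a * reach a (path_of Y T) \<le> reach y a * 1" by (intro mult_left_mono reach_le_1 reach_nonneg)
  then have "e y * (reach y a * reach a (path_of Y T)) \<le> e y * reach y a" using y by simp
  moreover have "\<mu> * (\<mu> * e y) = e y * \<nu>" unfolding \<mu>(3)[symmetric] by simp
  ultimately have "e y * \<nu> \<le> e y * reach y a" using a(2) by linarith
  then have "\<nu> \<le> reach y a" using y by simp
  then show ?thesis using a(1) \<nu> by (intro bexI[of _ a]) auto
qed

lemma e_A_sup:
  assumes "c < 1" shows "\<exists>a\<in>A. c < e a"
proof -
  obtain \<nu> where \<nu>: "max c 0 < \<nu>" "\<nu> < 1" using dense[of "max c 0" 1] assms by auto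
  define \<mu> where "\<mu> = sqrt \<nu>"
  have \<mu>: "0 < \<mu>" "\<mu> < 1" "\<mu> * \<mu> = \<nu>" using \<nu> by (auto simp: \<mu>_def)
  obtain x where x: "\<mu> < e x" using local_ld_sup[OF ld r \<mu>(2)] by blast
  obtain a where a: "a \<in> A" "\<mu> < reach x a" using reach_A[OF _ \<mu>(2), of x] x \<mu>(1) by auto
  have "\<mu> * \<mu> \<le> e x * reach x a" using x a \<mu> by (intro mult_mono) auto
  then show ?thesis using e_reach[of x a] \<mu>(3) \<nu> a(1) by (intro bexI[of _ a]) auto
qed

lemma reach_A_pos: "a \<in> A \<Longrightarrow> a' \<in> A \<Longrightarrow> 0 < reach a a'"
  using communicate[of a a'] trans_dens_le_reach by (meson less_imp_le less_le_trans)

lemma e_A_pos: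
  assumes "a \<in> A" shows "0 < e a"
proof -
  obtain b where b: "b \<in> A" "0 < e b" using e_A_sup[of 0] by auto
  have "0 < e b * reach b a" using b reach_A_pos assms by simp
  then show ?thesis using e_reach[of b a] by linarith
qed

lemma constant_path:
  assumes "a \<in> A" obtains Y where "\<And>t. 0 \<le> t \<Longrightarrow> path_of Y t = a" "D a {Y} = 1"
proof -
  let ?Y = "Skorohod (restrict (\<lambda>_. a) {0..})"
  have *: "\<And>t. 0 \<le> t \<Longrightarrow> path_of ?Y t = a" by (simp add: Skorohod_inverse[OF const_cadlag_paths])
  show thesis using that[OF *] rest[OF assms *] by blast
qed

lemma reach_self: "a \<in> A \<Longrightarrow> reach a a = 1"
  using constant_path[of a] reach_ge[of 0 _ a a] reach_le_1[of a a] by (metis antisym order_refl)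

text \<open>Waiting at \<open>a\<close> before leaving is free.\<close>

lemma trans_dens_A_mono:
  assumes a: "a \<in> A" and st: "0 \<le> s" "s \<le> t"
  shows "trans_dens D a s y \<le> trans_dens D a t y"
proof (rule dense_le)
  fix c assume c: "c < trans_dens D a s y"
  show "c \<le> trans_dens D a t y"
  proof (cases "0 \<le> c")
    case False
    have "0 \<le> trans_dens D a t y"
      unfolding trans_dens_def by (intro sup0_nonneg bdd_aboveI2[of _ _ 1] D_le_1) (auto intro: D_nonneg)
    with False show ?thesis by simp
  next
    case True
    obtain Y where Y: "path_of Y s = y" "c < D a {Y}" using less_trans_dens[OF True c] by blast
    obtain Z where Z: "\<And>t. 0 \<le> t \<Longrightarrow> path_of Z t = a" "D a {Z} = 1" using constant_path[OF a] by blast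
    have ts: "0 \<le> t - s" using st by simp
    have "0 < D (path_of Z (t - s)) {Y}" using Z(1)[OF ts] Y True by simp
    then obtain W where W: "D a {Z} * D (path_of Z (t - s)) {Y} \<le> D a {W}"
        "\<And>u. 0 \<le> u \<Longrightarrow> path_of W (t - s + u) = path_of Y u"
      using path_concat[OF e_A_pos[OF a] _ ts] Z(2) by (metis zero_less_one)
    have "D a {W} \<le> trans_dens D a t y" using W(2)[OF st(1)] Y(1) by (intro trans_dens_ge) simp
    then show ?thesis using W(1) Z Y ts by simp
  qed
qed

lemma lim_dens_A:
  assumes a: "a \<in> A" shows "lim_dens D a y = reach a y"
proof -
  have "((\<lambda>t. trans_dens D a t y) \<longlongrightarrow> reach a y) at_top"
  proof (rule order_tendstoI)
    fix c assume c: "c < reach a y"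
    show "\<forall>\<^sub>F t in at_top. c < trans_dens D a t y"
    proof (cases "0 \<le> c")
      case False
      have "0 \<le> trans_dens D a t y" for t
        unfolding trans_dens_def by (intro sup0_nonneg bdd_aboveI2[of _ _ 1] D_le_1) (auto intro: D_nonneg)
      then show ?thesis using False by (intro always_eventually allI) (meson not_le order.strict_trans2)
    next
      case True
      obtain Y s where Y: "0 \<le> s" "path_of Y s = y" "c < D a {Y}" using less_reach[OF True c] by blast
      have "c < trans_dens D a t y" if "s \<le> t" for t
        using trans_dens_A_mono[OF a Y(1) that, of y] trans_dens_ge[OF Y(2), of a] Y(3) by linarith
      then show ?thesis using eventually_at_top_linorder by blast
    qed
  next
    fix c assume "reach a y < c"
    then have "trans_dens D a t y < c" if "0 \<le> t" for t using trans_dens_le_reach[OF that, of a y] by simp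
    then show "\<forall>\<^sub>F t in at_top. trans_dens D a t y < c" using eventually_at_top_linorder by blast
  qed
  then show ?thesis unfolding lim_dens_def by (intro tendsto_Lim) auto
qed

end

section \<open>Max flux and max balance\<close>

lemma sup0_attained:
  fixes h :: "'b \<Rightarrow> real"
  assumes fin: "finite {a \<in> S. c \<le> h a}" and c: "0 \<le> c" "c < sup0 (h ` S)"
  shows "\<exists>a\<in>S. sup0 (h ` S) \<le> h a"
proof -
  let ?T = "{a \<in> S. c \<le> h a}"
  obtain a1 where "a1 \<in> S" "c < h a1" using less_sup0[OF c] by auto
  then have ne: "h ` ?T \<noteq> {}" by auto
  have "Max (h ` ?T) \<in> h ` ?T" using fin ne by (intro Max_in) auto
  then obtain a where a: "a \<in> ?T" "h a = Max (h ` ?T)" by auto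
  have "h b \<le> h a" if "b \<in> S" for b
  proof (cases "c \<le> h b")
    case True
    then show ?thesis unfolding a(2) using fin that by (intro Max_ge) auto
  qed (use a(1) in auto)
  then have "sup0 (h ` S) \<le> h a" using a(1) c(1) by (intro sup0_least) auto
  then show ?thesis using a(1) by blast
qed

context stationary_ld
begin

definition reach_set :: "'a \<Rightarrow> 'a set \<Rightarrow> real"
  where "reach_set x B = sup0 (reach x ` B)"

lemma reach_set_ge: "b \<in> B \<Longrightarrow> reach x b \<le> reach_set x B"
  unfolding reach_set_def by (intro sup0_upper bdd_aboveI2[of _ _ 1] reach_le_1) auto

lemma reach_set_nonneg: "0 \<le> reach_set x B"
  unfolding reach_set_def by (intro sup0_nonneg bdd_aboveI2[of _ _ 1] reach_le_1) (auto intro: reach_nonneg)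

lemma reach_set_le_1: "reach_set x B \<le> 1"
  unfolding reach_set_def by (intro sup0_least) (auto intro: reach_le_1)

lemma mult_reach_set_le:
  assumes "\<And>b. b \<in> B \<Longrightarrow> k * reach x b \<le> v" "0 \<le> k" "0 \<le> v"
  shows "k * reach_set x B \<le> v"
proof -
  have "reach_set x B * k \<le> v"
  proof (rule mult_le_of_less[OF _ assms(2,3)])
    fix c assume "0 \<le> c" "c < reach_set x B"
    then obtain b where b: "b \<in> B" "c < reach x b" unfolding reach_set_def using less_sup0 by blast
    have "c * k \<le> reach x b * k" using b assms(2) by (intro mult_right_mono) auto
    also have "\<dots> \<le> v" using assms(1)[OF b(1)] by (simp add: mult.commute)
    finally show "c * k \<le> v" .
  qed
  then show ?thesis by (simp add: mult.commute)
qed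

end

context stationary_limit
begin

lemma lim_set_A:
  assumes "a \<in> A" shows "lim_set D {a} B = reach_set a B"
proof -
  have "{lim_dens D x y |x y. x \<in> {a} \<and> y \<in> B} = reach a ` B"
    using lim_dens_A[OF assms] by auto
  then show ?thesis by (simp add: lim_set_def reach_set_def)
qed

lemma max_flux_A:
  assumes "A1 \<subseteq> A" shows "max_flux D E A1 B = sup0 ((\<lambda>a. E {a} * reach_set a B) ` A1)"
  unfolding max_flux_def
  by (rule arg_cong[of _ _ sup0], rule image_cong[OF refl]) (use assms in \<open>simp add: lim_set_A subset_iff\<close>)

lemma max_flux_bdd:
  assumes "deviability E" shows "bdd_above ((\<lambda>a. E {a} * reach_set a B) ` A1)"
  using deviability_density(1,2)[OF assms] reach_set_le_1 reach_set_nonneg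
  by (intro bdd_aboveI2[of _ _ 1] mult_le_one)

lemma max_flux_ge:
  assumes "deviability E" "A1 \<subseteq> A" "a \<in> A1"
  shows "E {a} * reach_set a B \<le> max_flux D E A1 B"
  unfolding max_flux_A[OF assms(2)] using assms by (intro sup0_upper max_flux_bdd) auto

lemma max_flux_ge_reach:
  assumes "deviability E" "A1 \<subseteq> A" "a \<in> A1" "b \<in> B"
  shows "E {a} * reach a b \<le> max_flux D E A1 B"
proof -
  have "E {a} * reach a b \<le> E {a} * reach_set a B"
    using assms deviability_density(1)[OF assms(1)] by (intro mult_left_mono reach_set_ge)
  then show ?thesis using max_flux_ge[OF assms(1,2,3), of B] by linarith
qed

lemma max_flux_nonneg:
  assumes "deviability E" "A1 \<subseteq> A" shows "0 \<le> max_flux D E A1 B"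
  unfolding max_flux_A[OF assms(2)]
  using deviability_density(1)[OF assms(1)] by (intro sup0_nonneg max_flux_bdd[OF assms(1)]) (auto intro!: mult_nonneg_nonneg reach_set_nonneg)

lemma less_max_flux:
  assumes E: "deviability E" and A1: "A1 \<subseteq> A" and c: "0 \<le> c" "c < max_flux D E A1 B"
  shows "\<exists>a\<in>A1. \<exists>b\<in>B. c < E {a} * reach a b"
proof (rule ccontr)
  assume "\<not> ?thesis"
  then have le: "E {a} * reach a b \<le> c" if "a \<in> A1" "b \<in> B" for a b using that by force
  have "max_flux D E A1 B \<le> c"
    unfolding max_flux_A[OF A1] using c(1) deviability_density(1)[OF E] le
    by (intro sup0_least) (auto intro!: mult_reach_set_le)
  with c show False by simp
qed

text \<open>Let \<open>A1\<close> be the set where \<open>E1\<close> exceeds \<open>E2\<close>; its complement \<open>A2\<close> in \<open>A\<close> contains a point where \<open>E2\<close> is one. The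
  flux from \<open>A2\<close> to \<open>A1\<close> is at most as large for \<open>E1\<close> as for \<open>E2\<close>. The flux from \<open>A1\<close> to \<open>A2\<close> is
  strictly larger for \<open>E1\<close>, because for \<open>E2\<close> the supremum is attained: it is positive, and only finitely many
  points of \<open>A\<close> have \<open>E2\<close> above a positive level. This contradicts the balance.\<close>

lemma max_balance_le:
  assumes E1: "deviability E1" "max_balance D E1 A"
    and E2: "deviability E2" "max_balance D E2 A" "E2 A = 1" and a: "a \<in> A"
  shows "E1 {a} \<le> E2 {a}"
proof (rule ccontr)
  assume less: "\<not> E1 {a} \<le> E2 {a}"
  have fin: "finite {b \<in> A. c \<le> E2 {b}}" if "0 < c" for c
  proof -
    have "{b \<in> A. c \<le> E2 {b}} = A \<inter> {x. c \<le> E2 {x}}" by blast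
    then show ?thesis using locally_finite[OF deviability_density(5)[OF E2(1) that]] by simp
  qed
  have "1 / 2 < sup0 ((\<lambda>b. E2 {b}) ` A)"
    using E2(3) deviability_density(3)[OF E2(1), of A] by simp
  then obtain m where "m \<in> A" "sup0 ((\<lambda>b. E2 {b}) ` A) \<le> E2 {m}"
    using sup0_attained[OF fin[of "1 / 2"]] by auto
  then have m: "m \<in> A" "E2 {m} = 1"
    using E2(3) deviability_density(2)[OF E2(1), of "{m}"] deviability_density(3)[OF E2(1), of A] by auto
  define A1 where "A1 = {b \<in> A. E2 {b} < E1 {b}}"
  define A2 where "A2 = {b \<in> A. E1 {b} \<le> E2 {b}}"
  have sub: "A1 \<subseteq> A" "A2 \<subseteq> A" by (auto simp: A1_def A2_def)
  have aA1: "a \<in> A1" using a less by (simp add: A1_def)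
  have mA2: "m \<in> A2" using m deviability_density(2)[OF E1(1), of "{m}"] by (simp add: A2_def)
  have part: "A1 \<noteq> {} \<and> A2 \<noteq> {} \<and> A1 \<inter> A2 = {} \<and> A1 \<union> A2 = A"
    using aA1 mA2 by (auto simp: A1_def A2_def)
  then have bal: "max_flux D E1 A1 A2 = max_flux D E1 A2 A1" "max_flux D E2 A1 A2 = max_flux D E2 A2 A1"
    using E1(2) E2(2) unfolding max_balance_def by blast+
  define v where "v = max_flux D E2 A1 A2"
  have "max_flux D E1 A2 A1 \<le> max_flux D E2 A2 A1"
    unfolding max_flux_A[OF sub(2), of E1]
  proof (intro sup0_least max_flux_nonneg E2 sub)
    fix z assume "z \<in> (\<lambda>b. E1 {b} * reach_set b A1) ` A2"
    then obtain b where b: "b \<in> A2" "z = E1 {b} * reach_set b A1" by blast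
    have "z \<le> E2 {b} * reach_set b A1" using b by (auto simp: A2_def intro: mult_right_mono reach_set_nonneg)
    then show "z \<le> max_flux D E2 A2 A1" using max_flux_ge[OF E2(1) sub(2) b(1), of A1] by linarith
  qed
  then have E1v: "max_flux D E1 A1 A2 \<le> v" using bal by (simp add: v_def)
  have "0 < E2 {m} * reach m a" using m a reach_A_pos by simp
  also have "\<dots> \<le> v" using max_flux_ge_reach[OF E2(1) sub(2) mA2 aA1] bal by (simp add: v_def)
  finally have v0: "0 < v" .
  have "finite {b \<in> A1. v / 2 \<le> E2 {b} * reach_set b A2}"
  proof (rule finite_subset[OF _ fin[of "v / 2"]])
    have "v / 2 \<le> E2 {b}" if "v / 2 \<le> E2 {b} * reach_set b A2" for b
    proof -
      have "E2 {b} * reach_set b A2 \<le> E2 {b} * 1"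
        by (intro mult_left_mono reach_set_le_1 deviability_density(1)[OF E2(1)])
      with that show ?thesis by simp
    qed
    then show "{b \<in> A1. v / 2 \<le> E2 {b} * reach_set b A2} \<subseteq> {b \<in> A. v / 2 \<le> E2 {b}}"
      using sub by blast
  qed (use v0 in simp)
  then obtain b where b: "b \<in> A1" "v \<le> E2 {b} * reach_set b A2"
    using sup0_attained[of A1 "v / 2" "\<lambda>b. E2 {b} * reach_set b A2"] v0
    unfolding v_def max_flux_A[OF sub(1)] by auto
  then have "0 < reach_set b A2"
    using v0 reach_set_nonneg[of b A2] by (cases "reach_set b A2 = 0") auto
  then have "E2 {b} * reach_set b A2 < E1 {b} * reach_set b A2" using b by (simp add: A1_def)
  also have "\<dots> \<le> max_flux D E1 A1 A2" by (rule max_flux_ge[OF E1(1) sub(1) b(1)])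
  finally show False using E1v b by simp
qed

lemma near_reach:
  assumes \<mu>: "\<mu> < 1" shows "\<exists>\<delta>>0. \<forall>x'\<in>ball x \<delta>. \<mu> < reach x x' \<and> \<mu> < reach x' x"
proof -
  obtain \<delta> t0 t1 where \<delta>: "0 < \<delta>" "0 \<le> t0" "0 \<le> t1"
      "\<And>x'. dist x x' < \<delta> \<Longrightarrow> \<mu> < trans_dens D x t0 x' \<and> \<mu> < trans_dens D x' t1 x"
    using local_control[of "1 - \<mu>" x] \<mu> by auto
  have "\<mu> < reach x x' \<and> \<mu> < reach x' x" if "x' \<in> ball x \<delta>" for x'
    using \<delta>(4)[of x'] that trans_dens_le_reach[OF \<delta>(2), of x x'] trans_dens_le_reach[OF \<delta>(3), of x' x]
    by simp
  then show ?thesis using \<delta>(1) by blast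
qed

text \<open>The flux through \<open>x\<close> into \<open>B\<close>. It is continuous in \<open>x\<close>: a move to a nearby point and back costs
  little, and where \<open>e\<close> vanishes continuity follows from the upper semicontinuity of \<open>e\<close>.\<close>

definition outflow :: "'a set \<Rightarrow> 'a \<Rightarrow> real"
  where "outflow B x = e x * reach_set x B"

lemma outflow_nonneg: "0 \<le> outflow B x"
  unfolding outflow_def by (intro mult_nonneg_nonneg e_nonneg reach_set_nonneg)

lemma outflow_le: "outflow B x \<le> e x"
  unfolding outflow_def using mult_left_mono[OF reach_set_le_1 e_nonneg] by simp

lemma outflow_near:
  assumes x: "0 < e x" and \<eta>: "\<eta> < 1"
  shows "\<exists>\<delta>>0. \<forall>x'\<in>ball x \<delta>. \<eta> * outflow B x \<le> outflow B x' \<and> \<eta> * outflow B x' \<le> outflow B x"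
proof -
  define \<mu> where "\<mu> = sqrt (max \<eta> 0)"
  have \<mu>: "0 \<le> \<mu>" "\<mu> < 1" "\<eta> \<le> \<mu> * \<mu>" using \<eta> by (auto simp: \<mu>_def)
  have step: "\<eta> * outflow B y \<le> outflow B z"
    if pos: "0 < e y" "0 < e z" and yz: "\<mu> < reach y z" "\<mu> < reach z y" for y z
  proof -
    have "\<eta> * outflow B y \<le> \<mu> * \<mu> * outflow B y" by (intro mult_right_mono \<mu> outflow_nonneg)
    also have "\<dots> = (e y * \<mu>) * (\<mu> * reach_set y B)" by (simp add: outflow_def)
    also have "\<dots> \<le> e z * reach_set z B"
    proof (intro mult_mono)
      have "e y * \<mu> \<le> e y * reach y z" using pos yz by (intro mult_left_mono) auto
      then show "e y * \<mu> \<le> e z" using e_reach[of y z] by linarith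
      show "\<mu> * reach_set y B \<le> reach_set z B"
      proof (rule mult_reach_set_le[OF _ \<mu>(1) reach_set_nonneg])
        fix b assume "b \<in> B"
        have "\<mu> * reach y b \<le> reach z y * reach y b" using yz by (intro mult_right_mono reach_nonneg) auto
        also have "\<dots> \<le> reach z b" by (rule reach_trans[OF pos(2)])
        also have "\<dots> \<le> reach_set z B" by (rule reach_set_ge[OF \<open>b \<in> B\<close>])
        finally show "\<mu> * reach y b \<le> reach_set z B" .
      qed
    qed (auto intro: e_nonneg mult_nonneg_nonneg \<mu> reach_set_nonneg)
    finally show ?thesis by (simp add: outflow_def)
  qed
  obtain \<delta> where \<delta>: "0 < \<delta>" "\<And>x'. x' \<in> ball x \<delta> \<Longrightarrow> \<mu> < reach x x' \<and> \<mu> < reach x' x"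
    using near_reach[OF \<mu>(2), of x] by blast
  have "0 < e x'" if "x' \<in> ball x \<delta>" for x'
  proof -
    have "0 < e x * reach x x'" using x \<delta>(2)[OF that] \<mu>(1) by simp
    then show ?thesis using e_reach[of x x'] by linarith
  qed
  then show ?thesis using \<delta> x by (intro exI[of _ \<delta>]) (auto intro!: step)
qed

lemma open_outflow_gt:
  assumes "0 \<le> \<theta>" shows "open {x. \<theta> < outflow B x}"
  unfolding open_contains_ball
proof (intro ballI)
  fix x assume "x \<in> {x. \<theta> < outflow B x}"
  then have x: "\<theta> < outflow B x" by simp
  then have "0 < e x" "0 < outflow B x" using assms outflow_le[of B x] by auto
  have "\<theta> / outflow B x < 1" using x \<open>0 < outflow B x\<close> by simp
  then obtain \<eta> where \<eta>: "\<theta> / outflow B x < \<eta>" "\<eta> < 1" using dense by blast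
  obtain \<delta> where "0 < \<delta>" "\<And>x'. x' \<in> ball x \<delta> \<Longrightarrow> \<eta> * outflow B x \<le> outflow B x'"
    using outflow_near[OF \<open>0 < e x\<close> \<eta>(2), of B] by blast
  moreover have "\<theta> < \<eta> * outflow B x" using \<eta>(1) \<open>0 < outflow B x\<close> by (simp add: field_simps)
  ultimately show "\<exists>\<delta>>0. ball x \<delta> \<subseteq> {x. \<theta> < outflow B x}"
    by (intro exI[of _ \<delta>]) (auto intro: less_le_trans)
qed

lemma open_outflow_lt: "open {x. outflow B x < \<theta>}"
  unfolding open_contains_ball
proof (intro ballI)
  fix x assume "x \<in> {x. outflow B x < \<theta>}"
  then have x: "outflow B x < \<theta>" by simp
  have \<theta>: "0 < \<theta>" using x outflow_nonneg[of B x] by simp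
  show "\<exists>\<delta>>0. ball x \<delta> \<subseteq> {x. outflow B x < \<theta>}"
  proof (cases "e x < \<theta>")
    case True
    then obtain \<delta> where "0 < \<delta>" "ball x \<delta> \<subseteq> {x. e x < \<theta>}"
      using openE[OF local_ld_usc[OF ld r, of \<theta>], of x] by auto
    moreover have "{x. e x < \<theta>} \<subseteq> {x. outflow B x < \<theta>}" using outflow_le by (auto intro: le_less_trans)
    ultimately show ?thesis by blast
  next
    case False
    then have "0 < e x" using \<theta> by simp
    have "outflow B x / \<theta> < 1" using x \<theta> by simp
    then obtain \<eta> where \<eta>: "outflow B x / \<theta> < \<eta>" "\<eta> < 1" using dense by blast
    have \<eta>0: "0 < \<eta>" using \<eta>(1) \<theta> outflow_nonneg[of B x] by (meson divide_nonneg_pos le_less_trans)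
    obtain \<delta> where \<delta>: "0 < \<delta>" "\<And>x'. x' \<in> ball x \<delta> \<Longrightarrow> \<eta> * outflow B x' \<le> outflow B x"
      using outflow_near[OF \<open>0 < e x\<close> \<eta>(2), of B] by blast
    have "outflow B x' < \<theta>" if "x' \<in> ball x \<delta>" for x'
    proof -
      have "outflow B x < \<eta> * \<theta>" using \<eta>(1) \<theta> by (simp add: field_simps)
      then have "\<eta> * outflow B x' < \<eta> * \<theta>" using \<delta>(2)[OF that] by linarith
      then show ?thesis using \<eta>0 by simp
    qed
    then show ?thesis using \<delta>(1) by blast
  qed
qed

text \<open>No point \<open>y\<close> can receive flux about \<open>v'\<close> from \<open>A2\<close> and send flux about \<open>v'\<close> to \<open>A1\<close> when
  \<open>v'\<close> exceeds \<open>v\<close> and the square of \<open>v'\<close> exceeds \<open>v * u\<close>. Let \<open>d \<in> A\<close> be almost freely reachable from \<open>y\<close>, and let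
  \<open>b \<in> A\<close> nearly realise \<open>e y\<close>. If \<open>d \<in> A1\<close>, then the flux from \<open>c\<close> through \<open>y\<close> to \<open>d\<close> is
  almost \<open>v'\<close>. If \<open>b \<in> A2\<close>, then the flux from \<open>b\<close> through \<open>y\<close> to \<open>A1\<close> is almost \<open>v'\<close>. In the remaining
  case the flux from \<open>b\<close> to \<open>d\<close> shows that \<open>e y\<close> is at most about \<open>u\<close>, so \<open>reach_set y A1\<close> is
  at least about \<open>v' / u\<close>, and the flux from \<open>c\<close> through \<open>y\<close> to \<open>A1\<close> is at least about the square
  of \<open>v'\<close> divided by \<open>u\<close>.\<close>

lemma crossing_contradiction:
  assumes part: "A1 \<union> A2 = A"
    and v: "0 \<le> v" and le_v: "\<And>a b. a \<in> A1 \<Longrightarrow> b \<in> A2 \<Longrightarrow> e b * reach b a \<le> v"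
    and le_u: "\<And>a b. a \<in> A1 \<Longrightarrow> b \<in> A2 \<Longrightarrow> e a * reach a b \<le> u"
    and v': "0 < v'" "v < \<eta> ^ 3 * v'" "v * u < \<eta> ^ 3 * v' ^ 2" and \<eta>: "0 < \<eta>" "\<eta> < 1"
    and c: "c \<in> A2" "v' \<le> e c * reach c y" and y: "\<eta> * v' \<le> outflow A1 y"
  shows False
proof -
  have pow: "\<eta> ^ 3 \<le> \<eta>" "\<eta> ^ 3 \<le> \<eta> ^ 2"
    using \<eta> power_decreasing[of 1 3 \<eta>] power_decreasing[of 2 3 \<eta>] by auto
  have ey: "0 < e y" using e_reach[of c y] c v' by linarith
  have ec: "0 < e c" using e_A_pos c part by blast
  have via: "e b * reach b y * reach_set y A1 \<le> v" if "b \<in> A2" for b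
  proof (rule mult_reach_set_le[OF _ mult_nonneg_nonneg[OF e_nonneg reach_nonneg] v])
    fix a assume "a \<in> A1"
    have "0 < e b" using e_A_pos that part by blast
    then have "e b * reach b y * reach y a \<le> e b * reach b a"
      by (simp add: mult.assoc mult_left_mono reach_trans)
    then show "e b * reach b y * reach y a \<le> v" using le_v[OF \<open>a \<in> A1\<close> that] by linarith
  qed
  obtain d where d: "d \<in> A" "\<eta> < reach y d" using reach_A[OF ey \<eta>(2)] by blast
  have "0 \<le> \<eta> * e y" "\<eta> * e y < e y" using \<eta> ey by auto
  then obtain b where b: "b \<in> A" "\<eta> * e y < e b * reach b y" using e_from_A by blast
  have eb: "0 < e b" using e_A_pos b by blast
  consider "d \<in> A1" | "d \<in> A2" "b \<in> A1" | "b \<in> A2" using b d part by blast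
  then show False
  proof cases
    case 1
    have "\<eta> ^ 3 * v' \<le> v' * \<eta>" using pow v' by (simp add: mult.commute)
    also have "\<dots> \<le> (e c * reach c y) * reach y d" using c d \<eta> by (intro mult_mono) (auto intro: mult_nonneg_nonneg e_nonneg reach_nonneg)
    also have "\<dots> \<le> e c * reach c d" using ec by (simp add: mult.assoc mult_left_mono reach_trans)
    also have "\<dots> \<le> v" by (rule le_v[OF 1 c(1)])
    finally show False using v' by simp
  next
    case 2
    have "\<eta> ^ 2 * e y = (\<eta> * e y) * \<eta>" by (simp add: power2_eq_square)
    also have "\<dots> \<le> (e b * reach b y) * reach y d"
      using b d \<eta> by (intro mult_mono[of "\<eta> * e y"]) (auto intro: mult_nonneg_nonneg e_nonneg reach_nonneg)
    also have "\<dots> \<le> e b * reach b d" using eb by (simp add: mult.assoc mult_left_mono reach_trans)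
    also have "\<dots> \<le> u" by (rule le_u[OF 2(2,1)])
    finally have u: "\<eta> ^ 2 * e y \<le> u" .
    have "v' * reach_set y A1 \<le> e c * reach c y * reach_set y A1"
      by (intro mult_right_mono c reach_set_nonneg)
    then have vQ: "v' * reach_set y A1 \<le> v" using via[OF c(1)] by linarith
    have "\<eta> ^ 3 * v' ^ 2 = (v' * \<eta> ^ 2) * (\<eta> * v')" by (simp add: power2_eq_square power3_eq_cube)
    also have "\<dots> \<le> (v' * \<eta> ^ 2) * outflow A1 y" using y v' by (intro mult_left_mono) auto
    also have "\<dots> = (v' * reach_set y A1) * (\<eta> ^ 2 * e y)" by (simp add: outflow_def)
    also have "\<dots> \<le> v * u" using vQ u v' ey by (intro mult_mono) (auto intro: mult_nonneg_nonneg reach_set_nonneg v)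
    finally show False using v' by simp
  next
    case 3
    have "\<eta> ^ 3 * v' \<le> \<eta> ^ 2 * v'" using pow v' by simp
    also have "\<dots> = \<eta> * (\<eta> * v')" by (simp add: power2_eq_square)
    also have "\<dots> \<le> \<eta> * outflow A1 y" using y \<eta> by (intro mult_left_mono) auto
    also have "\<dots> = (\<eta> * e y) * reach_set y A1" by (simp add: outflow_def)
    also have "\<dots> \<le> (e b * reach b y) * reach_set y A1" using b by (intro mult_right_mono reach_set_nonneg) auto
    also have "\<dots> \<le> v" using via[OF 3] .
    finally show False using v' by simp
  qed
qed

text \<open>If the flux \<open>u\<close> from \<open>A1\<close> to \<open>A2\<close> exceeded the flux \<open>v\<close> back, the flow out of
  \<open>B = {x. v' \<le> outflow A1 x}\<close> would have a rate above \<open>v'\<close>, hence by \<open>joint_flux\<close> so would the flow into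
  \<open>B\<close>; a long trajectory realising it contradicts \<open>crossing_contradiction\<close>.\<close>

lemma max_flux_le:
  assumes E: "deviability E" "\<And>x. E {x} = e x" and part: "A1 \<union> A2 = A"
  shows "max_flux D E A1 A2 \<le> max_flux D E A2 A1"
proof (rule ccontr)
  define u where "u = max_flux D E A1 A2"
  define v where "v = max_flux D E A2 A1"
  assume "\<not> max_flux D E A1 A2 \<le> max_flux D E A2 A1"
  then have vu: "v < u" by (simp add: u_def v_def)
  have sub: "A1 \<subseteq> A" "A2 \<subseteq> A" using part by auto
  have v0: "0 \<le> v" unfolding v_def by (rule max_flux_nonneg[OF E(1) sub(2)])
  have le_v: "e b * reach b a \<le> v" if "a \<in> A1" "b \<in> A2" for a b
    using max_flux_ge_reach[OF E(1) sub(2) that(2,1)] by (simp add: v_def E(2))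
  have le_u: "e a * reach a b \<le> u" if "a \<in> A1" "b \<in> A2" for a b
    using max_flux_ge_reach[OF E(1) sub(1) that] by (simp add: u_def E(2))
  \<comment> \<open>The threshold \<open>v'\<close> is so close to \<open>u\<close> that there is room for a factor \<open>\<eta> ^ 3 < 1\<close> in the
    strict inequalities \<open>v < v'\<close> and \<open>v * u < v' ^ 2\<close>.\<close>
  have "v * u < u * u" using vu v0 by (intro mult_strict_right_mono) auto
  then have "sqrt (v * u) < sqrt (u * u)" by (rule real_sqrt_less_mono)
  moreover have "sqrt (u * u) = u" using vu v0 by simp
  ultimately have "max v (sqrt (v * u)) < u" using vu by simp
  then obtain v' where v': "v < v'" "sqrt (v * u) < v'" "v' < u"
    using dense[of "max v (sqrt (v * u))" u] by auto
  have v'0: "0 < v'" using v0 v' by simp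
  have "v * u = sqrt (v * u) ^ 2" using v0 vu by simp
  also have "\<dots> < v' ^ 2" using v'(2) v0 vu by (intro power_strict_mono) auto
  finally have "max (v / v') (v * u / v' ^ 2) < 1" using v' v'0 by simp
  then obtain \<nu> where \<nu>: "max (v / v') (v * u / v' ^ 2) < \<nu>" "\<nu> < 1" using dense by blast
  have \<nu>0: "0 < \<nu>" using \<nu>(1) v0 v'0 by (meson divide_nonneg_pos le_less_trans max.strict_boundedE)
  define \<eta> where "\<eta> = root 3 \<nu>"
  have \<eta>: "0 < \<eta>" "\<eta> < 1" "\<eta> ^ 3 = \<nu>" using \<nu> \<nu>0 by (auto simp: \<eta>_def)
  have \<eta>v: "v < \<eta> ^ 3 * v'" "v * u < \<eta> ^ 3 * v' ^ 2"
    using \<nu>(1) v'0 unfolding \<eta>(3) by (auto simp: field_simps)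
  obtain a0 b0 where ab: "a0 \<in> A1" "b0 \<in> A2" "v' < e a0 * reach a0 b0"
    using less_max_flux[OF E(1) sub(1) less_imp_le[OF v'0], of A2] v'(3) by (auto simp: u_def E(2))
  \<comment> \<open>The rates \<open>v' < c < w\<close>: the outflow from \<open>B\<close> has rate at least \<open>w\<close>, the trajectory found for the inflow has
    rate above \<open>c\<close>, and its diversion through \<open>A\<close> still has rate above \<open>v'\<close>.\<close>
  obtain w where w: "v' < w" "w < e a0 * reach a0 b0" using dense[OF ab(3)] by blast
  obtain c where c: "v' < c" "c < w" using dense[OF w(1)] by blast
  have c0: "0 < c" and w0: "0 < w" using v'0 c by auto
  have "v' / c < 1" using c c0 by simp
  then obtain \<eta>1 where \<eta>1: "v' / c < \<eta>1" "\<eta>1 < 1" using dense by blast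
  obtain T where T: "0 \<le> T" "\<And>x Y t. T \<le> t \<Longrightarrow> c \<le> e x * D x {Y} \<Longrightarrow>
      \<exists>a\<in>A. \<eta>1 * c \<le> e x * (reach x a * reach a (path_of Y t))"
    using long_path_via_A[OF c0 \<eta>1(2)] by blast
  have a0: "a0 \<in> A" "0 < e a0" using ab(1) sub e_A_pos by auto
  have wr: "w / e a0 < reach a0 b0" using w(2) a0 by (simp add: field_simps)
  have we: "0 \<le> w / e a0" using w0 a0 by simp
  obtain Y0 t0 where Y0: "0 \<le> t0" "path_of Y0 t0 = b0" "w / e a0 < D a0 {Y0}"
    using less_reach[OF we wr] by blast
  \<comment> \<open>The inflow trajectory is located only up to one unit of time, hence \<open>T + 1\<close>.\<close>
  define t where "t = max t0 (T + 1)"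
  have t: "0 \<le> t" "t0 \<le> t" "T + 1 \<le> t" using T Y0 by (auto simp: t_def)
  have "w / e a0 < trans_dens D a0 t b0"
    using trans_dens_A_mono[OF a0(1) Y0(1) t(2), of b0] trans_dens_ge[OF Y0(2), of a0] Y0(3) by linarith
  then obtain Y1 where Y1: "path_of Y1 t = b0" "w / e a0 < D a0 {Y1}" using less_trans_dens[OF we] by blast
  have w1: "w < e a0 * D a0 {Y1}" using Y1(2) a0 by (simp add: field_simps)
  define B where "B = - {x. outflow A1 x < v'}"
  have Bc: "closed B" unfolding B_def using open_outflow_lt by (simp add: closed_Compl)
  have B: "B \<in> sets borel" "- B \<in> sets borel" using Bc by auto
  have gt: "open {x. v' < outflow A1 x}" using v'0 by (intro open_outflow_gt) simp
  have "e a0 * 1 \<le> outflow A1 a0"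
    unfolding outflow_def using a0 reach_set_ge[OF ab(1), of a0] reach_self[OF a0(1)] by simp
  moreover have "e a0 * reach a0 b0 \<le> e a0 * 1" using a0 by (intro mult_left_mono reach_le_1) auto
  ultimately have "a0 \<in> {x. v' < outflow A1 x}" using ab(3) by simp
  then obtain \<rho>1 where \<rho>1: "0 < \<rho>1" "ball a0 \<rho>1 \<subseteq> {x. v' < outflow A1 x}" using openE[OF gt] by blast
  have "outflow A1 b0 \<le> v"
    unfolding outflow_def using ab(2) by (intro mult_reach_set_le e_nonneg v0 le_v)
  then have "b0 \<in> - B" using v' by (simp add: B_def)
  then obtain \<rho>2 where \<rho>2: "0 < \<rho>2" "ball b0 \<rho>2 \<subseteq> - B" using openE[of "- B" b0] Bc by auto
  define \<rho> where "\<rho> = min \<rho>1 \<rho>2"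
  have \<rho>: "0 < \<rho>" "ball a0 \<rho> \<subseteq> B" "ball b0 \<rho> \<subseteq> - B"
    using \<rho>1 \<rho>2 by (auto simp: \<rho>_def B_def subset_iff)
  have big: "\<forall>\<^sub>F k in sequentially. w ^ r k \<le> joint (r k) t (- B) B"
    using joint_ball_lower[OF ld r less_imp_le[OF w0] w1 t(1) \<rho>(1)]
  proof eventually_elim
    case (elim k)
    have "joint (r k) t (ball a0 \<rho>) (ball (path_of Y1 t) \<rho>) \<le> joint (r k) t B (- B)"
      using \<rho> B t Y1(1) by (intro joint_mono) auto
    then show ?case using elim joint_flux[OF t(1) B(1), of "r k"] by simp
  qed
  obtain x y where xy: "x \<in> closure (- B)" "y \<in> closure B" "\<forall>\<rho>>0. \<exists>Y s. 0 \<le> s \<and> \<bar>s - t\<bar> \<le> 1 \<and>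
      path_of Y s \<in> ball y \<rho> \<and> c < e x * D x {Y}"
    using joint_limit_pair[OF ld r t(1) B(2,1) less_imp_le[OF c0] c(2) big] by blast
  have "closure (- B) \<subseteq> - {x. v' < outflow A1 x}"
    using gt by (intro closure_minimal) (auto simp: B_def closed_Compl)
  then have fx: "outflow A1 x \<le> v'" using xy(1) by auto
  have fy: "v' \<le> outflow A1 y" using xy(2) Bc by (simp add: B_def not_less)
  then have "0 < e y" using v'0 outflow_le[of A1 y] by linarith
  then obtain \<delta> where \<delta>: "0 < \<delta>" "\<And>z. z \<in> ball y \<delta> \<Longrightarrow> \<eta> * outflow A1 y \<le> outflow A1 z"
    using outflow_near[OF _ \<eta>(2), of y A1] by blast
  obtain Y s where Y: "0 \<le> s" "\<bar>s - t\<bar> \<le> 1" "path_of Y s \<in> ball y \<delta>" "c < e x * D x {Y}"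
    using xy(3) \<delta>(1) by blast
  \<comment> \<open>The trajectory visits \<open>?z\<close>, a point near \<open>y\<close>, and there the outflow is still almost \<open>v'\<close>.\<close>
  let ?z = "path_of Y s"
  have "T \<le> s" using Y(2) t(3) by simp
  then obtain d where d: "d \<in> A" "\<eta>1 * c \<le> e x * (reach x d * reach d ?z)"
    using T(2)[OF _ less_imp_le[OF Y(4)]] by blast
  have "v' < \<eta>1 * c" using \<eta>1(1) c0 by (simp add: field_simps)
  then have v'd: "v' < (e x * reach x d) * reach d ?z" using d(2) by (simp add: mult.assoc)
  have "d \<notin> A1"
  proof
    assume "d \<in> A1"
    have "(e x * reach x d) * reach d ?z \<le> (e x * reach x d) * 1"
      by (intro mult_left_mono reach_le_1 mult_nonneg_nonneg e_nonneg reach_nonneg)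
    also have "\<dots> \<le> outflow A1 x"
      unfolding outflow_def using reach_set_ge[OF \<open>d \<in> A1\<close>, of x] e_nonneg[of x] by (simp add: mult_left_mono)
    finally show False using v'd fx by simp
  qed
  then have "d \<in> A2" using d(1) part by blast
  moreover have "v' \<le> e d * reach d ?z"
    using v'd mult_right_mono[OF e_reach[of x d] reach_nonneg[of d ?z]] by linarith
  moreover have "\<eta> * v' \<le> outflow A1 ?z"
    using \<delta>(2)[OF Y(3)] mult_left_mono[OF fy less_imp_le[OF \<eta>(1)]] by linarith
  ultimately show False
    using crossing_contradiction[OF part v0 le_v le_u v'0 \<eta>v \<eta>(1,2)] by blast
qed

lemma max_balance_e:
  assumes E: "deviability E" "\<And>x. E {x} = e x" shows "max_balance D E A"
  unfolding max_balance_def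
  using max_flux_le[OF E] by (metis antisym sup_commute)

lemma normalised_e:
  assumes E: "deviability E" "\<And>x. E {x} = e x" shows "E A = 1"
proof (rule antisym[OF deviability_density(2)[OF E(1)] dense_le])
  fix c :: real assume "c < 1"
  then obtain a where "a \<in> A" "c < e a" using e_A_sup by blast
  then show "c \<le> E A" using deviability_mono[OF E(1), of a A] E(2)[of a] by simp
qed

lemma flux_from_A:
  assumes E: "deviability E" "\<And>x. E {x} = e x" shows "E {x} = max_flux D E A {x}"
proof (rule antisym)
  show "E {x} \<le> max_flux D E A {x}"
  proof (rule dense_le)
    fix c assume c: "c < E {x}"
    show "c \<le> max_flux D E A {x}"
    proof (cases "0 \<le> c")
      case True
      then obtain a where "a \<in> A" "c < e a * reach a x" using e_from_A c unfolding E(2) by blast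
      then show ?thesis using max_flux_ge_reach[OF E(1) order_refl, of a x "{x}"] by (simp add: E(2))
    qed (use max_flux_nonneg[OF E(1) order_refl, of "{x}"] in simp)
  qed
  show "max_flux D E A {x} \<le> E {x}"
    unfolding max_flux_A[OF order_refl] E(2)
    by (intro sup0_least) (auto intro!: mult_reach_set_le e_reach e_nonneg)
qed

end

section \<open>The stationary LD limit\<close>

context stationary_ld
begin

text \<open>Two limit densities, possibly along disjoint subsequences, agree on \<open>A\<close> by balance, and
  then everywhere since both are the flux from \<open>A\<close>.\<close>

lemma local_ld_unique:
  assumes "strict_mono r1" "local_ld r1 P e1" "strict_mono r2" "local_ld r2 P e2"
  shows "e1 x = e2 x"
proof -
  interpret L1: stationary_limit P M X \<kappa> D A r1 e1 by unfold_locales (rule assms)+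
  interpret L2: stationary_limit P M X \<kappa> D A r2 e2 by unfold_locales (rule assms)+
  let ?E1 = "\<lambda>S. sup0 (e1 ` S)" and ?E2 = "\<lambda>S. sup0 (e2 ` S)"
  have E1: "deviability ?E1" "\<And>x. ?E1 {x} = e1 x"
    using local_ld_deviability assms by (auto simp: sup0_def)
  have E2: "deviability ?E2" "\<And>x. ?E2 {x} = e2 x"
    using local_ld_deviability assms by (auto simp: sup0_def)
  have eq: "?E1 {a} = ?E2 {a}" if "a \<in> A" for a
    by (rule antisym)
      (rule L1.max_balance_le that E1(1) E2(1) L1.max_balance_e[OF E1] L2.max_balance_e[OF E2]
        L1.normalised_e[OF E1] L2.normalised_e[OF E2])+
  have "e1 x = max_flux D ?E1 A {x}" using L1.flux_from_A[OF E1] E1(2) by metis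
  also have "\<dots> = max_flux D ?E2 A {x}"
    unfolding max_flux_def using eq by (intro arg_cong[of _ _ sup0] image_cong) auto
  also have "\<dots> = e2 x" using L2.flux_from_A[OF E2] E2(2) by metis
  finally show ?thesis .
qed

text \<open>A subsequence violating convergence would, by compactness, have a further subsequence with a limit
  density, and that density is \<open>E\<close>.\<close>

lemma ld_converges_full_sequence:
  assumes E: "deviability E" and r: "strict_mono r" and ld: "local_ld r P (\<lambda>x. E {x})"
  shows "ld_converges (\<lambda>n. n) P E"
  unfolding ld_converges_def
proof (intro allI impI, rule ccontr)
  fix f :: "'a \<Rightarrow> real"
  assume f: "continuous_on UNIV f \<and> bounded (range f) \<and> (\<forall>x. 0 \<le> f x)"
  let ?L = "sup0 (range (\<lambda>x. f x * E {x}))" and ?I = "\<lambda>n. root n (\<integral>x. f x ^ n \<partial>P n)"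
  assume "\<not> ?I \<longlonglongrightarrow> ?L"
  then obtain \<epsilon> where \<epsilon>: "0 < \<epsilon>" "\<not> (\<forall>\<^sub>F n in sequentially. dist (?I n) ?L < \<epsilon>)"
    unfolding tendsto_iff by blast
  obtain s0 :: "nat \<Rightarrow> nat" where s0: "strict_mono s0" "\<forall>n. \<not> dist (?I (s0 n)) ?L < \<epsilon>"
    using not_eventually_sequentiallyD[OF \<epsilon>(2)] by blast
  obtain s e where s: "strict_mono s" "local_ld (s0 \<circ> s) P e"
    using exists_local_ld_subsequence[OF s0(1)] by blast
  have mono: "strict_mono (s0 \<circ> s)" using s0(1) s(1) by (rule strict_mono_o)
  have "e = (\<lambda>x. E {x})" using local_ld_unique[OF mono s(2) r ld] by blast
  then have "ld_converges (s0 \<circ> s) (\<lambda>k. P ((s0 \<circ> s) k)) E"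
    using local_ld_imp_ld_converges[OF _ mono E] s(2) by simp
  then have "(\<lambda>k. ?I ((s0 \<circ> s) k)) \<longlonglongrightarrow> ?L" using f unfolding ld_converges_def by blast
  then have "\<forall>\<^sub>F k in sequentially. dist (?I ((s0 \<circ> s) k)) ?L < \<epsilon>" using \<epsilon>(1) by (rule tendstoD)
  then obtain k where "dist (?I ((s0 \<circ> s) k)) ?L < \<epsilon>" using eventually_happens[of _ sequentially] by auto
  then show False using s0(2) by simp
qed

end

theorem theorem2p1:
  fixes M :: "'w measure"
    and X :: "nat \<Rightarrow> 'w \<Rightarrow> 'a::metric_space skorohod"
    and P :: "nat \<Rightarrow> 'a measure"
    and \<kappa> :: "nat \<Rightarrow> 'a \<Rightarrow> 'a skorohod measure"
    and D :: "'a \<Rightarrow> 'a skorohod set \<Rightarrow> real"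
    and A :: "'a set"
    and E :: "'a set \<Rightarrow> real"
  assumes prob: "prob_space M" "complete_measure M"
    and process: "\<And>n t. 0 \<le> t \<Longrightarrow> (\<lambda>\<omega>. path_of (X n \<omega>) t) \<in> borel_measurable M"
    and P: "\<And>n. prob_space (P n)" "\<And>n. sets (P n) = sets borel"
    and invariant: "\<And>n t \<Gamma>. 0 \<le> t \<Longrightarrow> \<Gamma> \<in> sets borel \<Longrightarrow>
      measure M {\<omega> \<in> space M. path_of (X n \<omega>) t \<in> \<Gamma>} = measure (P n) \<Gamma>"
    and H1_rcd: "\<And>n. regular_conditional_distribution M (X n) (\<lambda>\<omega>. path_of (X n \<omega>) 0) (\<kappa> n)"
    and H1_dev: "\<And>x. deviability (D x)"
    and H1_ld: "\<And>r xs x. strict_mono r \<Longrightarrow> (\<And>k. xs k \<in> measure_support (P (r k))) \<Longrightarrow>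
      xs \<longlonglongrightarrow> x \<Longrightarrow> ld_converges r (\<lambda>k. \<kappa> (r k) (xs k)) (D x)"
    and H1_cont: "\<And>x Y. \<not> continuous_on {0..} (path_of Y) \<Longrightarrow> D x {Y} = 0"
    and H2_usc: "upper_semicontinuous (\<lambda>(x, Y). D x {Y})"
    and H2_level: "\<And>\<gamma> K. 0 < \<gamma> \<Longrightarrow> \<gamma> \<le> 1 \<Longrightarrow> compact K \<Longrightarrow>
      compact (\<Union>x\<in>K. {Y. \<gamma> \<le> D x {Y}})"
    and H3: "\<And>x s Y. 0 \<le> s \<Longrightarrow>
      D x {Y} = D x (same_until s Y) * D (path_of Y s) {time_shift s Y}"
    and H4: "\<And>K. compact K \<Longrightarrow> finite (A \<inter> K)"
    and H4_1: "\<And>x Y. D x {Y} = 1 \<Longrightarrow> (INF t\<in>{0..}. infdist (path_of Y t) A) = 0"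
    and H4_2: "\<And>a Y. a \<in> A \<Longrightarrow> (\<And>t. 0 \<le> t \<Longrightarrow> path_of Y t = a) \<Longrightarrow> D a {Y} = 1"
    and H4_3: "\<And>a a'. a \<in> A \<Longrightarrow> a' \<in> A \<Longrightarrow> \<exists>t>0. 0 < trans_dens D a t a'"
    and H4_4: "\<And>\<epsilon>. 0 < \<epsilon> \<Longrightarrow> \<exists>\<delta>>0. \<forall>x. infdist x A < \<delta> \<longrightarrow>
      (\<exists>s0>0. \<exists>s1>0. \<exists>a\<in>A. 1 - \<epsilon> < trans_dens D x s0 a \<and> 1 - \<epsilon> < trans_dens D a s1 x)"
    and H4_5: "\<And>x \<epsilon>. 0 < \<epsilon> \<Longrightarrow> \<exists>\<delta>>0. \<exists>t0\<ge>0. \<exists>t1\<ge>0. \<forall>x'. dist x x' < \<delta> \<longrightarrow>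
      1 - \<epsilon> < trans_dens D x t0 x' \<and> 1 - \<epsilon> < trans_dens D x' t1 x"
    and H5: "\<And>K1 \<epsilon>. compact K1 \<Longrightarrow> 0 < \<epsilon> \<Longrightarrow> \<exists>K2. compact K2 \<and>
      Limsup at_top (\<lambda>t::real. ereal (sup0 ((\<lambda>x. trans_set D x t (- K2)) ` K1))) < ereal \<epsilon>"
    and tight: "exponentially_tight P"
    and limit_point: "ld_limit_point P E"
  shows "(max_balance D E A \<and> E A = 1 \<and>
      (\<forall>E'. deviability E' \<and> max_balance D E' A \<and> E' A = 1 \<longrightarrow> (\<forall>a\<in>A. E' {a} = E {a})))
    \<and> (\<forall>x. E {x} = max_flux D E A {x})
    \<and> ld_converges (\<lambda>n. n) P E"
proof -
  interpret stationary_ld P M X \<kappa> D A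
    by (intro stationary_ld.intro tight_sequence.intro stationary_ld_axioms.intro)
      (fact prob process P tight invariant H1_rcd H1_dev H1_ld H1_cont H2_usc H2_level H3 H4
        H4_1 H4_2 H4_3 H4_4 H4_5)+
  obtain r where E: "deviability E" and r: "strict_mono r" and conv: "ld_converges r (\<lambda>k. P (r k)) E"
    using limit_point unfolding ld_limit_point_def by blast
  have ld: "local_ld r P (\<lambda>x. E {x})"
    by (rule ld_converges_imp_local_ld[OF conv r P E])
  interpret stationary_limit P M X \<kappa> D A r "\<lambda>x. E {x}"
    by unfold_locales (rule r ld)+
  note balance = max_balance_e[OF E refl] and normalised = normalised_e[OF E refl]
  have "E' {a} = E {a}" if "deviability E' \<and> max_balance D E' A \<and> E' A = 1" "a \<in> A" for E' a
    using that max_balance_le[of E' E a] max_balance_le[of E E' a] E balance normalised by (simp add: order_antisym)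
  then show ?thesis
    using balance normalised flux_from_A[OF E refl] ld_converges_full_sequence[OF E r ld] by blast
qed

end
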